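(* Let $d,T\ge 1$ be integers and $L>0$. Let $f:\mathbb{R}^d\to\mathbb{R}$ be $L$-smooth and bounded below by $f^*>-\infty$, and let the stochastic gradient oracle be unbiased and have coordinate-wise affine variance noise with parameters $\boldsymbol{\sigma}_0,\boldsymbol{\sigma}_1$ (all as specified in the context). Let $\{x_s\}$ be generated by the Adam algorithm with parameters satisfying $$0\le\beta_1<\beta_2<1,\qquad \eta=C_0\sqrt{1-\beta_2},\qquad \epsilon=\epsilon_0\sqrt{1-\beta_2}$$ for some constants $C_0,\epsilon_0>0$. Then for every $\delta\in(0,1)$, with probability at least $1-\delta$, $$\|\nabla f(x_{t+1})\|^2\le G-L\sum_{i=1}^d\sum_{s=1}^t\eta_s\cdot\frac{(\nabla f(x_s)_i)^2}{a_{s,i}}\qquad\text{for all }t\in[T],$$ where $G$ and $a_{s,i}$ are defined in the context. As a consequence, with probability at least $1-\delta$, $\|\nabla f(x_t)\|^2\le G$ for all $t\in[T+1]$.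
   Context: Notation: $[n]=\{1,\dots,n\}$; $\|\cdot\|$, $\|\cdot\|_\infty$ are the $\ell_2$- and $\ell_\infty$-norms; $v_i$ is the $i$-th coordinate of $v\in\mathbb{R}^d$. $L$-smooth: $f$ is differentiable and $\|\nabla f(x)-\nabla f(y)\|\le L\|x-y\|$ for all $x,y$. Bounded below: $f(x)\ge f^*$ for all $x\in\mathbb{R}^d$. Oracle: a query at $x\in\mathbb{R}^d$ returns a random vector $g(x)\in\mathbb{R}^d$. Unbiased: $\mathbb{E}[g(x)\mid x]=\nabla f(x)$. Coordinate-wise affine variance noise: for each $i\in[d]$ and all $x$, $(g(x)_i-\nabla f(x)_i)^2\le\sigma_{0,i}^2+\sigma_{1,i}^2\,(\nabla f(x)_i)^2$ almost surely, where $\boldsymbol{\sigma}_0=(\sigma_{0,i})_i$, $\boldsymbol{\sigma}_1=(\sigma_{1,i})_i$ are vectors of positive reals. Each iteration makes a fresh query, so that, with $g_s=g(x_s)$, $\mathbb{E}[g_s\mid g_1,\dots,g_{s-1}]=\nabla f(x_s)$. Adam algorithm: given deterministic $x_1\in\mathbb{R}^d$, $\beta_1,\beta_2\in[0,1)$, $\epsilon,\eta>0$, $m_0=v_0=0$; for $s=1,\dots,T$ draw $g_s=(g_{s,i})_i=g(x_s)$ and for $i\in[d]$ set $m_{s,i}=\beta_1m_{s-1,i}+(1-\beta_1)g_{s,i}$, $v_{s,i}=\beta_2v_{s-1,i}+(1-\beta_2)g_{s,i}^2$, $\eta_s=\eta\sqrt{1-\beta_2^s}/(1-\beta_1^s)$,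 $\epsilon_s=\epsilon\sqrt{1-\beta_2^s}$, $x_{s+1,i}=x_{s,i}-\frac{\eta_s}{\sqrt{v_{s,i}}+\epsilon_s}m_{s,i}$. Proxy step-size: $a_{s,i}=\sqrt{\beta_2v_{s-1,i}+(1-\beta_2)\left(\sigma_{0,i}^2+(1+\sigma_{1,i}^2)(\nabla f(x_s)_i)^2\right)}+\epsilon_s$. Explicit quantities: $\Sigma_{\max}=\max\{1,\sqrt{(1+\beta_2)/\beta_2}-1\}$, $$\mathcal{F}(T)=1+\frac{2}{\epsilon^2}\left[\left(\|\boldsymbol{\sigma}_0\|_\infty^2+2(1+\|\boldsymbol{\sigma}_1\|_\infty^2)\|\nabla f(x_1)\|^2\right)T+\frac{2(1+\|\boldsymbol{\sigma}_1\|_\infty^2)dL^2C_0^2}{1-\beta_1/\beta_2}T^3\right],$$ $$\begin{aligned}G=\;&8L(f(x_1)-f^* )+\frac{256L^2C_0^2\beta_1^2d^2}{(1-\beta_1)^3(1-\beta_1/\beta_2)}+\frac{4L^2C_0^2\beta_1^2d}{(1-\beta_1)^2(1-\beta_1/\beta_2)}+\frac{48LC_0\|\boldsymbol{\sigma}_0\|_\infty}{1-\beta_1}d\log\left(\frac{dT}{\delta}\right)\\&+\frac{8LC_0\beta_1^2}{(1-\beta_1)^2(1-\beta_1/\beta_2)}\left[\frac{4\|\boldsymbol{\sigma}_0\|_\infty}{\beta_2}+\frac{\epsilon_0+\sqrt2\|\boldsymbol{\sigma}_0\|_\infty}{\sqrt{\beta_2}}+\frac{LC_0}{2}(1+4\Sigma_{\max}^2)\right]d\log\left(\frac{\mathcal{F}(T)}{\beta_2^T}\right)\\&+8\left(\frac{3L^2C_0^2}{(1-\beta_1)^2}+\frac{8L\|\boldsymbol{\sigma}_0\|_\infty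 C_0}{1-\beta_1}\right)d\log\left(\frac{\mathcal{F}(T)}{\beta_2^T}\right)+\frac{2304L^2C_0^2\|\boldsymbol{\sigma}_1\|_\infty^2}{(1-\beta_1)^2}d^2\log^2\left(\frac{dT}{\delta}\right)\\&+256\left[\frac{16L^2C_0^2\|\boldsymbol{\sigma}_1\|_\infty^2}{(1-\beta_1)^2}+\frac{9L^2C_0^2\beta_1^4(1+\|\boldsymbol{\sigma}_1\|_\infty^2)}{\beta_2^2(1-\beta_1)^4(1-\beta_1/\beta_2)^2}\right]d^2\log^2\left(\frac{\mathcal{F}(T)}{\beta_2^T}\right).\end{aligned}$$ *)

theory Defs
  imports "HOL-Probability.Probability"
begin

section \<open>Smooth functions\<close>

definition nabla :: "('a::real_inner \<Rightarrow> real) \<Rightarrow> 'a \<Rightarrow> 'a"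
  where "nabla f x = (THE D. GDERIV f x :> D)"

lemma nabla_eqI:
  assumes "GDERIV f x :> D"
  shows "nabla f x = D"
  unfolding nabla_def
proof (rule the_equality)
  show "GDERIV f x :> D" by fact
next
  fix E assume "GDERIV f x :> E"
  with assms have "(\<lambda>h. inner h E) = (\<lambda>h. inner h D)"
    unfolding gderiv_def using has_derivative_unique by blast
  then have "inner (E - D) E = inner (E - D) D" by (rule fun_cong)
  then have "inner (E - D) (E - D) = 0" by (simp add: inner_diff_right)
  then show "E = D" by simp
qed

lemma GDERIV_nabla:
  fixes f :: "'a::euclidean_space \<Rightarrow> real"
  assumes "f differentiable (at x)"
  shows "GDERIV f x :> nabla f x"
proof -
  obtain f' where f': "(f has_derivative f') (at x)"
    using assms unfolding differentiable_def by blast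
  then have lin: "linear f'" by (rule has_derivative_linear)
  have "f' = (\<lambda>h. inner h (adjoint f' 1))"
    using adjoint_works[OF lin, of _ 1] by simp
  then have "GDERIV f x :> adjoint f' 1"
    using f' unfolding gderiv_def by metis
  then show ?thesis using nabla_eqI by metis
qed

definition L_smooth :: "real \<Rightarrow> ('a::real_inner \<Rightarrow> real) \<Rightarrow> bool"
  where "L_smooth L f \<longleftrightarrow>
    (\<forall>x. f differentiable (at x)) \<and>
    (\<forall>x y. norm (nabla f x - nabla f y) \<le> L * norm (x - y))"


section \<open>The stochastic gradient oracle\<close>

text \<open>
  The oracle is a random field: \<open>orc s x \<omega>\<close> is the random vector \<open>g(x)\<close> returned when the
  \<open>s\<close>-th query is made at \<open>x\<close>, and \<open>g s\<close> is the answer actually received in iteration \<open>s\<close>.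
  \<open>history M g s\<close> is the sigma-algebra generated by \<open>g 1, \<dots>, g (s - 1)\<close>.

  That each iteration makes a fresh query is expressed by letting the query point \<open>x\<close> in the
  assumptions on \<open>g(x)\<close> range over all random vectors \<open>X\<close> determined by the earlier answers.
  Taking \<open>X\<close> constant gives the assumption at each fixed \<open>x\<close>; the iterate of the algorithm is
  another instance. No independence or identical distribution of the answers is imposed.
\<close>

definition history ::
  "'w measure \<Rightarrow> (nat \<Rightarrow> 'w \<Rightarrow> 'b::topological_space) \<Rightarrow> nat \<Rightarrow> 'w measure"
  where "history M g s =
    sigma (space M) (\<Union>r\<in>{1..<s}. {g r -` A \<inter> space M |A. A \<in> sets borel})"

definition stochastic_oracle ::
  "'w measure \<Rightarrow> nat \<Rightarrow> (nat \<Rightarrow> real^'d \<Rightarrow> 'w \<Rightarrow> real^'d) \<Rightarrow> (nat \<Rightarrow> 'w \<Rightarrow> real^'d) \<Rightarrow> bool"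
  where "stochastic_oracle M T orc g \<longleftrightarrow>
    (\<forall>s\<in>{1..T}. \<forall>X \<in> borel_measurable (history M g s).
      (\<lambda>\<omega>. orc s (X \<omega>) \<omega>) \<in> borel_measurable M)"

text \<open>
  A random \<open>X\<close> may be such that \<open>g(X)\<close> has no mean; unbiasedness says nothing about those.
  For constant \<open>X\<close> the noise bound below makes \<open>g(X)\<close> integrable.
\<close>

definition unbiased ::
  "'w measure \<Rightarrow> nat \<Rightarrow> (real^'d \<Rightarrow> real) \<Rightarrow>
    (nat \<Rightarrow> real^'d \<Rightarrow> 'w \<Rightarrow> real^'d) \<Rightarrow> (nat \<Rightarrow> 'w \<Rightarrow> real^'d) \<Rightarrow> bool"
  where "unbiased M T f orc g \<longleftrightarrow>
    (\<forall>s\<in>{1..T}. \<forall>X \<in> borel_measurable (history M g s).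
      integrable M (\<lambda>\<omega>. orc s (X \<omega>) \<omega>) \<longrightarrow>
      (\<forall>i. AE \<omega> in M.
        real_cond_exp M (history M g s) (\<lambda>\<omega>. orc s (X \<omega>) \<omega> $ i) \<omega> = nabla f (X \<omega>) $ i))"

definition affine_variance_noise ::
  "'w measure \<Rightarrow> nat \<Rightarrow> (real^'d \<Rightarrow> real) \<Rightarrow> real^'d \<Rightarrow> real^'d \<Rightarrow>
    (nat \<Rightarrow> real^'d \<Rightarrow> 'w \<Rightarrow> real^'d) \<Rightarrow> (nat \<Rightarrow> 'w \<Rightarrow> real^'d) \<Rightarrow> bool"
  where "affine_variance_noise M T f \<sigma>0 \<sigma>1 orc g \<longleftrightarrow>
    (\<forall>s\<in>{1..T}. \<forall>X \<in> borel_measurable (history M g s). \<forall>i. AE \<omega> in M.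
      (orc s (X \<omega>) \<omega> $ i - nabla f (X \<omega>) $ i)\<^sup>2
        \<le> (\<sigma>0 $ i)\<^sup>2 + (\<sigma>1 $ i)\<^sup>2 * (nabla f (X \<omega>) $ i)\<^sup>2)"


section \<open>Adam\<close>

definition adam_eta :: "real \<Rightarrow> real \<Rightarrow> real \<Rightarrow> nat \<Rightarrow> real"
  where "adam_eta \<beta>1 \<beta>2 \<eta> s = \<eta> * sqrt (1 - \<beta>2 ^ s) / (1 - \<beta>1 ^ s)"

definition adam_eps :: "real \<Rightarrow> real \<Rightarrow> nat \<Rightarrow> real"
  where "adam_eps \<beta>2 \<epsilon> s = \<epsilon> * sqrt (1 - \<beta>2 ^ s)"

text \<open>
  The update rules along one sample path. The iterates \<open>x\<close> are meaningful at
  \<open>1, \<dots>, T + 1\<close>, the answers \<open>g\<close> at \<open>1, \<dots>, T\<close>, and the moments \<open>m\<close>, \<open>v\<close> at \<open>0, \<dots>, T\<close>.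
\<close>

definition adam_path ::
  "real \<Rightarrow> real \<Rightarrow> real \<Rightarrow> real \<Rightarrow> nat \<Rightarrow> real^'d \<Rightarrow> (nat \<Rightarrow> real^'d) \<Rightarrow>
    (nat \<Rightarrow> real^'d) \<Rightarrow> (nat \<Rightarrow> real^'d) \<Rightarrow> (nat \<Rightarrow> real^'d) \<Rightarrow> bool"
  where "adam_path \<beta>1 \<beta>2 \<epsilon> \<eta> T x1 g x m v \<longleftrightarrow>
    x 1 = x1 \<and> m 0 = 0 \<and> v 0 = 0 \<and>
    (\<forall>s\<in>{1..T}. \<forall>i.
      m s $ i = \<beta>1 * m (s - 1) $ i + (1 - \<beta>1) * g s $ i \<and>
      v s $ i = \<beta>2 * v (s - 1) $ i + (1 - \<beta>2) * (g s $ i)\<^sup>2 \<and>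
      x (s + 1) $ i = x s $ i
        - adam_eta \<beta>1 \<beta>2 \<eta> s / (sqrt (v s $ i) + adam_eps \<beta>2 \<epsilon> s) * m s $ i)"

definition adam_process ::
  "'w measure \<Rightarrow> real \<Rightarrow> real \<Rightarrow> real \<Rightarrow> real \<Rightarrow> nat \<Rightarrow> real^'d \<Rightarrow>
    (nat \<Rightarrow> real^'d \<Rightarrow> 'w \<Rightarrow> real^'d) \<Rightarrow> (nat \<Rightarrow> 'w \<Rightarrow> real^'d) \<Rightarrow>
    (nat \<Rightarrow> 'w \<Rightarrow> real^'d) \<Rightarrow> (nat \<Rightarrow> 'w \<Rightarrow> real^'d) \<Rightarrow> (nat \<Rightarrow> 'w \<Rightarrow> real^'d) \<Rightarrow> bool"
  where "adam_process M \<beta>1 \<beta>2 \<epsilon> \<eta> T x1 orc g x m v \<longleftrightarrow>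
    (\<forall>\<omega>\<in>space M.
      (\<forall>s\<in>{1..T}. g s \<omega> = orc s (x s \<omega>) \<omega>) \<and>
      adam_path \<beta>1 \<beta>2 \<epsilon> \<eta> T x1
        (\<lambda>s. g s \<omega>) (\<lambda>s. x s \<omega>) (\<lambda>s. m s \<omega>) (\<lambda>s. v s \<omega>))"

text \<open>
  The proxy step-size \<open>a\<^sub>s\<^sub>,\<^sub>i\<close> on one sample path.
\<close>

definition proxy_step ::
  "(real^'d \<Rightarrow> real) \<Rightarrow> real \<Rightarrow> real \<Rightarrow> real^'d \<Rightarrow> real^'d \<Rightarrow>
    (nat \<Rightarrow> real^'d) \<Rightarrow> (nat \<Rightarrow> real^'d) \<Rightarrow> nat \<Rightarrow> 'd \<Rightarrow> real"
  where "proxy_step f \<beta>2 \<epsilon> \<sigma>0 \<sigma>1 x v s i =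
    sqrt (\<beta>2 * v (s - 1) $ i
      + (1 - \<beta>2) * ((\<sigma>0 $ i)\<^sup>2 + (1 + (\<sigma>1 $ i)\<^sup>2) * (nabla f (x s) $ i)\<^sup>2))
    + adam_eps \<beta>2 \<epsilon> s"


section \<open>The explicit constants\<close>

definition Sigma_max :: "real \<Rightarrow> real"
  where "Sigma_max \<beta>2 = max 1 (sqrt ((1 + \<beta>2) / \<beta>2) - 1)"

definition F_const ::
  "(real^'d \<Rightarrow> real) \<Rightarrow> real^'d \<Rightarrow> real \<Rightarrow> real^'d \<Rightarrow> real^'d \<Rightarrow>
    real \<Rightarrow> real \<Rightarrow> real \<Rightarrow> real \<Rightarrow> nat \<Rightarrow> real"
  where "F_const f x1 L \<sigma>0 \<sigma>1 \<beta>1 \<beta>2 C0 \<epsilon> T =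
    1 + 2 / \<epsilon>\<^sup>2 *
      (((infnorm \<sigma>0)\<^sup>2 + 2 * (1 + (infnorm \<sigma>1)\<^sup>2) * (norm (nabla f x1))\<^sup>2) * real T
       + 2 * (1 + (infnorm \<sigma>1)\<^sup>2) * real CARD('d) * L\<^sup>2 * C0\<^sup>2 / (1 - \<beta>1 / \<beta>2) * real T ^ 3)"

definition G_const ::
  "(real^'d \<Rightarrow> real) \<Rightarrow> real \<Rightarrow> real^'d \<Rightarrow> real \<Rightarrow> real^'d \<Rightarrow> real^'d \<Rightarrow>
    real \<Rightarrow> real \<Rightarrow> real \<Rightarrow> real \<Rightarrow> nat \<Rightarrow> real \<Rightarrow> real"
  where "G_const f fstar x1 L \<sigma>0 \<sigma>1 \<beta>1 \<beta>2 C0 \<epsilon>0 T \<delta> =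
   (let d = real CARD('d);
        S0 = infnorm \<sigma>0;
        S1 = infnorm \<sigma>1;
        \<epsilon> = \<epsilon>0 * sqrt (1 - \<beta>2);
        logT = ln (d * real T / \<delta>);
        logF = ln (F_const f x1 L \<sigma>0 \<sigma>1 \<beta>1 \<beta>2 C0 \<epsilon> T / \<beta>2 ^ T)
    in 8 * L * (f x1 - fstar)
     + 256 * L\<^sup>2 * C0\<^sup>2 * \<beta>1\<^sup>2 * d\<^sup>2 / ((1 - \<beta>1) ^ 3 * (1 - \<beta>1 / \<beta>2))
     + 4 * L\<^sup>2 * C0\<^sup>2 * \<beta>1\<^sup>2 * d / ((1 - \<beta>1)\<^sup>2 * (1 - \<beta>1 / \<beta>2))
     + 48 * L * C0 * S0 / (1 - \<beta>1) * d * logT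
     + 8 * L * C0 * \<beta>1\<^sup>2 / ((1 - \<beta>1)\<^sup>2 * (1 - \<beta>1 / \<beta>2))
         * (4 * S0 / \<beta>2 + (\<epsilon>0 + sqrt 2 * S0) / sqrt \<beta>2
            + L * C0 / 2 * (1 + 4 * (Sigma_max \<beta>2)\<^sup>2)) * d * logF
     + 8 * (3 * L\<^sup>2 * C0\<^sup>2 / (1 - \<beta>1)\<^sup>2 + 8 * L * S0 * C0 / (1 - \<beta>1)) * d * logF
     + 2304 * L\<^sup>2 * C0\<^sup>2 * S1\<^sup>2 / (1 - \<beta>1)\<^sup>2 * d\<^sup>2 * logT\<^sup>2
     + 256 * (16 * L\<^sup>2 * C0\<^sup>2 * S1\<^sup>2 / (1 - \<beta>1)\<^sup>2
              + 9 * L\<^sup>2 * C0\<^sup>2 * \<beta>1 ^ 4 * (1 + S1\<^sup>2)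
                / (\<beta>2\<^sup>2 * (1 - \<beta>1) ^ 4 * (1 - \<beta>1 / \<beta>2)\<^sup>2)) * d\<^sup>2 * logF\<^sup>2)"

end

theory Submission
  imports Defs
begin

text \<open>
  The squared gradient at an iterate is bounded by the gap in function value at a nearby point, and
  along Adam that gap is controlled by a quantity that itself grows only like the square root of a
  bound on the earlier squared gradients. Such an estimate closes on itself: if
  \<open>2 * B + Y\<^sup>2 \<le> G\<close> and \<open>H = sqrt G\<close>, then \<open>B + H * Y \<le> G\<close>. The constant
  \<open>G\<close> of the theorem is large enough for this, and the conclusion follows by induction on the
  round, on an event that is fixed before the induction starts.

  Momentum is removed by following the look-ahead points
  \<open>y\<^sub>s = x\<^sub>s + \<kappa> * (x\<^sub>s - x\<^sub>s\<^sub>-\<^sub>1)\<close> with \<open>\<kappa> = \<beta>1 / (1 - \<beta>1)\<close> instead of the iterates. Their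
  increments are a plain adaptive gradient step \<open>- w\<^sub>s * g\<^sub>s\<close> plus a correction that is
  proportional to the change of the effective step-size \<open>w\<^sub>s = \<eta>\<^sub>s / (sqrt v\<^sub>s + \<epsilon>\<^sub>s)\<close>. The
  descent inequality for smooth functions at \<open>y\<^sub>s\<close>, with the gradient replaced by the one at
  \<open>x\<^sub>s\<close>, leaves second-order terms and, in each coordinate, first-order terms.

  All second-order terms reduce to \<open>\<Sum>\<^sub>s (1 - \<beta>2) * g\<^sub>s\<^sup>2 / v\<^sub>s\<close>, which telescopes to a
  logarithm (\<open>sum_g_sq_over_u_le_log\<close>), and to the same sum with \<open>g\<^sub>s\<^sup>2\<close> replaced by a moving
  average with rate \<open>\<beta>1 < \<beta>2\<close> (\<open>sum_q_over_u_le\<close>). In the first-order terms the step-size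
  depends on the current noise. It is exchanged for the proxy step-size, which is determined by
  the past; each exchange costs a fraction of the negative term \<open>- \<eta>\<^sub>s * p\<^sub>s\<^sup>2 / a\<^sub>s\<close>, where
  \<open>p\<^sub>s\<close> is the gradient coordinate, and a further multiple of the logarithm (\<open>round_bound\<close>,
  \<open>coordinate_bound\<close>). After the exchange the noise is multiplied by a past-determined weight.

  The weighted noise is a martingale with bounded conditional increments, but only as long as the
  gradient is bounded, which is what is to be proved. The weights are therefore cut off where a
  gradient coordinate exceeds \<open>sqrt G\<close>. The cut-off process has an exponential moment bound
  without any condition (\<open>supermartingale_exp_le_1\<close>), and a union bound over coordinates and
  horizons gives the event on which the deterministic induction (\<open>gradient_bound\<close>) runs; there
  the cut-off never takes effect.
\<close>

section \<open>Smooth functions\<close>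

text \<open>
  Along the segment from \<open>x\<close> to \<open>y\<close>, the difference between \<open>f\<close> and the quadratic model has a
  nonpositive derivative, because the gradient moves at most at rate \<open>L\<close>.
\<close>

lemma L_smooth_descent:
  fixes f :: "'a::euclidean_space \<Rightarrow> real"
  assumes "L_smooth L f"
  shows "f y \<le> f x + inner (nabla f x) (y - x) + L / 2 * (norm (y - x))\<^sup>2"
proof -
  define d where "d = y - x"
  define \<phi> where "\<phi> t = f (x + t *\<^sub>R d) - t * inner (nabla f x) d - L / 2 * t\<^sup>2 * (norm d)\<^sup>2" for t
  have der: "(\<phi> has_real_derivative
      (inner d (nabla f (x + t *\<^sub>R d)) - inner (nabla f x) d - L * t * (norm d)\<^sup>2)) (at t)" for t
  proof -
    have "GDERIV f (x + t *\<^sub>R d) :> nabla f (x + t *\<^sub>R d)"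
      using assms by (intro GDERIV_nabla) (auto simp: L_smooth_def)
    then have "(f has_derivative (\<lambda>h. inner h (nabla f (x + t *\<^sub>R d)))) (at (x + t *\<^sub>R d))"
      by (simp add: gderiv_def)
    moreover have "((\<lambda>t. x + t *\<^sub>R d) has_derivative (\<lambda>h. h *\<^sub>R d)) (at t)"
      by (auto intro!: derivative_eq_intros)
    ultimately have "((\<lambda>t. f (x + t *\<^sub>R d)) has_derivative
        (\<lambda>h. inner (h *\<^sub>R d) (nabla f (x + t *\<^sub>R d)))) (at t)"
      by (rule has_derivative_compose[rotated])
    then have "((\<lambda>t. f (x + t *\<^sub>R d)) has_real_derivative inner d (nabla f (x + t *\<^sub>R d))) (at t)"
      by (simp add: has_field_derivative_def mult.commute[of _ "inner d _"])
    then show ?thesis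
      unfolding \<phi>_def by (auto intro!: derivative_eq_intros)
  qed
  have "\<phi> 1 \<le> \<phi> 0"
  proof (rule DERIV_nonpos_imp_nonincreasing[of 0 1 \<phi>])
    show "0 \<le> (1::real)" by simp
    fix t :: real assume t: "0 \<le> t" "t \<le> 1"
    have "inner d (nabla f (x + t *\<^sub>R d)) - inner (nabla f x) d
        = inner (nabla f (x + t *\<^sub>R d) - nabla f x) d"
      by (simp add: inner_diff_left inner_commute[of d])
    also have "\<dots> \<le> norm (nabla f (x + t *\<^sub>R d) - nabla f x) * norm d"
      by (rule norm_cauchy_schwarz)
    also have "\<dots> \<le> (L * norm ((x + t *\<^sub>R d) - x)) * norm d"
      using assms unfolding L_smooth_def by (blast intro: mult_right_mono norm_ge_zero)
    also have "\<dots> = L * t * (norm d)\<^sup>2"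
      using t by (simp add: power2_eq_square)
    finally show "\<exists>y. (\<phi> has_real_derivative y) (at t) \<and> y \<le> 0"
      using der[of t] by (intro exI conjI) auto
  qed
  then show ?thesis by (simp add: \<phi>_def d_def)
qed

text \<open>
  A gradient step of length \<open>1 / L\<close> lowers \<open>f\<close> by \<open>(norm (nabla f x))\<^sup>2 / (2 * L)\<close>, and
  there is only \<open>f x - fstar\<close> to lose.
\<close>

lemma L_smooth_grad_sq_le:
  fixes f :: "'a::euclidean_space \<Rightarrow> real"
  assumes "L_smooth L f" "L > 0" and lower: "\<And>y. fstar \<le> f y"
  shows "(norm (nabla f x))\<^sup>2 \<le> 2 * L * (f x - fstar)"
proof -
  define y where "y = x - (1 / L) *\<^sub>R nabla f x"
  have "fstar \<le> f x + inner (nabla f x) (y - x) + L / 2 * (norm (y - x))\<^sup>2"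
    using lower[of y] L_smooth_descent[OF assms(1), of y x] by linarith
  also have "\<dots> = f x - (norm (nabla f x))\<^sup>2 / (2 * L)"
    using \<open>L > 0\<close> by (simp add: y_def power2_norm_eq_inner[symmetric] field_simps power2_eq_square)
  finally show ?thesis using \<open>L > 0\<close> by (simp add: field_simps)
qed

section \<open>Exponential tail bounds for bounded martingale differences\<close>

text \<open>
  With \<open>\<bar>x\<bar> \<le> c\<close> this gives \<open>exp (x - c\<^sup>2) \<le> 1 + x * exp (- c\<^sup>2)\<close>, whose right-hand side is
  affine in \<open>x\<close> and so has conditional mean \<open>1\<close> when \<open>x\<close> is centred and \<open>c\<close> is determined by the
  past.
\<close>

lemma exp_le_add_exp_square: "exp x \<le> x + exp (x\<^sup>2)" for x :: real
proof -
  have sq: "1 + x\<^sup>2 \<le> exp (x\<^sup>2)" by (rule exp_ge_add_one_self)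
  \<comment> \<open>On the middle range both sides are compared with \<open>1 + x + x\<^sup>2\<close>.\<close>
  consider "x > 1" | "0 \<le> x" "x \<le> 1" | "-1 \<le> x" "x < 0" | "x < -1" by linarith
  then show ?thesis
  proof cases
    case 1
    then have "x \<le> x\<^sup>2" by (simp add: power2_eq_square)
    then have "exp x \<le> exp (x\<^sup>2)" by simp
    with 1 show ?thesis by linarith
  next
    case 2
    then show ?thesis using exp_bound[of x] sq by linarith
  next
    case 3
    have "1 - x \<le> exp (- x)" using exp_ge_add_one_self[of "- x"] by simp
    then have "exp x \<le> 1 / (1 - x)" using 3 by (simp add: exp_minus field_simps)
    also have "\<dots> \<le> 1 + x + x\<^sup>2"
    proof -
      have "(1 + x + x\<^sup>2) * (1 - x) = 1 - x ^ 3" by (simp add: algebra_simps power2_eq_square power3_eq_cube)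
      moreover have "x ^ 3 \<le> 0" using 3 by (simp add: power3_eq_cube mult_nonneg_nonpos mult_nonpos_nonpos mult_le_0_iff)
      ultimately have "1 \<le> (1 + x + x\<^sup>2) * (1 - x)" by linarith
      then show ?thesis using 3 by (simp add: pos_divide_le_eq)
    qed
    finally show ?thesis using sq by linarith
  next
    case 4
    then have "exp x \<le> 1" by simp
    moreover have "0 \<le> x + x\<^sup>2"
      using mult_nonpos_nonpos[of x "x + 1"] 4 by (simp add: algebra_simps power2_eq_square)
    ultimately show ?thesis using sq by linarith
  qed
qed

text \<open>
  The increments are \<open>h s * \<xi> s\<close> with a weight \<open>h s\<close> and a bound \<open>c s\<close> that are measurable for
  the past \<open>F s\<close>. By the affine bound above, one more factor changes the expectation by that of a
  past-measurable variable times \<open>\<xi> n\<close>, which vanishes. The uniform bound \<open>K\<close> makes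
  all factors integrable.
\<close>

lemma (in prob_space) supermartingale_exp_le_1:
  fixes F :: "nat \<Rightarrow> 'a measure" and h \<xi> c :: "nat \<Rightarrow> 'a \<Rightarrow> real"
  assumes sub: "\<And>s. s < n \<Longrightarrow> subalgebra M (F s)"
    and mono: "\<And>r s. r < s \<Longrightarrow> s < n \<Longrightarrow> \<xi> r \<in> borel_measurable (F s)
                 \<and> h r \<in> borel_measurable (F s) \<and> c r \<in> borel_measurable (F s)"
    and h: "\<And>s. s < n \<Longrightarrow> h s \<in> borel_measurable (F s)"
    and c: "\<And>s. s < n \<Longrightarrow> c s \<in> borel_measurable (F s)"
    and h_bd: "\<And>s \<omega>. s < n \<Longrightarrow> \<omega> \<in> space M \<Longrightarrow> \<bar>h s \<omega>\<bar> \<le> K"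
    and int: "\<And>s. s < n \<Longrightarrow> integrable M (\<xi> s)"
    and cond: "\<And>s. s < n \<Longrightarrow> AE \<omega> in M. real_cond_exp M (F s) (\<xi> s) \<omega> = 0"
    and bd: "\<And>s. s < n \<Longrightarrow> AE \<omega> in M. \<bar>h s \<omega> * \<xi> s \<omega>\<bar> \<le> c s \<omega>"
    and c_bd: "\<And>s \<omega>. s < n \<Longrightarrow> \<omega> \<in> space M \<Longrightarrow> \<bar>c s \<omega>\<bar> \<le> K"
  shows "integrable M (\<lambda>\<omega>. exp (\<Sum>s<n. h s \<omega> * \<xi> s \<omega> - (c s \<omega>)\<^sup>2))
    \<and> expectation (\<lambda>\<omega>. exp (\<Sum>s<n. h s \<omega> * \<xi> s \<omega> - (c s \<omega>)\<^sup>2)) \<le> 1"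
  using assms
proof (induction n)
  case 0
  then show ?case by (simp add: prob_space)
next
  case (Suc n)
  define W where "W \<omega> = exp (\<Sum>s<n. h s \<omega> * \<xi> s \<omega> - (c s \<omega>)\<^sup>2)" for \<omega>
  define B where "B = exp (real n * K)"
  have IH: "integrable M W" "expectation W \<le> 1"
    using Suc.IH Suc.prems unfolding W_def by auto
  note subn = Suc.prems(1)[OF lessI]
  have toM: "p \<in> borel_measurable M" if "p \<in> borel_measurable (F n)" for p :: "'a \<Rightarrow> real"
    by (rule measurable_from_subalg[OF subn that])
  have WF: "W \<in> borel_measurable (F n)"
    unfolding W_def using Suc.prems(2)[OF _ lessI]
    by (intro borel_measurable_exp[THEN measurable_compose[rotated]] borel_measurable_sum
        borel_measurable_diff borel_measurable_times borel_measurable_power) auto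
  have \<xi>M: "\<xi> n \<in> borel_measurable M" using Suc.prems(6)[OF lessI] by auto
  have hM: "h n \<in> borel_measurable M" and cM: "c n \<in> borel_measurable M"
    using toM[OF Suc.prems(3)[OF lessI]] toM[OF Suc.prems(4)[OF lessI]] by simp_all
  have Wbd: "AE \<omega> in M. W \<omega> \<le> B"
  proof -
    have "AE \<omega> in M. \<forall>s\<in>{..<n}. \<bar>h s \<omega> * \<xi> s \<omega>\<bar> \<le> c s \<omega>"
      using Suc.prems(8) by (intro AE_finite_allI) auto
    then show ?thesis
      using AE_space
    proof eventually_elim
      case (elim \<omega>)
      have "(\<Sum>s<n. h s \<omega> * \<xi> s \<omega> - (c s \<omega>)\<^sup>2) \<le> (\<Sum>s<n. K)"
      proof (rule sum_mono)
        fix s assume s: "s \<in> {..<n}"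
        have "h s \<omega> * \<xi> s \<omega> \<le> c s \<omega>" using elim(1) s by force
        moreover have "c s \<omega> \<le> K" using Suc.prems(9)[of s \<omega>] s elim(2) by auto
        ultimately show "h s \<omega> * \<xi> s \<omega> - (c s \<omega>)\<^sup>2 \<le> K"
          using zero_le_power2[of "c s \<omega>"] by linarith
      qed
      then show ?case by (simp add: W_def B_def)
    qed
  qed
  define k where "k \<omega> = W \<omega> * h n \<omega> * exp (- (c n \<omega>)\<^sup>2)" for \<omega>
  have kF: "k \<in> borel_measurable (F n)"
    unfolding k_def using WF Suc.prems(3,4)[OF lessI] by measurable
  have kbd: "AE \<omega> in M. \<bar>k \<omega>\<bar> \<le> B * K"
    using Wbd AE_space
  proof eventually_elim
    case (elim \<omega>)
    have "\<bar>k \<omega>\<bar> = W \<omega> * \<bar>h n \<omega>\<bar> * exp (- (c n \<omega>)\<^sup>2)"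
      by (simp add: k_def abs_mult W_def)
    also have "\<dots> \<le> B * K * 1"
      using elim Suc.prems(5)[OF lessI elim(2)]
      by (intro mult_mono) (auto simp: B_def W_def intro: order_trans[OF abs_ge_zero])
    finally show ?case by simp
  qed
  have kint: "integrable M (\<lambda>\<omega>. k \<omega> * \<xi> n \<omega>)"
  proof (rule Bochner_Integration.integrable_bound)
    show "integrable M (\<lambda>\<omega>. B * K * \<xi> n \<omega>)" using Suc.prems(6)[OF lessI] by simp
    show "(\<lambda>\<omega>. k \<omega> * \<xi> n \<omega>) \<in> borel_measurable M" using toM[OF kF] \<xi>M by measurable
    show "AE \<omega> in M. norm (k \<omega> * \<xi> n \<omega>) \<le> norm (B * K * \<xi> n \<omega>)"
      using kbd
    proof eventually_elim
      case (elim \<omega>)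
      have "\<bar>k \<omega>\<bar> \<le> \<bar>B * K\<bar>" using elim by linarith
      then show ?case by (simp only: real_norm_def abs_mult[of "k \<omega>"] abs_mult[of "B * K"])
          (rule mult_right_mono, simp_all)
    qed
  qed
  interpret sigma_finite_subalgebra M "F n"
    by (rule finite_measure_subalgebra_is_sigma_finite) (unfold_locales, rule subn)
  have "expectation (\<lambda>\<omega>. k \<omega> * \<xi> n \<omega>) = expectation (\<lambda>\<omega>. k \<omega> * real_cond_exp M (F n) (\<xi> n) \<omega>)"
    by (rule real_cond_exp_intg(2)[OF kint kF \<xi>M, symmetric])
  also have "\<dots> = expectation (\<lambda>\<omega>. 0)"
    using Suc.prems(7)[OF lessI] toM[OF kF] by (intro integral_cong_AE) auto
  finally have k0: "expectation (\<lambda>\<omega>. k \<omega> * \<xi> n \<omega>) = 0" by simp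
  let ?V = "\<lambda>\<omega>. exp (\<Sum>s<Suc n. h s \<omega> * \<xi> s \<omega> - (c s \<omega>)\<^sup>2)"
  have le: "AE \<omega> in M. ?V \<omega> \<le> W \<omega> + k \<omega> * \<xi> n \<omega>"
    using Suc.prems(8)[OF lessI]
  proof eventually_elim
    case (elim \<omega>)
    let ?x = "h n \<omega> * \<xi> n \<omega>" and ?c = "c n \<omega>"
    have "?x\<^sup>2 \<le> ?c\<^sup>2" using elim abs_le_square_iff[of ?x ?c] by linarith
    then have "exp ?x \<le> ?x + exp (?c\<^sup>2)"
      using exp_le_add_exp_square[of ?x] by (smt (verit) exp_le_cancel_iff)
    then have "exp (- ?c\<^sup>2) * exp ?x \<le> exp (- ?c\<^sup>2) * (?x + exp (?c\<^sup>2))"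
      by (intro mult_left_mono) auto
    then have "exp (?x - ?c\<^sup>2) \<le> 1 + exp (- ?c\<^sup>2) * ?x"
      by (simp add: algebra_simps exp_minus exp_diff field_simps)
    then have "W \<omega> * exp (?x - ?c\<^sup>2) \<le> W \<omega> * (1 + exp (- ?c\<^sup>2) * ?x)"
      by (intro mult_left_mono) (auto simp: W_def)
    then show ?case
      by (simp only: W_def k_def sum.lessThan_Suc exp_add) (simp add: algebra_simps)
  qed
  \<comment> \<open>Integrability of the next factor follows from domination by \<open>W + k * \<xi> n\<close>.\<close>
  have VM: "?V \<in> borel_measurable M"
  proof -
    have "?V = (\<lambda>\<omega>. W \<omega> * exp (h n \<omega> * \<xi> n \<omega> - (c n \<omega>)\<^sup>2))"
      by (simp add: W_def exp_add)
    then show ?thesis using toM[OF WF] hM \<xi>M cM by simp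
  qed
  have intR: "integrable M (\<lambda>\<omega>. W \<omega> + k \<omega> * \<xi> n \<omega>)" using IH kint by simp
  have intV: "integrable M ?V"
    by (rule Bochner_Integration.integrable_bound[OF intR VM])
      (use le in eventually_elim, simp add: order_trans[OF _ abs_ge_self])
  have "expectation ?V \<le> expectation (\<lambda>\<omega>. W \<omega> + k \<omega> * \<xi> n \<omega>)"
    by (rule integral_mono_AE[OF intV intR le])
  also have "\<dots> = expectation W" using IH kint k0 by simp
  finally show ?case using intV IH by simp
qed

lemma (in prob_space) exp_martingale_tail:
  fixes Z :: "'a \<Rightarrow> real"
  assumes "integrable M (\<lambda>\<omega>. exp (Z \<omega>))" "expectation (\<lambda>\<omega>. exp (Z \<omega>)) \<le> 1" "p > 0"
  shows "prob {\<omega> \<in> space M. Z \<omega> > ln (1 / p)} \<le> p"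
proof -
  have "{\<omega> \<in> space M. Z \<omega> > ln (1 / p)} \<subseteq> {\<omega> \<in> space M. exp (Z \<omega>) \<ge> 1 / p}"
  proof (intro Collect_mono impI conjI; elim conjE)
    fix \<omega> assume "ln (1 / p) < Z \<omega>"
    then have "exp (ln (1 / p)) < exp (Z \<omega>)" by simp
    then show "1 / p \<le> exp (Z \<omega>)" using assms(3) by simp
  qed
  then have "prob {\<omega> \<in> space M. Z \<omega> > ln (1 / p)} \<le> prob {\<omega> \<in> space M. exp (Z \<omega>) \<ge> 1 / p}"
    using assms(1) by (intro finite_measure_mono) auto
  also have "\<dots> \<le> expectation (\<lambda>\<omega>. exp (Z \<omega>)) / (1 / p)"
    using assms by (intro integral_Markov_inequality_measure[where A="{}"]) auto
  also have "\<dots> \<le> p" using assms mult_right_mono[of _ 1 p] by simp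
  finally show ?thesis .
qed

section \<open>The moments of Adam in one coordinate\<close>

text \<open>
  Everything up to the descent inequality happens separately in each coordinate. Round \<open>s + 1\<close> is
  written with \<open>Suc s\<close>, so that the state before the round carries the index \<open>s\<close>.
\<close>

locale adam_coordinate =
  fixes \<beta>1 \<beta>2 C0 \<epsilon>0 :: real and T :: nat and g m v :: "nat \<Rightarrow> real"
  assumes \<beta>1_nonneg: "0 \<le> \<beta>1" and \<beta>12: "\<beta>1 < \<beta>2" and \<beta>2_less: "\<beta>2 < 1"
    and C0_pos: "C0 > 0" and \<epsilon>0_pos: "\<epsilon>0 > 0"
    and m_0: "m 0 = 0" and v_0: "v 0 = 0"
    and m_Suc: "\<And>s. s < T \<Longrightarrow> m (Suc s) = \<beta>1 * m s + (1 - \<beta>1) * g (Suc s)"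
    and v_Suc: "\<And>s. s < T \<Longrightarrow> v (Suc s) = \<beta>2 * v s + (1 - \<beta>2) * (g (Suc s))\<^sup>2"
begin

definition eta :: "nat \<Rightarrow> real"
  where "eta s = adam_eta \<beta>1 \<beta>2 (C0 * sqrt (1 - \<beta>2)) s"

definition eps :: "nat \<Rightarrow> real"
  where "eps s = adam_eps \<beta>2 (\<epsilon>0 * sqrt (1 - \<beta>2)) s"

definition b :: "nat \<Rightarrow> real"
  where "b s = sqrt (v s) + eps s"

text \<open>
  The effective step-size: \<open>- w s * m s\<close> is the displacement in round \<open>s\<close>. At \<open>s = 0\<close>
  both \<open>w\<close> (as the quotient \<open>0 / 0\<close>) and \<open>m\<close> are zero.
\<close>

definition w :: "nat \<Rightarrow> real"
  where "w s = eta s / b s"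

text \<open>
  A lower bound for \<open>(b s)\<^sup>2\<close> in which the regularization is independent of \<open>s\<close>. This makes
  \<open>u (Suc s) - \<beta>2 * u s\<close> at least the new contribution \<open>(1 - \<beta>2) * (g (Suc s))\<^sup>2\<close>, and keeps
  \<open>u 0\<close> positive.
\<close>

definition u :: "nat \<Rightarrow> real"
  where "u s = v s + (1 - \<beta>2)\<^sup>2 * \<epsilon>0\<^sup>2"

text \<open>
  The average of the squares with the rate \<open>\<beta>1\<close> of the first moment. It majorizes \<open>(m s)\<^sup>2\<close> by
  Jensen and still satisfies a linear recursion, which \<open>(m s)\<^sup>2\<close> does not.
\<close>

primrec q :: "nat \<Rightarrow> real" where
  "q 0 = 0"
| "q (Suc s) = \<beta>1 * q s + (1 - \<beta>1) * (g (Suc s))\<^sup>2"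

lemma \<beta>1_less: "\<beta>1 < 1" and \<beta>2_pos: "0 < \<beta>2"
  using \<beta>1_nonneg \<beta>12 \<beta>2_less by auto

lemma pow1_le: "s \<ge> 1 \<Longrightarrow> \<beta>1 ^ s \<le> \<beta>1" and pow2_le: "s \<ge> 1 \<Longrightarrow> \<beta>2 ^ s \<le> \<beta>2"
  using power_decreasing[of 1 s \<beta>1] power_decreasing[of 1 s \<beta>2] \<beta>1_nonneg \<beta>1_less \<beta>2_pos \<beta>2_less
  by auto

lemma pow1_nonneg: "0 \<le> \<beta>1 ^ s" and pow2_pos: "0 < \<beta>2 ^ s"
  using \<beta>1_nonneg \<beta>2_pos by auto

lemma pow1_le_1: "\<beta>1 ^ s \<le> 1" and pow2_le_1: "\<beta>2 ^ s \<le> 1"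
  using \<beta>1_nonneg \<beta>1_less \<beta>2_pos \<beta>2_less by (auto intro: power_le_one)

lemma v_nonneg: "s \<le> T \<Longrightarrow> 0 \<le> v s"
proof (induction s)
  case (Suc s)
  then show ?case using v_Suc[of s] \<beta>2_pos \<beta>2_less by simp
qed (simp add: v_0)

lemma q_nonneg: "0 \<le> q s"
  using \<beta>1_nonneg \<beta>1_less by (induction s) auto

lemma eta_nonneg: "0 \<le> eta s"
  unfolding eta_def adam_eta_def
  using C0_pos \<beta>2_less pow1_le_1[of s] pow2_le_1[of s]
  by (intro divide_nonneg_nonneg mult_nonneg_nonneg) auto

lemma eta_pos: "s \<ge> 1 \<Longrightarrow> 0 < eta s"
  unfolding eta_def adam_eta_def
  using C0_pos \<beta>2_less \<beta>1_less pow1_le[of s] pow2_le[of s]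
  by (intro divide_pos_pos mult_pos_pos) auto

lemma eta_le: "s \<ge> 1 \<Longrightarrow> eta s \<le> C0 * sqrt (1 - \<beta>2) / (1 - \<beta>1 ^ s)"
  unfolding eta_def adam_eta_def
  using C0_pos \<beta>2_less \<beta>1_less pow1_le[of s] pow2_pos[of s]
  by (intro divide_right_mono mult_left_le) auto

lemma eta_le': "eta s \<le> C0 * sqrt (1 - \<beta>2) / (1 - \<beta>1)"
proof (cases "s \<ge> 1")
  case True
  have "C0 * sqrt (1 - \<beta>2) / (1 - \<beta>1 ^ s) \<le> C0 * sqrt (1 - \<beta>2) / (1 - \<beta>1)"
    using C0_pos \<beta>2_less \<beta>1_less pow1_le[OF True] by (intro divide_left_mono) auto
  with eta_le[OF True] show ?thesis by linarith
next
  case False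
  then have "s = 0" by simp
  then show ?thesis using C0_pos \<beta>2_less \<beta>1_less by (simp add: eta_def adam_eta_def)
qed

lemma eps_mono: "r \<le> s \<Longrightarrow> eps r \<le> eps s"
  unfolding eps_def adam_eps_def
  using \<epsilon>0_pos \<beta>2_pos \<beta>2_less power_decreasing[of r s \<beta>2]
  by (intro mult_left_mono) auto

lemma eps_ge: "s \<ge> 1 \<Longrightarrow> \<epsilon>0 * (1 - \<beta>2) \<le> eps s"
  using eps_mono[of 1 s] \<beta>2_less by (simp add: eps_def adam_eps_def mult.assoc)

lemma eps_nonneg: "0 \<le> eps s"
  using eps_mono[of 0 s] by (simp add: eps_def adam_eps_def)

lemma eps_pos: "s \<ge> 1 \<Longrightarrow> 0 < eps s"
  using eps_ge[of s] \<epsilon>0_pos \<beta>2_less by (smt (verit) mult_pos_pos)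

lemma eps_Suc_diff: "eps (Suc s) - eps s \<le> \<epsilon>0 * (1 - \<beta>2)"
proof -
  have "sqrt (1 - \<beta>2 ^ Suc s) \<le> sqrt ((1 - \<beta>2 ^ s) + (1 - \<beta>2))"
    using mult_left_mono[of "\<beta>2 ^ s" 1 "1 - \<beta>2"] pow2_le_1[of s] \<beta>2_less by (simp add: algebra_simps)
  also have "\<dots> \<le> sqrt (1 - \<beta>2 ^ s) + sqrt (1 - \<beta>2)"
    using pow2_le_1[of s] \<beta>2_less by (intro sqrt_add_le_add_sqrt) auto
  finally have "sqrt (1 - \<beta>2 ^ Suc s) - sqrt (1 - \<beta>2 ^ s) \<le> sqrt (1 - \<beta>2)" by simp
  then have "\<epsilon>0 * sqrt (1 - \<beta>2) * (sqrt (1 - \<beta>2 ^ Suc s) - sqrt (1 - \<beta>2 ^ s))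
      \<le> \<epsilon>0 * sqrt (1 - \<beta>2) * sqrt (1 - \<beta>2)"
    using \<epsilon>0_pos \<beta>2_less by (intro mult_left_mono) auto
  then show ?thesis using \<beta>2_less by (simp add: eps_def adam_eps_def algebra_simps)
qed

lemma b_pos: "s \<ge> 1 \<Longrightarrow> s \<le> T \<Longrightarrow> 0 < b s"
  unfolding b_def using eps_pos[of s] v_nonneg[of s] by (simp add: add_nonneg_pos)

lemma u_pos: "s \<le> T \<Longrightarrow> 0 < u s"
  unfolding u_def using v_nonneg[of s] \<beta>2_less \<epsilon>0_pos by (simp add: add_nonneg_pos)

lemma u_le_b_sq:
  assumes "s \<ge> 1" "s \<le> T"
  shows "u s \<le> (b s)\<^sup>2"
proof -
  have "(1 - \<beta>2)\<^sup>2 * \<epsilon>0\<^sup>2 \<le> (eps s)\<^sup>2"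
    using power_mono[OF eps_ge[OF assms(1)], of 2] \<epsilon>0_pos \<beta>2_less
    by (simp add: power_mult_distrib mult.commute)
  moreover have "v s + (eps s)\<^sup>2 \<le> (b s)\<^sup>2"
    using v_nonneg[OF assms(2)] eps_nonneg[of s] by (simp add: b_def power2_sum)
  ultimately show ?thesis by (simp add: u_def)
qed

lemma u_Suc_ge: "s < T \<Longrightarrow> \<beta>2 * u s \<le> u (Suc s)"
proof -
  assume s: "s < T"
  have "\<beta>2 * ((1 - \<beta>2)\<^sup>2 * \<epsilon>0\<^sup>2) \<le> (1 - \<beta>2)\<^sup>2 * \<epsilon>0\<^sup>2"
    using \<beta>2_less by (intro mult_left_le_one_le) (auto intro: less_imp_le[OF \<beta>2_pos])
  moreover have "0 \<le> (1 - \<beta>2) * (g (Suc s))\<^sup>2" using \<beta>2_less by simp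
  ultimately show ?thesis using v_Suc[OF s] by (simp add: u_def distrib_left)
qed

text \<open>
  Each term is at most \<open>1 - \<beta>2 * u s / u (Suc s)\<close>, which \<open>1 - z \<le> - ln z\<close> turns into a
  telescoping difference of logarithms.
\<close>

lemma sum_g_sq_over_u:
  assumes "t \<le> T"
  shows "(\<Sum>s<t. (1 - \<beta>2) * ((g (Suc s))\<^sup>2 / u (Suc s))) \<le> ln (u t / u 0) - real t * ln \<beta>2"
  using assms
proof (induction t)
  case (Suc t)
  have up: "0 < u t" "0 < u (Suc t)" "0 < u 0" using u_pos Suc.prems by auto
  have "(1 - \<beta>2) * (g (Suc t))\<^sup>2 \<le> u (Suc t) - \<beta>2 * u t"
    using v_Suc[of t] Suc.prems \<beta>2_less
      mult_left_le_one_le[of "(1 - \<beta>2)\<^sup>2 * \<epsilon>0\<^sup>2" \<beta>2] \<beta>2_pos by (simp add: u_def algebra_simps)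
  then have "(1 - \<beta>2) * ((g (Suc t))\<^sup>2 / u (Suc t)) \<le> (u (Suc t) - \<beta>2 * u t) / u (Suc t)"
    using up by (simp add: divide_right_mono)
  also have "\<dots> = - (\<beta>2 * u t / u (Suc t) - 1)" using up by (simp add: field_simps)
  also have "\<dots> \<le> - ln (\<beta>2 * u t / u (Suc t))"
    using ln_le_minus_one[of "\<beta>2 * u t / u (Suc t)"] up \<beta>2_pos by simp
  also have "\<dots> = ln (u (Suc t)) - ln (u t) - ln \<beta>2"
    using up \<beta>2_pos by (simp add: ln_div ln_mult)
  finally show ?case using Suc up by (simp add: ln_div algebra_simps)
qed (use u_pos[of 0] in simp)

lemma v_le_sum: "t \<le> T \<Longrightarrow> v t \<le> (1 - \<beta>2) * (\<Sum>s<t. (g (Suc s))\<^sup>2)"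
proof (induction t)
  case (Suc t)
  have "\<beta>2 * v t \<le> v t" using v_nonneg[of t] Suc.prems \<beta>2_less \<beta>2_pos by (intro mult_left_le_one_le) auto
  then show ?case using Suc v_Suc[of t] by (simp add: algebra_simps)
qed (simp add: v_0)

lemma sum_g_sq_over_u_le_log:
  assumes "t \<le> T" and F: "1 + (\<Sum>s<T. (g (Suc s))\<^sup>2) / (\<epsilon>0 * sqrt (1 - \<beta>2))\<^sup>2 \<le> F"
  shows "(\<Sum>s<t. (1 - \<beta>2) * ((g (Suc s))\<^sup>2 / u (Suc s))) \<le> ln (F / \<beta>2 ^ T)"
proof -
  let ?S = "\<lambda>t. \<Sum>s<t. (g (Suc s))\<^sup>2"
  have S: "?S t \<le> ?S T" using assms(1) by (intro sum_mono2) auto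
  have k: "0 < (1 - \<beta>2)\<^sup>2 * \<epsilon>0\<^sup>2" using \<beta>2_less \<epsilon>0_pos by simp
  have "u t / u 0 = 1 + v t / ((1 - \<beta>2)\<^sup>2 * \<epsilon>0\<^sup>2)" using \<beta>2_less \<epsilon>0_pos by (simp add: u_def v_0 add_divide_distrib)
  also have "\<dots> \<le> 1 + ((1 - \<beta>2) * ?S t) / ((1 - \<beta>2)\<^sup>2 * \<epsilon>0\<^sup>2)"
    using v_le_sum[OF assms(1)] k by (intro add_left_mono divide_right_mono) auto
  also have "\<dots> = 1 + ?S t / (\<epsilon>0 * sqrt (1 - \<beta>2))\<^sup>2"
    using \<beta>2_less by (simp add: power_mult_distrib power2_eq_square[of "1 - \<beta>2"] mult.commute)
  also have "\<dots> \<le> 1 + ?S T / (\<epsilon>0 * sqrt (1 - \<beta>2))\<^sup>2"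
    using S by (intro add_left_mono divide_right_mono) auto
  also note F
  finally have uF: "u t / u 0 \<le> F" .
  have up: "0 < u t / u 0" using u_pos assms(1) by simp
  have "ln (u t / u 0) \<le> ln F" using uF up by simp
  moreover have "- real t * ln \<beta>2 \<le> - real T * ln \<beta>2"
    using assms(1) \<beta>2_pos \<beta>2_less by (intro mult_right_mono_neg) auto
  moreover have "ln (F / \<beta>2 ^ T) = ln F - real T * ln \<beta>2"
    using up uF \<beta>2_pos by (simp add: ln_div ln_realpow)
  ultimately show ?thesis using sum_g_sq_over_u[OF assms(1)] by simp
qed

text \<open>
  Jensen for the weights \<open>(1 - \<beta>1) * \<beta>1 ^ (s - r)\<close>, whose total mass is \<open>1 - \<beta>1 ^ s\<close>. This
  factor cancels one of the two powers of the bias correction in \<open>(eta s)\<^sup>2\<close>.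
\<close>

lemma m_sq_le: "s \<le> T \<Longrightarrow> (m s)\<^sup>2 \<le> (1 - \<beta>1 ^ s) * q s"
proof (induction s)
  case (Suc s)
  let ?p = "1 - \<beta>1 ^ s"
  have p: "0 \<le> ?p" using pow1_le_1[of s] by simp
  have IH: "(m s)\<^sup>2 \<le> ?p * q s" using Suc by simp
  have cross: "2 * (m s * g (Suc s)) \<le> q s + ?p * (g (Suc s))\<^sup>2"
  proof -
    have "(m s * g (Suc s))\<^sup>2 \<le> q s * (?p * (g (Suc s))\<^sup>2)"
      using mult_right_mono[OF IH, of "(g (Suc s))\<^sup>2"] by (simp add: power_mult_distrib algebra_simps)
    also have "4 * \<dots> \<le> (q s + ?p * (g (Suc s))\<^sup>2)\<^sup>2"
      using zero_le_power2[of "q s - ?p * (g (Suc s))\<^sup>2"] by (simp add: power2_sum power2_diff)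
    finally have "(2 * (m s * g (Suc s)))\<^sup>2 \<le> (q s + ?p * (g (Suc s))\<^sup>2)\<^sup>2"
      by (simp add: power_mult_distrib)
    then show ?thesis using p q_nonneg[of s] by (auto intro: power2_le_imp_le)
  qed
  have "(m (Suc s))\<^sup>2 = \<beta>1\<^sup>2 * (m s)\<^sup>2 + \<beta>1 * (1 - \<beta>1) * (2 * (m s * g (Suc s))) + (1 - \<beta>1)\<^sup>2 * (g (Suc s))\<^sup>2"
    using Suc.prems by (simp add: m_Suc power2_eq_square algebra_simps)
  also have "\<dots> \<le> \<beta>1\<^sup>2 * (?p * q s) + \<beta>1 * (1 - \<beta>1) * (q s + ?p * (g (Suc s))\<^sup>2) + (1 - \<beta>1)\<^sup>2 * (g (Suc s))\<^sup>2"
    using IH cross \<beta>1_nonneg \<beta>1_less by (intro add_mono mult_left_mono) auto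
  also have "\<dots> = (1 - \<beta>1 ^ Suc s) * q (Suc s)"
    by (simp add: algebra_simps power2_eq_square)
  finally show ?case .
qed (simp add: m_0)

text \<open>
  Older squares are discounted more strongly in \<open>q\<close> than in \<open>v\<close>, because \<open>\<beta>1 < \<beta>2\<close>.
\<close>

lemma q_le_v: "s \<le> T \<Longrightarrow> (1 - \<beta>2) * q s \<le> (1 - \<beta>1) * v s"
proof (induction s)
  case (Suc s)
  have "(1 - \<beta>2) * q (Suc s) = \<beta>1 * ((1 - \<beta>2) * q s) + (1 - \<beta>1) * ((1 - \<beta>2) * (g (Suc s))\<^sup>2)"
    by (simp add: algebra_simps)
  also have "\<dots> \<le> \<beta>1 * ((1 - \<beta>1) * v s) + (1 - \<beta>1) * ((1 - \<beta>2) * (g (Suc s))\<^sup>2)"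
    using Suc \<beta>1_nonneg by (intro add_right_mono mult_left_mono) auto
  also have "\<dots> \<le> \<beta>2 * ((1 - \<beta>1) * v s) + (1 - \<beta>1) * ((1 - \<beta>2) * (g (Suc s))\<^sup>2)"
    using \<beta>12 \<beta>1_less v_nonneg[of s] Suc.prems by (intro add_right_mono mult_right_mono) auto
  also have "\<dots> = (1 - \<beta>1) * v (Suc s)" using Suc.prems by (simp add: v_Suc algebra_simps)
  finally show ?case .
qed (simp add: v_0)

lemma m_over_b: "s \<ge> 1 \<Longrightarrow> s \<le> T \<Longrightarrow> (1 - \<beta>2) * (m s)\<^sup>2 \<le> (1 - \<beta>1 ^ s) * (1 - \<beta>1) * (b s)\<^sup>2"
proof -
  assume s: "s \<ge> 1" "s \<le> T"
  have "(1 - \<beta>2) * (m s)\<^sup>2 \<le> (1 - \<beta>2) * ((1 - \<beta>1 ^ s) * q s)"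
    using m_sq_le[OF s(2)] \<beta>2_less by (intro mult_left_mono) auto
  also have "\<dots> = (1 - \<beta>1 ^ s) * ((1 - \<beta>2) * q s)" by simp
  also have "\<dots> \<le> (1 - \<beta>1 ^ s) * ((1 - \<beta>1) * v s)"
    using q_le_v[OF s(2)] pow1_le_1[of s] by (intro mult_left_mono) auto
  also have "\<dots> \<le> (1 - \<beta>1 ^ s) * ((1 - \<beta>1) * (b s)\<^sup>2)"
  proof -
    have "v s \<le> u s" by (simp add: u_def)
    then show ?thesis using u_le_b_sq[OF s] pow1_le_1[of s] \<beta>1_less
      by (intro mult_left_mono) auto
  qed
  finally show ?thesis by simp
qed

lemma eta_sq_le: "s \<ge> 1 \<Longrightarrow> (eta s)\<^sup>2 \<le> C0\<^sup>2 * (1 - \<beta>2) / (1 - \<beta>1 ^ s)\<^sup>2"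
  using power_mono[OF eta_le eta_nonneg, of s 2] \<beta>2_less
  by (simp add: power_mult_distrib power_divide)

lemma step_sq_le: "s \<le> T \<Longrightarrow> (w s * m s)\<^sup>2 \<le> C0\<^sup>2"
proof (cases "s = 0")
  case False
  assume "s \<le> T"
  with False have s: "s \<ge> 1" "s \<le> T" by auto
  have p: "0 < 1 - \<beta>1 ^ s" "1 - \<beta>1 \<le> 1 - \<beta>1 ^ s" using pow1_le[OF s(1)] \<beta>1_less by auto
  have b: "0 < (b s)\<^sup>2" using b_pos[OF s] by simp
  have "(w s * m s)\<^sup>2 = (eta s)\<^sup>2 * (m s)\<^sup>2 / (b s)\<^sup>2" by (simp add: w_def power_mult_distrib power_divide)
  also have "\<dots> \<le> (C0\<^sup>2 * (1 - \<beta>2) / (1 - \<beta>1 ^ s)\<^sup>2) * (m s)\<^sup>2 / (b s)\<^sup>2"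
    using eta_sq_le[OF s(1)] by (intro divide_right_mono mult_right_mono) auto
  also have "\<dots> = (C0\<^sup>2 / (1 - \<beta>1 ^ s)\<^sup>2) * (((1 - \<beta>2) * (m s)\<^sup>2) / (b s)\<^sup>2)" by simp
  also have "\<dots> \<le> (C0\<^sup>2 / (1 - \<beta>1 ^ s)\<^sup>2) * (((1 - \<beta>1 ^ s) * (1 - \<beta>1) * (b s)\<^sup>2) / (b s)\<^sup>2)"
    using m_over_b[OF s] by (intro divide_right_mono mult_left_mono) auto
  also have "\<dots> = C0\<^sup>2 * ((1 - \<beta>1) / (1 - \<beta>1 ^ s))"
    using p b_pos[OF s] by (simp add: power2_eq_square)
  also have "\<dots> \<le> C0\<^sup>2" using p \<beta>1_less by (intro mult_left_le) auto
  finally show ?thesis .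
qed (simp add: m_0)

text \<open>
  Passing from \<open>s\<close> to \<open>Suc s\<close>, the old part of \<open>q s / u s\<close> shrinks at least by the factor
  \<open>\<beta>1 / \<beta>2 < 1\<close>, so the sum is dominated by a geometric series of the new contributions.
\<close>

lemma sum_q_over_u:
  assumes "t \<le> T"
  shows "(1 - \<beta>1 / \<beta>2) * (\<Sum>s<t. q s / u s) + q t / u t \<le> (1 - \<beta>1) * (\<Sum>s<t. (g (Suc s))\<^sup>2 / u (Suc s)) "
  using assms
proof (induction t)
  case (Suc t)
  have up: "0 < u t" "0 < u (Suc t)" using u_pos Suc.prems by auto
  have le: "\<beta>2 * u t \<le> u (Suc t)" using u_Suc_ge Suc.prems by simp
  have "q (Suc t) / u (Suc t) = \<beta>1 * q t / u (Suc t) + (1 - \<beta>1) * ((g (Suc t))\<^sup>2 / u (Suc t))"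
    by (simp add: add_divide_distrib)
  also have "\<beta>1 * q t / u (Suc t) \<le> \<beta>1 * q t / (\<beta>2 * u t)"
    using le up \<beta>2_pos \<beta>1_nonneg q_nonneg[of t] by (intro divide_left_mono) auto
  finally have "q (Suc t) / u (Suc t) \<le> (\<beta>1 / \<beta>2) * (q t / u t) + (1 - \<beta>1) * ((g (Suc t))\<^sup>2 / u (Suc t))"
    by simp
  moreover have "(1 - \<rho>) * (A + Q) + X \<le> (1 - \<beta>1) * (B + R)"
    if "(1 - \<rho>) * A + Q \<le> (1 - \<beta>1) * B" "X \<le> \<rho> * Q + (1 - \<beta>1) * R" for \<rho> A B Q R X :: real
    using that by (simp add: algebra_simps)
  ultimately show ?case using Suc by (simp del: q.simps)
qed simp

end

section \<open>Exchanging the step-size for its proxy\<close>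

text \<open>
  Young's inequality in the form used throughout: a first-order term in the gradient coordinate
  \<open>p\<close> is paid with a fraction \<open>\<theta>\<close> of the descent \<open>E * p\<^sup>2 / a\<close>.
\<close>

lemma young_mult:
  fixes p r E a \<theta> :: real
  assumes "E > 0" "a > 0" "\<theta> > 0"
  shows "p * r \<le> \<theta> * (E * p\<^sup>2 / a) + a * r\<^sup>2 / (4 * \<theta> * E)"
proof -
  have "0 \<le> (2 * \<theta> * E * p - a * r)\<^sup>2 / (4 * \<theta> * E * a)" using assms by simp
  also have "\<dots> = \<theta> * (E * p\<^sup>2 / a) + a * r\<^sup>2 / (4 * \<theta> * E) - p * r"
    using assms by (simp add: power2_eq_square field_simps)
  finally show ?thesis by simp
qed

context adam_coordinate
begin

text \<open>
  The proxy step-size of round \<open>s + 1\<close>, with \<open>c2\<close> in place of the square of the incoming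
  gradient. It is determined by the past, whereas \<open>b (Suc s)\<close> is not.
\<close>

definition proxy :: "nat \<Rightarrow> real \<Rightarrow> real"
  where "proxy s c2 = sqrt (\<beta>2 * v s + (1 - \<beta>2) * c2) + eps (Suc s)"

lemma proxy_ge:
  assumes "s < T" "0 \<le> c2"
  shows "sqrt (1 - \<beta>2) * sqrt c2 + \<epsilon>0 * (1 - \<beta>2) \<le> proxy s c2" "sqrt \<beta>2 * sqrt (v s) \<le> proxy s c2" "0 < proxy s c2"
proof -
  have "sqrt ((1 - \<beta>2) * c2) \<le> sqrt (\<beta>2 * v s + (1 - \<beta>2) * c2)"
    using v_nonneg[of s] assms \<beta>2_pos by simp
  then show 1: "sqrt (1 - \<beta>2) * sqrt c2 + \<epsilon>0 * (1 - \<beta>2) \<le> proxy s c2"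
    using eps_ge[of "Suc s"] by (simp add: proxy_def real_sqrt_mult)
  have "sqrt (\<beta>2 * v s) \<le> sqrt (\<beta>2 * v s + (1 - \<beta>2) * c2)"
    using assms \<beta>2_less by simp
  then show "sqrt \<beta>2 * sqrt (v s) \<le> proxy s c2"
    using eps_nonneg[of "Suc s"] by (simp add: proxy_def real_sqrt_mult)
  show "0 < proxy s c2"
    using 1 \<beta>2_less \<epsilon>0_pos assms by (smt (verit) mult_nonneg_nonneg mult_pos_pos real_sqrt_ge_zero)
qed

text \<open>
  With \<open>A\<close> and \<open>B\<close> the two square roots, \<open>(A - B)\<^sup>2 = A\<^sup>2 + B\<^sup>2 - 2 * A * B\<close>, and by Cauchy-Schwarz
  \<open>A * B\<close> is at least \<open>V + k * p * g\<close>. What remains is \<open>k * (S2 + (g - p)\<^sup>2)\<close>.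
\<close>

lemma proxy_minus_b_sq_le:
  assumes s: "s < T" and noise: "(g (Suc s) - p)\<^sup>2 \<le> S2"
  shows "(proxy s (p\<^sup>2 + S2) - b (Suc s))\<^sup>2 \<le> 2 * ((1 - \<beta>2) * S2)"
proof -
  define V where "V = \<beta>2 * v s"
  define k where "k = 1 - \<beta>2"
  define g' where "g' = g (Suc s)"
  have V: "0 \<le> V" and k: "0 \<le> k" using v_nonneg[of s] s \<beta>2_pos \<beta>2_less by (auto simp: V_def k_def)
  have S2: "0 \<le> S2" using noise zero_le_power2 order_trans by blast
  let ?A = "sqrt (V + k * (p\<^sup>2 + S2))" and ?B = "sqrt (V + k * g'\<^sup>2)"
  have "V + k * (p * g') \<le> ?A * ?B"
  proof (rule power2_le_imp_le)
    have "(V + k * (p * g'))\<^sup>2 \<le> (V + k * p\<^sup>2) * (V + k * g'\<^sup>2)"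
      using mult_nonneg_nonneg[OF mult_nonneg_nonneg[OF V k] zero_le_power2[of "p - g'"]]
      by (simp add: power2_eq_square algebra_simps)
    also have "\<dots> \<le> (V + k * (p\<^sup>2 + S2)) * (V + k * g'\<^sup>2)"
      using V k S2 by (intro mult_right_mono add_left_mono mult_left_mono) auto
    also have "\<dots> = (?A * ?B)\<^sup>2"
      using V k S2 by (simp add: power_mult_distrib)
    finally show "(V + k * (p * g'))\<^sup>2 \<le> (?A * ?B)\<^sup>2" .
    show "0 \<le> ?A * ?B" using V k S2 by simp
  qed
  moreover have "(?A - ?B)\<^sup>2 = (V + k * (p\<^sup>2 + S2)) + (V + k * g'\<^sup>2) - 2 * (?A * ?B)"
    using V k S2 by (simp add: power2_diff)
  ultimately have "(?A - ?B)\<^sup>2 \<le> k * (S2 + (g' - p)\<^sup>2)"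
    by (simp add: algebra_simps power2_eq_square)
  also have "\<dots> \<le> k * (S2 + S2)" using noise k by (intro mult_left_mono) (auto simp: g'_def)
  finally have "(?A - ?B)\<^sup>2 \<le> 2 * (k * S2)" by simp
  then show ?thesis
    using v_Suc[OF s] by (simp add: proxy_def b_def V_def k_def g'_def mult.assoc mult.left_commute)
qed

text \<open>
  The proxy against the denominator of the previous round. It can be larger because of the new
  square and the growth of \<open>eps\<close>, and then both its size and the increase bound the difference; it
  can be smaller only because \<open>v s\<close> is discounted by \<open>\<beta>2\<close>, and then the difference is a multiple
  \<open>1 - sqrt \<beta>2\<close> of \<open>sqrt (v s)\<close>.
\<close>

lemma proxy_minus_old_b_sq_le:
  assumes s: "1 \<le> s" "s < T" and c2: "0 \<le> c2" "c2 \<le> cb\<^sup>2" "0 \<le> cb" and v: "v s \<le> 2 * cb\<^sup>2"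
  shows "(proxy s c2 - b s)\<^sup>2 \<le> proxy s c2 * (sqrt (1 - \<beta>2) * ((\<epsilon>0 + sqrt 2 * cb) / sqrt \<beta>2))"
proof -
  let ?a = "proxy s c2" and ?W = "(\<epsilon>0 + sqrt 2 * cb) / sqrt \<beta>2" and ?r = "sqrt (1 - \<beta>2)"
  have a: "0 < ?a" "?r * sqrt c2 + \<epsilon>0 * (1 - \<beta>2) \<le> ?a" "sqrt \<beta>2 * sqrt (v s) \<le> ?a"
    using proxy_ge[OF s(2) c2(1)] by auto
  have vn: "0 \<le> v s" using v_nonneg s by simp
  have r: "0 \<le> ?r" "?r \<le> 1" "?r * ?r = 1 - \<beta>2" using \<beta>2_pos \<beta>2_less by auto
  have sb: "0 < sqrt \<beta>2" "sqrt \<beta>2 \<le> 1" "sqrt \<beta>2 * sqrt \<beta>2 = \<beta>2" using \<beta>2_pos \<beta>2_less by auto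
  have W: "\<epsilon>0 + sqrt 2 * cb \<le> ?W"
    using sb \<epsilon>0_pos c2 mult_left_le[of "sqrt \<beta>2" "\<epsilon>0 + sqrt 2 * cb"] by (simp add: pos_le_divide_eq)
  show ?thesis
  proof (cases "b s \<le> ?a")
    case True
    have "sqrt (\<beta>2 * v s + (1 - \<beta>2) * c2) \<le> sqrt (v s + (1 - \<beta>2) * c2)"
      using vn \<beta>2_pos \<beta>2_less mult_left_le_one_le[of "v s" \<beta>2] by simp
    also have "\<dots> \<le> sqrt (v s) + ?r * sqrt c2"
      using sqrt_add_le_add_sqrt[of "v s" "(1 - \<beta>2) * c2"] vn c2 \<beta>2_less by (simp add: real_sqrt_mult)
    finally have d: "?a - b s \<le> ?r * sqrt c2 + \<epsilon>0 * (1 - \<beta>2)"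
      using eps_Suc_diff[of s] by (simp add: proxy_def b_def)
    have "sqrt c2 \<le> cb" using c2 by (simp add: real_le_lsqrt)
    also have "cb \<le> sqrt 2 * cb" using c2 mult_right_mono[of 1 "sqrt 2" cb] by simp
    finally have "?r * sqrt c2 \<le> ?r * (sqrt 2 * cb)" using r by (intro mult_left_mono) auto
    moreover have "\<epsilon>0 * (1 - \<beta>2) \<le> ?r * \<epsilon>0"
    proof -
      have "?r * (?r * \<epsilon>0) \<le> ?r * \<epsilon>0"
        using r \<epsilon>0_pos mult_left_le_one_le[of "?r * \<epsilon>0" ?r] by simp
      moreover have "?r * (?r * \<epsilon>0) = \<epsilon>0 * (1 - \<beta>2)"
        using r(3) by (metis mult.assoc mult.commute)
      ultimately show ?thesis by simp
    qed
    ultimately have "?r * sqrt c2 + \<epsilon>0 * (1 - \<beta>2) \<le> ?r * (\<epsilon>0 + sqrt 2 * cb)"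
      by (simp add: algebra_simps)
    also have "\<dots> \<le> ?r * ?W" using W r by (intro mult_left_mono) auto
    finally have d2: "?a - b s \<le> ?r * ?W" using d by linarith
    have d1: "?a - b s \<le> ?a" using d a by linarith
    show ?thesis using d1 d2 True a unfolding power2_eq_square by (intro mult_mono) auto
  next
    case False
    have "b s - ?a \<le> sqrt (v s) - sqrt (\<beta>2 * v s)"
    proof -
      have "sqrt (\<beta>2 * v s) \<le> sqrt (\<beta>2 * v s + (1 - \<beta>2) * c2)" using c2 \<beta>2_less by simp
      then show ?thesis using eps_mono[of s "Suc s"] unfolding proxy_def b_def by linarith
    qed
    also have "\<dots> = (1 - sqrt \<beta>2) * sqrt (v s)" by (simp add: real_sqrt_mult algebra_simps)
    finally have d: "b s - ?a \<le> (1 - sqrt \<beta>2) * sqrt (v s)" .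
    have "1 - sqrt \<beta>2 \<le> 1 - \<beta>2" using sb mult_left_le[of "sqrt \<beta>2" "sqrt \<beta>2"] by simp
    also have "\<dots> \<le> ?r" using r mult_left_le[of ?r ?r] by simp
    finally have k: "1 - sqrt \<beta>2 \<le> ?r" .
    have sv: "sqrt (v s) \<le> sqrt 2 * cb"
      using real_sqrt_le_mono[OF v] c2 by (simp add: real_sqrt_mult)
    have e1: "b s - ?a \<le> ?r * (sqrt 2 * cb)"
      using d mult_mono[OF k sv] r vn by simp
    have e2: "b s - ?a \<le> sqrt (v s)"
      using d mult_right_mono[of "1 - sqrt \<beta>2" 1 "sqrt (v s)"] sb vn by simp
    have "sqrt (v s) \<le> ?a / sqrt \<beta>2" using a(3) sb by (simp add: pos_le_divide_eq mult.commute)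
    then have "(b s - ?a) * (b s - ?a) \<le> (?a / sqrt \<beta>2) * (?r * (sqrt 2 * cb))"
      using e1 e2 False a sb by (intro mult_mono) auto
    also have "\<dots> = ?a * (?r * ((sqrt 2 * cb) / sqrt \<beta>2))" by simp
    also have "\<dots> \<le> ?a * (?r * ?W)"
      using a r sb \<epsilon>0_pos by (intro mult_left_mono divide_right_mono) auto
    finally show ?thesis by (simp add: power2_eq_square algebra_simps)
  qed
qed

text \<open>
  The cost of replacing the true step-size by the proxy. The factor \<open>n\<close> is the new gradient in one
  use and a multiple of the momentum in the other.
\<close>

lemma surrogate_error_le:
  assumes s: "s < T" and noise: "(g (Suc s) - p)\<^sup>2 \<le> S2" and Sb: "S2 \<le> Sb\<^sup>2" "0 \<le> Sb"
  defines "a \<equiv> proxy s (p\<^sup>2 + S2)" and "E \<equiv> eta (Suc s)"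
  shows "p * (E * n * (1 / a - 1 / b (Suc s)))
    \<le> 1 / 8 * (E * p\<^sup>2 / a) + 4 * Sb * (E * sqrt (1 - \<beta>2) * n\<^sup>2 / u (Suc s))"
proof -
  let ?b = "b (Suc s)" and ?r = "sqrt (1 - \<beta>2)"
  have S2: "0 \<le> S2" using noise zero_le_power2 order_trans by blast
  have E: "0 < E" using eta_pos by (simp add: E_def)
  have b: "0 < ?b" using b_pos s by simp
  have ub: "0 < u (Suc s)" "u (Suc s) \<le> ?b\<^sup>2" using u_pos u_le_b_sq s by simp_all
  have a: "0 < a" "?r * sqrt (p\<^sup>2 + S2) + \<epsilon>0 * (1 - \<beta>2) \<le> a"
    using proxy_ge[OF s, of "p\<^sup>2 + S2"] S2 by (auto simp: a_def)
  have r: "0 \<le> ?r" "?r * ?r = 1 - \<beta>2" using \<beta>2_less by auto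
  have "?r * sqrt S2 \<le> ?r * sqrt (p\<^sup>2 + S2)" using r by (intro mult_left_mono) auto
  then have aS: "?r * sqrt S2 \<le> a" using a \<epsilon>0_pos \<beta>2_less by (smt (verit) mult_pos_pos)
  have "(1 - \<beta>2) * S2 = (?r * ?r) * (sqrt S2 * sqrt S2)" using S2 r by simp
  also have "\<dots> = (?r * sqrt S2) * (?r * sqrt S2)" by (simp only: ac_simps)
  also have "\<dots> \<le> a * (?r * Sb)"
    using aS a r Sb S2 by (intro mult_mono mult_left_mono real_le_lsqrt) auto
  finally have kS: "(1 - \<beta>2) * S2 \<le> a * (?r * Sb)" .
  have "p * (E * n * (1 / a - 1 / ?b))
      \<le> 1 / 8 * (E * p\<^sup>2 / a) + a * (E * n * (1 / a - 1 / ?b))\<^sup>2 / (4 * (1 / 8) * E)"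
    by (rule young_mult[OF E a(1)]) simp
  also have "a * (E * n * (1 / a - 1 / ?b))\<^sup>2 / (4 * (1 / 8) * E) = 2 * E * n\<^sup>2 * (a - ?b)\<^sup>2 / (a * ?b\<^sup>2)"
  proof -
    have "1 / a - 1 / ?b = (?b - a) / (a * ?b)" using a b by (simp add: field_simps)
    then have "(E * n * (1 / a - 1 / ?b))\<^sup>2 = E\<^sup>2 * n\<^sup>2 * (a - ?b)\<^sup>2 / (a\<^sup>2 * ?b\<^sup>2)"
      by (simp add: power_mult_distrib power_divide power2_commute)
    then show ?thesis using a b E by (simp add: power2_eq_square)
  qed
  also have "\<dots> \<le> 2 * E * n\<^sup>2 * (2 * (a * (?r * Sb))) / (a * ?b\<^sup>2)"
  proof -
    have "(a - ?b)\<^sup>2 \<le> 2 * (a * (?r * Sb))"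
      using proxy_minus_b_sq_le[OF s noise] kS by (simp add: a_def)
    then show ?thesis using E a by (intro divide_right_mono mult_left_mono) auto
  qed
  also have "\<dots> = 4 * Sb * (E * ?r * n\<^sup>2) / ?b\<^sup>2" using a by simp
  also have "\<dots> \<le> 4 * Sb * (E * ?r * n\<^sup>2) / u (Suc s)"
    using ub b Sb E r by (intro divide_left_mono) auto
  finally show ?thesis by simp
qed

lemma eta_Suc_m_sq_le:
  assumes "s < T"
  shows "eta (Suc s) * sqrt (1 - \<beta>2) * (m s)\<^sup>2 \<le> C0 * ((1 - \<beta>2) * q s)"
proof -
  let ?r = "sqrt (1 - \<beta>2)"
  have r: "0 \<le> ?r" "?r * ?r = 1 - \<beta>2" using \<beta>2_less by auto
  have P: "0 < 1 - \<beta>1 ^ Suc s" using pow1_le[of "Suc s"] \<beta>1_less by simp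
  have "\<beta>1 ^ Suc s \<le> \<beta>1 ^ s" using \<beta>1_nonneg \<beta>1_less by (intro power_decreasing) auto
  then have "(m s)\<^sup>2 \<le> (1 - \<beta>1 ^ Suc s) * q s"
    using m_sq_le[of s] assms mult_right_mono[of "1 - \<beta>1 ^ s" "1 - \<beta>1 ^ Suc s" "q s"] q_nonneg[of s] by simp
  then have "eta (Suc s) * ?r * (m s)\<^sup>2
      \<le> (C0 * ?r / (1 - \<beta>1 ^ Suc s)) * ?r * ((1 - \<beta>1 ^ Suc s) * q s)"
    using eta_le[of "Suc s"] eta_nonneg C0_pos P r
    by (intro mult_mono mult_right_mono) auto
  also have "\<dots> = C0 * ((?r * ?r) * q s)" using P by simp
  finally show ?thesis using r by simp
qed

text \<open>
  The cost of replacing the step-size of the previous round by the proxy, needed because the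
  momentum correction contains the difference of two consecutive step-sizes.
\<close>

lemma old_error_le:
  assumes s: "1 \<le> s" "s < T" and c2: "p\<^sup>2 \<le> c2" "c2 \<le> cb\<^sup>2" "0 \<le> cb" and v: "v s \<le> 2 * cb\<^sup>2"
  defines "a \<equiv> proxy s c2" and "E \<equiv> eta (Suc s)"
  shows "p * (E * n * (1 / a - 1 / b s))
    \<le> 1 / 4 * (E * p\<^sup>2 / a) + (\<epsilon>0 + sqrt 2 * cb) / sqrt \<beta>2 * (E * sqrt (1 - \<beta>2) * n\<^sup>2 / u s)"
proof -
  let ?b = "b s" and ?r = "sqrt (1 - \<beta>2)" and ?W = "(\<epsilon>0 + sqrt 2 * cb) / sqrt \<beta>2"
  have c2n: "0 \<le> c2" using c2(1) zero_le_power2 order_trans by blast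
  have E: "0 < E" using eta_pos by (simp add: E_def)
  have b: "0 < ?b" using b_pos s by simp
  have ub: "0 < u s" "u s \<le> ?b\<^sup>2" using u_pos u_le_b_sq s by simp_all
  have a: "0 < a" using proxy_ge[OF s(2) c2n] by (auto simp: a_def)
  have "p * (E * n * (1 / a - 1 / ?b))
      \<le> 1 / 4 * (E * p\<^sup>2 / a) + a * (E * n * (1 / a - 1 / ?b))\<^sup>2 / (4 * (1 / 4) * E)"
    by (rule young_mult[OF E a]) simp
  also have "a * (E * n * (1 / a - 1 / ?b))\<^sup>2 / (4 * (1 / 4) * E) = E * n\<^sup>2 * (a - ?b)\<^sup>2 / (a * ?b\<^sup>2)"
  proof -
    have "1 / a - 1 / ?b = (?b - a) / (a * ?b)" using a b by (simp add: field_simps)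
    then have "(E * n * (1 / a - 1 / ?b))\<^sup>2 = E\<^sup>2 * n\<^sup>2 * (a - ?b)\<^sup>2 / (a\<^sup>2 * ?b\<^sup>2)"
      by (simp add: power_mult_distrib power_divide power2_commute)
    then show ?thesis using a b E by (simp add: power2_eq_square)
  qed
  also have "\<dots> \<le> E * n\<^sup>2 * (a * (?r * ?W)) / (a * ?b\<^sup>2)"
    using proxy_minus_old_b_sq_le[OF s c2n c2(2,3) v] E a
    by (intro divide_right_mono mult_left_mono) (auto simp: a_def)
  also have "\<dots> = ?W * (E * ?r * n\<^sup>2) / ?b\<^sup>2" using a by simp
  also have "\<dots> \<le> ?W * (E * ?r * n\<^sup>2) / u s"
    using ub b E \<beta>2_pos \<beta>2_less \<epsilon>0_pos c2
    by (intro divide_left_mono mult_nonneg_nonneg divide_nonneg_nonneg) auto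
  finally show ?thesis by simp
qed

text \<open>
  \<open>eta\<close> is a product of an increasing and a decreasing factor, and need not be monotone. Each
  factor varies in total by a bounded amount, which bounds the variation of the product.
\<close>

lemma sum_eta_variation_le:
  "(\<Sum>s<t. if s = 0 then 0 else \<bar>eta (Suc s) - eta s\<bar>) \<le> 2 * C0 * sqrt (1 - \<beta>2) / (1 - \<beta>1)"
proof (cases "t = 0")
  case False
  define K where "K = C0 * sqrt (1 - \<beta>2)"
  define h k where "h s = sqrt (1 - \<beta>2 ^ s)" and "k s = 1 / (1 - \<beta>1 ^ s)" for s :: nat
  have K: "0 \<le> K" using C0_pos \<beta>2_less by (simp add: K_def)
  have eta: "eta s = K * (h s * k s)" for s by (simp add: eta_def adam_eta_def K_def h_def k_def)
  have h: "h s \<le> h (Suc s)" "0 \<le> h s" "h s \<le> 1" for s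
    using pow2_le_1 pow2_pos[of s] power_decreasing[of s "Suc s" \<beta>2] \<beta>2_pos \<beta>2_less
    by (auto simp: h_def simp del: power_Suc)
  have k: "k (Suc s) \<le> k s" "0 \<le> k s" "k s \<le> 1 / (1 - \<beta>1)" if "s \<ge> 1" for s
    using pow1_le[OF that] \<beta>1_less power_decreasing[of s "Suc s" \<beta>1] \<beta>1_nonneg
    by (auto simp: k_def intro!: divide_left_mono mult_pos_pos simp del: power_Suc)
  have step: "\<bar>eta (Suc s) - eta s\<bar> \<le> K * ((h (Suc s) - h s) / (1 - \<beta>1)) + K * (k s - k (Suc s))"
    if s: "s \<ge> 1" for s
  proof -
    have "h (Suc s) * k (Suc s) - h s * k s = (h (Suc s) - h s) * k (Suc s) + h s * (k (Suc s) - k s)"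
      by (simp add: algebra_simps)
    then have "\<bar>h (Suc s) * k (Suc s) - h s * k s\<bar>
        \<le> (h (Suc s) - h s) * k (Suc s) + h s * (k s - k (Suc s))"
      using abs_triangle_ineq[of "(h (Suc s) - h s) * k (Suc s)" "h s * (k (Suc s) - k s)"]
        h[of s] k[of s] k[of "Suc s"] s by (simp add: abs_mult)
    also have "\<dots> \<le> (h (Suc s) - h s) * (1 / (1 - \<beta>1)) + 1 * (k s - k (Suc s))"
      using h k[of s] k[of "Suc s"] s by (intro add_mono mult_left_mono mult_right_mono) auto
    finally have "K * \<bar>h (Suc s) * k (Suc s) - h s * k s\<bar>
        \<le> K * ((h (Suc s) - h s) * (1 / (1 - \<beta>1)) + 1 * (k s - k (Suc s)))"
      using K by (rule mult_left_mono)
    moreover have "\<bar>eta (Suc s) - eta s\<bar> = K * \<bar>h (Suc s) * k (Suc s) - h s * k s\<bar>"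
      using K unfolding eta by (simp add: abs_mult flip: right_diff_distrib)
    ultimately show ?thesis by (simp add: algebra_simps diff_divide_distrib)
  qed
  have "(\<Sum>s<Suc n. if s = 0 then 0 else \<bar>eta (Suc s) - eta s\<bar>)
      \<le> K * (h (Suc n) / (1 - \<beta>1)) - K * k (Suc n) + K / (1 - \<beta>1)" for n
  proof (induction n)
    case 0
    show ?case using K h(2)[of 1] \<beta>1_less by (simp add: k_def)
  next
    case (Suc n)
    then show ?case using step[of "Suc n"] by (simp add: diff_divide_distrib right_diff_distrib)
  qed
  from this[of "t - 1"] False
  have "(\<Sum>s<t. if s = 0 then 0 else \<bar>eta (Suc s) - eta s\<bar>)
      \<le> K * (h t / (1 - \<beta>1)) - K * k t + K / (1 - \<beta>1)" by simp
  also have "\<dots> \<le> K * (1 / (1 - \<beta>1)) - 0 + K / (1 - \<beta>1)"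
    using K h(3)[of t] k(2)[of t] False \<beta>1_less
    by (intro add_right_mono diff_mono mult_left_mono divide_right_mono) auto
  finally show ?thesis by (simp add: K_def)
qed (use C0_pos \<beta>2_less \<beta>1_less in simp)

end

section \<open>The first-order terms in one coordinate\<close>

context adam_coordinate
begin

lemma sum_w_g_sq_le:
  assumes t: "t \<le> T" and \<Lambda>: "(\<Sum>s<t. (1 - \<beta>2) * ((g (Suc s))\<^sup>2 / u (Suc s))) \<le> \<Lambda>"
  shows "(\<Sum>s<t. (w (Suc s) * g (Suc s))\<^sup>2) \<le> C0\<^sup>2 / (1 - \<beta>1)\<^sup>2 * \<Lambda>"
proof -
  have "(w (Suc s) * g (Suc s))\<^sup>2 \<le> C0\<^sup>2 / (1 - \<beta>1)\<^sup>2 * ((1 - \<beta>2) * ((g (Suc s))\<^sup>2 / u (Suc s)))"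
    if "s < t" for s
  proof -
    have ub: "0 < u (Suc s)" "u (Suc s) \<le> (b (Suc s))\<^sup>2" and b: "0 < b (Suc s)"
      using that t u_pos u_le_b_sq b_pos by simp_all
    have "(eta (Suc s))\<^sup>2 \<le> C0\<^sup>2 * (1 - \<beta>2) / (1 - \<beta>1)\<^sup>2"
      using power_mono[OF eta_le' eta_nonneg, of "Suc s" 2] \<beta>2_less
      by (simp add: power_mult_distrib power_divide)
    then have "(eta (Suc s))\<^sup>2 * (g (Suc s))\<^sup>2 / (b (Suc s))\<^sup>2
        \<le> (C0\<^sup>2 * (1 - \<beta>2) / (1 - \<beta>1)\<^sup>2) * (g (Suc s))\<^sup>2 / u (Suc s)"
      using ub b \<beta>2_less by (intro frac_le mult_right_mono) auto
    then show ?thesis by (simp add: w_def power_mult_distrib power_divide)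
  qed
  then have "(\<Sum>s<t. (w (Suc s) * g (Suc s))\<^sup>2)
      \<le> (\<Sum>s<t. C0\<^sup>2 / (1 - \<beta>1)\<^sup>2 * ((1 - \<beta>2) * ((g (Suc s))\<^sup>2 / u (Suc s))))"
    by (intro sum_mono) auto
  also have "\<dots> = C0\<^sup>2 / (1 - \<beta>1)\<^sup>2 * (\<Sum>s<t. (1 - \<beta>2) * ((g (Suc s))\<^sup>2 / u (Suc s)))"
    by (rule sum_distrib_left[symmetric])
  also have "\<dots> \<le> C0\<^sup>2 / (1 - \<beta>1)\<^sup>2 * \<Lambda>" using \<Lambda> by (intro mult_left_mono) auto
  finally show ?thesis .
qed

lemma \<rho>_pos: "0 < 1 - \<beta>1 / \<beta>2"
  using \<beta>12 \<beta>2_pos by simp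

lemma sum_q_over_u_le:
  assumes t: "t \<le> T" and \<Lambda>: "(\<Sum>s<t. (1 - \<beta>2) * ((g (Suc s))\<^sup>2 / u (Suc s))) \<le> \<Lambda>"
  shows "(\<Sum>s<t. (1 - \<beta>2) * (q s / u s)) \<le> (1 - \<beta>1) / (1 - \<beta>1 / \<beta>2) * \<Lambda>"
proof -
  have "0 \<le> q t / u t" using q_nonneg[of t] u_pos[OF t] by simp
  then have "(1 - \<beta>1 / \<beta>2) * (\<Sum>s<t. q s / u s) \<le> (1 - \<beta>1) * (\<Sum>s<t. (g (Suc s))\<^sup>2 / u (Suc s))"
    using sum_q_over_u[OF t] by linarith
  then have "(1 - \<beta>2) * ((1 - \<beta>1 / \<beta>2) * (\<Sum>s<t. q s / u s))
      \<le> (1 - \<beta>2) * ((1 - \<beta>1) * (\<Sum>s<t. (g (Suc s))\<^sup>2 / u (Suc s)))"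
    using \<beta>2_less by (intro mult_left_mono) auto
  also have "\<dots> = (1 - \<beta>1) * (\<Sum>s<t. (1 - \<beta>2) * ((g (Suc s))\<^sup>2 / u (Suc s)))"
    by (simp add: sum_distrib_left mult.left_commute)
  also have "\<dots> \<le> (1 - \<beta>1) * \<Lambda>" using \<Lambda> \<beta>1_less by (intro mult_left_mono) auto
  finally have "(1 - \<beta>1 / \<beta>2) * (\<Sum>s<t. (1 - \<beta>2) * (q s / u s)) \<le> (1 - \<beta>1) * \<Lambda>"
    by (simp add: sum_distrib_left mult.left_commute)
  then show ?thesis using \<rho>_pos by (simp add: pos_le_divide_eq mult.commute)
qed

lemma sum_step_sq_le:
  assumes t: "t \<le> T" and \<Lambda>: "(\<Sum>s<t. (1 - \<beta>2) * ((g (Suc s))\<^sup>2 / u (Suc s))) \<le> \<Lambda>"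
  shows "(\<Sum>s<t. (w s * m s)\<^sup>2) \<le> C0\<^sup>2 / (1 - \<beta>1 / \<beta>2) * \<Lambda>"
proof -
  have "(w s * m s)\<^sup>2 \<le> C0\<^sup>2 / (1 - \<beta>1) * ((1 - \<beta>2) * (q s / u s))" if "s < t" for s
  proof (cases "s = 0")
    case False
    then have s: "1 \<le> s" "s \<le> T" using that t by auto
    have ub: "0 < u s" "u s \<le> (b s)\<^sup>2" and b: "0 < b s"
      using s u_pos u_le_b_sq b_pos by simp_all
    have P: "0 < 1 - \<beta>1 ^ s" "1 - \<beta>1 \<le> 1 - \<beta>1 ^ s" using pow1_le[OF s(1)] \<beta>1_less by auto
    have "(eta s)\<^sup>2 * (m s)\<^sup>2 \<le> (C0\<^sup>2 * (1 - \<beta>2) / (1 - \<beta>1 ^ s)\<^sup>2) * ((1 - \<beta>1 ^ s) * q s)"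
      using eta_sq_le[OF s(1)] m_sq_le[OF s(2)] \<beta>2_less by (intro mult_mono) auto
    also have "\<dots> = (C0\<^sup>2 * (1 - \<beta>2) * q s) / (1 - \<beta>1 ^ s)"
      using P by (simp add: power2_eq_square)
    also have "\<dots> \<le> (C0\<^sup>2 * (1 - \<beta>2) * q s) / (1 - \<beta>1)"
      using P \<beta>1_less \<beta>2_less q_nonneg[of s] by (intro divide_left_mono) auto
    finally have "(eta s)\<^sup>2 * (m s)\<^sup>2 / (b s)\<^sup>2 \<le> (C0\<^sup>2 * (1 - \<beta>2) * q s) / (1 - \<beta>1) / u s"
      using ub b q_nonneg[of s] \<beta>1_less \<beta>2_less by (intro frac_le) auto
    then show ?thesis by (simp add: w_def power_mult_distrib power_divide)
  qed (simp add: m_0)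
  then have "(\<Sum>s<t. (w s * m s)\<^sup>2) \<le> (\<Sum>s<t. C0\<^sup>2 / (1 - \<beta>1) * ((1 - \<beta>2) * (q s / u s)))"
    by (intro sum_mono) auto
  also have "\<dots> = C0\<^sup>2 / (1 - \<beta>1) * (\<Sum>s<t. (1 - \<beta>2) * (q s / u s))"
    by (rule sum_distrib_left[symmetric])
  also have "\<dots> \<le> C0\<^sup>2 / (1 - \<beta>1) * ((1 - \<beta>1) / (1 - \<beta>1 / \<beta>2) * \<Lambda>)"
    using sum_q_over_u_le[OF assms] \<beta>1_less by (intro mult_left_mono) auto
  finally show ?thesis using \<beta>1_less by simp
qed

text \<open>
  The ratio \<open>w (Suc s) / w s\<close> lies between \<open>0\<close> and \<open>sqrt ((1 + \<beta>2) / \<beta>2)\<close>: the bias correction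
  grows at most by \<open>sqrt (1 + \<beta>2)\<close> after the first round, and the denominator shrinks at most by
  \<open>sqrt \<beta>2\<close>. This is where \<open>Sigma_max\<close> comes from.
\<close>

lemma w_variation_le:
  assumes "s < T"
  shows "(m s * (w (Suc s) - w s))\<^sup>2 \<le> (Sigma_max \<beta>2)\<^sup>2 * (w s * m s)\<^sup>2"
proof (cases "s = 0")
  case False
  then have s: "1 \<le> s" "s \<le> T" using assms by auto
  let ?R = "sqrt ((1 + \<beta>2) / \<beta>2)"
  have b: "0 < b s" "0 < b (Suc s)" using b_pos s assms by simp_all
  have bb: "sqrt \<beta>2 * b s \<le> b (Suc s)"
  proof -
    have "sqrt (\<beta>2 * v s) \<le> sqrt (v (Suc s))" using v_Suc[OF assms] \<beta>2_less by simp
    moreover have "sqrt \<beta>2 * eps s \<le> eps s"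
      using eps_nonneg[of s] \<beta>2_pos \<beta>2_less by (intro mult_left_le_one_le) auto
    ultimately show ?thesis using eps_mono[of s "Suc s"]
      by (simp add: b_def real_sqrt_mult distrib_left)
  qed
  have "eta (Suc s) \<le> sqrt (1 + \<beta>2) * eta s"
  proof -
    have "\<beta>2 ^ s \<le> \<beta>2" using pow2_le s by simp
    then have "1 - \<beta>2 ^ Suc s \<le> (1 + \<beta>2) * (1 - \<beta>2 ^ s)" by (simp add: algebra_simps)
    then have h: "sqrt (1 - \<beta>2 ^ Suc s) \<le> sqrt (1 + \<beta>2) * sqrt (1 - \<beta>2 ^ s)"
      using real_sqrt_le_mono by (fastforce simp: real_sqrt_mult)
    have k: "1 - \<beta>1 ^ s \<le> 1 - \<beta>1 ^ Suc s" "0 < 1 - \<beta>1 ^ s"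
      using power_decreasing[of s "Suc s" \<beta>1] \<beta>1_nonneg \<beta>1_less pow1_le[OF s(1)] by auto
    have "C0 * sqrt (1 - \<beta>2) * sqrt (1 - \<beta>2 ^ Suc s) / (1 - \<beta>1 ^ Suc s)
        \<le> C0 * sqrt (1 - \<beta>2) * (sqrt (1 + \<beta>2) * sqrt (1 - \<beta>2 ^ s)) / (1 - \<beta>1 ^ s)"
      using h k C0_pos \<beta>2_pos \<beta>2_less pow2_le_1[of s]
      by (intro frac_le mult_left_mono mult_nonneg_nonneg) auto
    then show ?thesis by (simp add: eta_def adam_eta_def mult.left_commute mult.assoc)
  qed
  then have "w (Suc s) \<le> (sqrt (1 + \<beta>2) * eta s) / (sqrt \<beta>2 * b s)"
    unfolding w_def using bb b \<beta>2_pos eta_nonneg by (intro frac_le) auto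
  then have R: "w (Suc s) \<le> ?R * w s" by (simp add: w_def real_sqrt_divide)
  have w: "0 \<le> w s" "0 \<le> w (Suc s)" using b eta_nonneg by (auto simp: w_def)
  have "?R * w s - w s \<le> Sigma_max \<beta>2 * w s"
    using mult_right_mono[of "?R - 1" "Sigma_max \<beta>2" "w s"] w by (simp add: Sigma_max_def algebra_simps)
  moreover have "w s \<le> Sigma_max \<beta>2 * w s"
    using mult_right_mono[of 1 "Sigma_max \<beta>2" "w s"] w by (simp add: Sigma_max_def)
  ultimately have "\<bar>w (Suc s) - w s\<bar> \<le> Sigma_max \<beta>2 * w s" using R w by linarith
  then have "(w (Suc s) - w s)\<^sup>2 \<le> (Sigma_max \<beta>2 * w s)\<^sup>2"
    by (metis abs_ge_zero power2_abs power_mono)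
  then have "(m s)\<^sup>2 * (w (Suc s) - w s)\<^sup>2 \<le> (m s)\<^sup>2 * (Sigma_max \<beta>2 * w s)\<^sup>2"
    by (intro mult_left_mono) auto
  then show ?thesis by (simp add: power_mult_distrib mult.commute mult.left_commute)
qed (simp add: m_0)

lemma v_le_of_noise:
  assumes "t \<le> T" and noise: "\<And>s. s < t \<Longrightarrow> (g (Suc s) - p s)\<^sup>2 \<le> S2 s"
    and cb: "\<And>s. s < t \<Longrightarrow> (p s)\<^sup>2 + S2 s \<le> cb\<^sup>2"
  shows "s \<le> t \<Longrightarrow> v s \<le> 2 * cb\<^sup>2"
proof (induction s)
  case (Suc s)
  have "(g (Suc s))\<^sup>2 \<le> 2 * ((p s)\<^sup>2 + (g (Suc s) - p s)\<^sup>2)"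
    using zero_le_power2[of "g (Suc s) - 2 * p s"] by (simp add: power2_eq_square algebra_simps)
  also have "\<dots> \<le> 2 * cb\<^sup>2" using noise[of s] cb[of s] Suc.prems by simp
  finally have "(g (Suc s))\<^sup>2 \<le> 2 * cb\<^sup>2" .
  then have "v (Suc s) \<le> \<beta>2 * (2 * cb\<^sup>2) + (1 - \<beta>2) * (2 * cb\<^sup>2)"
    using v_Suc[of s] Suc assms(1) \<beta>2_pos \<beta>2_less by (auto intro!: add_mono mult_left_mono)
  then show ?case by (simp add: algebra_simps)
qed (simp add: v_0)

text \<open>
  The first-order term of one round. The gradient step contributes the descent, the weighted noise
  and one exchange error. In the momentum correction, the change of step-size is split into true
  step-size to proxy, proxy to old step-size, and the change of \<open>eta\<close> alone. The three exchanges
  use up the fractions \<open>1/8\<close>, \<open>1/8\<close> and \<open>1/4\<close> of the descent.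
\<close>

lemma round_bound:
  assumes s: "s < T" and noise: "(g (Suc s) - p)\<^sup>2 \<le> S2"
    and Sb: "S2 \<le> Sb\<^sup>2" "0 \<le> Sb" and cb: "p\<^sup>2 + S2 \<le> cb\<^sup>2" "0 \<le> cb" and H: "\<bar>p\<bar> \<le> H"
    and v: "v s \<le> 2 * cb\<^sup>2" and \<kappa>: "0 \<le> \<kappa>"
  defines "a \<equiv> proxy s (p\<^sup>2 + S2)"
  shows "p * (- (w (Suc s) * g (Suc s)) - \<kappa> * (m s * (w (Suc s) - w s)))
    \<le> - (1 / 2) * (eta (Suc s) * p\<^sup>2 / a) - eta (Suc s) * p * (g (Suc s) - p) / a
      + 4 * C0 * Sb / (1 - \<beta>1) * ((1 - \<beta>2) * ((g (Suc s))\<^sup>2 / u (Suc s)))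
      + \<kappa>\<^sup>2 * C0 * (4 * Sb / \<beta>2 + (\<epsilon>0 + sqrt 2 * cb) / sqrt \<beta>2) * ((1 - \<beta>2) * (q s / u s))
      + \<kappa> * H * (sqrt (1 - \<beta>1) / sqrt (1 - \<beta>2)) * (if s = 0 then 0 else \<bar>eta (Suc s) - eta s\<bar>)"
proof -
  let ?g = "g (Suc s)" and ?b = "b (Suc s)" and ?E = "eta (Suc s)" and ?r = "sqrt (1 - \<beta>2)"
  define X where "X = ?E * p\<^sup>2 / a"
  define W where "W = (\<epsilon>0 + sqrt 2 * cb) / sqrt \<beta>2"
  define Q where "Q = (1 - \<beta>2) * (q s / u s)"
  have S2: "0 \<le> S2" using noise zero_le_power2 order_trans by blast
  have E: "0 < ?E" using eta_pos by simp
  have b: "0 < ?b" using b_pos s by simp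
  have ub: "0 < u (Suc s)" "0 < u s" "\<beta>2 * u s \<le> u (Suc s)" using u_pos u_Suc_ge s by simp_all
  have a: "0 < a" using proxy_ge[OF s, of "p\<^sup>2 + S2"] S2 by (auto simp: a_def)
  have W: "0 \<le> W" using \<epsilon>0_pos cb \<beta>2_pos by (simp add: W_def)
  have Q: "0 \<le> Q" using q_nonneg[of s] ub \<beta>2_less by (simp add: Q_def)
  have r: "0 < ?r" "?r * ?r = 1 - \<beta>2" using \<beta>2_less by auto
  have P: "X \<ge> 0" using E a by (simp add: X_def)
  have Em: "?E * ?r * (m s)\<^sup>2 / u s \<le> C0 * Q"
    using divide_right_mono[OF eta_Suc_m_sq_le[OF s], of "u s"] ub by (simp add: Q_def)
  \<comment> \<open>Two uses of the proxy in place of the new step-size: for the gradient and for the momentum.\<close>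
  have T1: "p * (?E * ?g * (1 / a - 1 / ?b)) \<le> 1 / 8 * X
      + 4 * C0 * Sb / (1 - \<beta>1) * ((1 - \<beta>2) * (?g\<^sup>2 / u (Suc s)))"
  proof -
    have "?E * ?r \<le> (C0 * ?r / (1 - \<beta>1)) * ?r" using eta_le'[of "Suc s"] r by (intro mult_right_mono) auto
    also have "\<dots> = C0 / (1 - \<beta>1) * (1 - \<beta>2)" using \<beta>2_less by simp
    finally have "4 * Sb * (?E * ?r * ?g\<^sup>2 / u (Suc s)) \<le> 4 * Sb * (C0 / (1 - \<beta>1) * (1 - \<beta>2) * ?g\<^sup>2 / u (Suc s))"
      using Sb ub by (intro mult_left_mono divide_right_mono mult_right_mono) auto
    also have "\<dots> = 4 * C0 * Sb / (1 - \<beta>1) * ((1 - \<beta>2) * (?g\<^sup>2 / u (Suc s)))" by simp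
    finally show ?thesis
      using surrogate_error_le[OF s noise Sb, of ?g] unfolding X_def a_def by linarith
  qed
  have T2: "p * (?E * (\<kappa> * m s) * (1 / a - 1 / ?b)) \<le> 1 / 8 * X + \<kappa>\<^sup>2 * C0 * (4 * Sb / \<beta>2) * Q"
  proof -
    have "?E * ?r * (m s)\<^sup>2 / u (Suc s) \<le> ?E * ?r * (m s)\<^sup>2 / (\<beta>2 * u s)"
      using ub \<beta>2_pos E r by (intro divide_left_mono) auto
    also have "\<dots> = (?E * ?r * (m s)\<^sup>2 / u s) / \<beta>2" by simp
    also have "\<dots> \<le> (C0 * Q) / \<beta>2" using Em \<beta>2_pos by (intro divide_right_mono) auto
    finally have "4 * Sb * \<kappa>\<^sup>2 * (?E * ?r * (m s)\<^sup>2 / u (Suc s)) \<le> 4 * Sb * \<kappa>\<^sup>2 * ((C0 * Q) / \<beta>2)"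
      using Sb by (intro mult_left_mono) auto
    then have "4 * Sb * (?E * ?r * (\<kappa> * m s)\<^sup>2 / u (Suc s)) \<le> \<kappa>\<^sup>2 * C0 * (4 * Sb / \<beta>2) * Q"
      by (simp add: power_mult_distrib ac_simps)
    then show ?thesis
      using surrogate_error_le[OF s noise Sb, of "\<kappa> * m s"] unfolding X_def a_def by linarith
  qed
  have key: "- p * (\<kappa> * (m s * (w (Suc s) - w s)))
    \<le> 3 / 8 * X + \<kappa>\<^sup>2 * C0 * (4 * Sb / \<beta>2 + W) * Q
      + \<kappa> * H * (sqrt (1 - \<beta>1) / ?r) * (if s = 0 then 0 else \<bar>?E - eta s\<bar>)"
  proof (cases "s = 0")
    case True
    have "0 \<le> \<kappa>\<^sup>2 * C0 * (4 * Sb / \<beta>2 + W) * Q" using C0_pos Sb \<beta>2_pos W Q by simp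
    then show ?thesis using True P by (simp add: m_0)
  next
    case False
    then have s1: "1 \<le> s" "s \<le> T" using s by auto
    have b1: "0 < b s" using b_pos[OF s1] .
    have T3: "p * (?E * (- \<kappa> * m s) * (1 / a - 1 / b s)) \<le> 1 / 4 * X + \<kappa>\<^sup>2 * C0 * W * Q"
    proof -
      have "W * \<kappa>\<^sup>2 * (?E * ?r * (m s)\<^sup>2 / u s) \<le> W * \<kappa>\<^sup>2 * (C0 * Q)"
        using Em W by (intro mult_left_mono) auto
      then have "W * (?E * ?r * (- \<kappa> * m s)\<^sup>2 / u s) \<le> \<kappa>\<^sup>2 * C0 * W * Q"
        by (simp add: power_mult_distrib ac_simps)
      then show ?thesis
        using old_error_le[OF s1(1) s _ cb v, of p "- \<kappa> * m s"] S2 unfolding X_def a_def W_def by simp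
    qed
    have T4: "- p * \<kappa> * m s * ((?E - eta s) / b s) \<le> \<kappa> * H * (sqrt (1 - \<beta>1) / ?r) * \<bar>?E - eta s\<bar>"
    proof -
      have "(1 - \<beta>1 ^ s) * (1 - \<beta>1) * (b s)\<^sup>2 \<le> (1 - \<beta>1) * (b s)\<^sup>2"
        using pow1_nonneg[of s] \<beta>1_less
          mult_right_mono[of "1 - \<beta>1 ^ s" 1 "(1 - \<beta>1) * (b s)\<^sup>2"] by simp
      then have "(1 - \<beta>2) * (m s)\<^sup>2 \<le> (1 - \<beta>1) * (b s)\<^sup>2" using m_over_b[OF s1] by linarith
      then have "sqrt ((1 - \<beta>2) * (m s)\<^sup>2) \<le> sqrt ((1 - \<beta>1) * (b s)\<^sup>2)" by (rule real_sqrt_le_mono)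
      then have "?r * \<bar>m s\<bar> \<le> sqrt (1 - \<beta>1) * b s" using b1 by (simp add: real_sqrt_mult)
      then have mb: "\<bar>m s\<bar> / b s \<le> sqrt (1 - \<beta>1) / ?r"
        using b1 r by (simp add: divide_le_eq pos_le_divide_eq mult.commute)
      have "- p * \<kappa> * m s * ((?E - eta s) / b s) \<le> \<bar>p * \<kappa> * m s * ((?E - eta s) / b s)\<bar>"
        by (simp add: abs_if)
      also have "\<dots> = \<kappa> * (\<bar>p\<bar> * (\<bar>m s\<bar> / b s)) * \<bar>?E - eta s\<bar>"
        using \<kappa> b1 by (simp add: abs_mult)
      also have "\<dots> \<le> \<kappa> * (H * (sqrt (1 - \<beta>1) / ?r)) * \<bar>?E - eta s\<bar>"
        using \<kappa> H mb b1 \<beta>1_less r by (intro mult_right_mono mult_left_mono mult_mono) auto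
      finally show ?thesis by simp
    qed
    have "w (Suc s) - w s = - ?E * (1 / a - 1 / ?b) + ?E * (1 / a - 1 / b s) + (?E - eta s) / b s"
      using a b b1 by (simp add: w_def field_simps)
    then have "- p * (\<kappa> * (m s * (w (Suc s) - w s)))
        = p * (?E * (\<kappa> * m s) * (1 / a - 1 / ?b)) + p * (?E * (- \<kappa> * m s) * (1 / a - 1 / b s))
          + - p * \<kappa> * m s * ((?E - eta s) / b s)"
      by (simp only:) (simp add: algebra_simps)
    then show ?thesis using T2 T3 T4 False by (simp add: distrib_left distrib_right)
  qed
  have "- p * (w (Suc s) * ?g) = p * (?E * ?g * (1 / a - 1 / ?b)) - X - ?E * p * (?g - p) / a"
    using a b by (simp add: w_def X_def field_simps power2_eq_square)
  then have "p * (- (w (Suc s) * ?g) - \<kappa> * (m s * (w (Suc s) - w s)))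
      = p * (?E * ?g * (1 / a - 1 / ?b)) - X - ?E * p * (?g - p) / a + - p * (\<kappa> * (m s * (w (Suc s) - w s)))"
    by (simp add: right_diff_distrib)
  then show ?thesis using T1 key unfolding X_def[symmetric] W_def[symmetric] Q_def[symmetric] by linarith
qed

text \<open>
  Summed over the rounds, the three exchanges leave half of the descent. The noise may consume
  another sixth, the share for which the weights below are tuned; a third remains.
\<close>

lemma coordinate_bound:
  assumes t: "t \<le> T" and noise: "\<And>s. s < t \<Longrightarrow> (g (Suc s) - p s)\<^sup>2 \<le> S2 s"
    and Sb: "\<And>s. s < t \<Longrightarrow> S2 s \<le> Sb\<^sup>2" "0 \<le> Sb"
    and cb: "\<And>s. s < t \<Longrightarrow> (p s)\<^sup>2 + S2 s \<le> cb\<^sup>2" "0 \<le> cb"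
    and H: "\<And>s. s < t \<Longrightarrow> \<bar>p s\<bar> \<le> H" "0 \<le> H" and \<kappa>: "0 \<le> \<kappa>"
    and \<Lambda>: "(\<Sum>s<t. (1 - \<beta>2) * ((g (Suc s))\<^sup>2 / u (Suc s))) \<le> \<Lambda>"
  defines "P \<equiv> (\<Sum>s<t. eta (Suc s) * (p s)\<^sup>2 / proxy s ((p s)\<^sup>2 + S2 s))"
  assumes mart: "(\<Sum>s<t. - (eta (Suc s) * p s * (g (Suc s) - p s) / proxy s ((p s)\<^sup>2 + S2 s)))
      \<le> 1 / 6 * P + N"
  shows "(\<Sum>s<t. p s * (- (w (Suc s) * g (Suc s)) - \<kappa> * (m s * (w (Suc s) - w s))))
    \<le> - (1 / 3) * P + N + 4 * C0 * Sb / (1 - \<beta>1) * \<Lambda>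
      + \<kappa>\<^sup>2 * C0 / (1 - \<beta>1 / \<beta>2) * (4 * Sb / \<beta>2 + (\<epsilon>0 + sqrt 2 * cb) / sqrt \<beta>2) * \<Lambda>
      + 2 * \<kappa> * H * C0 / sqrt (1 - \<beta>1)"
proof -
  let ?A = "4 * C0 * Sb / (1 - \<beta>1)"
  let ?B = "\<kappa>\<^sup>2 * C0 * (4 * Sb / \<beta>2 + (\<epsilon>0 + sqrt 2 * cb) / sqrt \<beta>2)"
  let ?Y = "\<kappa> * H * (sqrt (1 - \<beta>1) / sqrt (1 - \<beta>2))"
  let ?X = "\<lambda>s. eta (Suc s) * (p s)\<^sup>2 / proxy s ((p s)\<^sup>2 + S2 s)"
  let ?Z = "\<lambda>s. eta (Suc s) * p s * (g (Suc s) - p s) / proxy s ((p s)\<^sup>2 + S2 s)"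
  let ?G = "\<lambda>s. (1 - \<beta>2) * ((g (Suc s))\<^sup>2 / u (Suc s))" and ?Q = "\<lambda>s. (1 - \<beta>2) * (q s / u s)"
  let ?D = "\<lambda>s. if s = 0 then 0 else \<bar>eta (Suc s) - eta s\<bar>"
  have "(\<Sum>s<t. p s * (- (w (Suc s) * g (Suc s)) - \<kappa> * (m s * (w (Suc s) - w s))))
      \<le> (\<Sum>s<t. - (1 / 2) * ?X s - ?Z s + ?A * ?G s + ?B * ?Q s + ?Y * ?D s)"
  proof (rule sum_mono)
    fix s assume "s \<in> {..<t}"
    then have s: "s < t" by simp
    have "v s \<le> 2 * cb\<^sup>2" using v_le_of_noise[OF t noise cb(1)] s by simp
    from round_bound[OF _ noise[OF s] Sb(1)[OF s] Sb(2) cb(1)[OF s] cb(2) H(1)[OF s] this \<kappa>] s t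
    show "p s * (- (w (Suc s) * g (Suc s)) - \<kappa> * (m s * (w (Suc s) - w s)))
      \<le> - (1 / 2) * ?X s - ?Z s + ?A * ?G s + ?B * ?Q s + ?Y * ?D s" by simp
  qed
  also have "\<dots> = - (1 / 2) * P + (\<Sum>s<t. - ?Z s) + ?A * (\<Sum>s<t. ?G s) + ?B * (\<Sum>s<t. ?Q s) + ?Y * (\<Sum>s<t. ?D s)"
    by (simp only: sum.distrib sum_subtractf sum_distrib_left sum_negf P_def)
  also have "\<dots> \<le> - (1 / 2) * P + (1 / 6 * P + N) + ?A * \<Lambda> + ?B * ((1 - \<beta>1) / (1 - \<beta>1 / \<beta>2) * \<Lambda>)
      + ?Y * (2 * C0 * sqrt (1 - \<beta>2) / (1 - \<beta>1))"
    using mart \<Lambda> sum_q_over_u_le[OF t \<Lambda>] sum_eta_variation_le[of t]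
      C0_pos Sb cb H \<kappa> \<beta>1_less \<beta>2_less \<beta>2_pos \<epsilon>0_pos
    by (intro add_mono mult_left_mono mult_nonneg_nonneg divide_nonneg_nonneg add_nonneg_nonneg order_refl) auto
  also have "?Y * (2 * C0 * sqrt (1 - \<beta>2) / (1 - \<beta>1)) = 2 * \<kappa> * H * C0 / sqrt (1 - \<beta>1)"
  proof -
    have "sqrt (1 - \<beta>1) / (1 - \<beta>1) = 1 / sqrt (1 - \<beta>1)" using \<beta>1_less by (simp add: sqrt_divide_self_eq inverse_eq_divide)
    moreover have "?Y * (2 * C0 * sqrt (1 - \<beta>2) / (1 - \<beta>1)) = 2 * \<kappa> * H * C0 * (sqrt (1 - \<beta>1) / (1 - \<beta>1))"
      using \<beta>2_less by simp
    ultimately show ?thesis by simp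
  qed
  also have "?B * ((1 - \<beta>1) / (1 - \<beta>1 / \<beta>2) * \<Lambda>) \<le> ?B * (1 / (1 - \<beta>1 / \<beta>2) * \<Lambda>)"
  proof -
    have "0 \<le> ?G s" if "s < t" for s
      using u_pos[of "Suc s"] that t \<beta>2_less by simp
    then have "0 \<le> (\<Sum>s<t. ?G s)" by (intro sum_nonneg) simp
    then have "0 \<le> \<Lambda>" using \<Lambda> by linarith
    then show ?thesis
      using C0_pos Sb cb \<kappa> \<beta>1_nonneg \<beta>2_pos \<epsilon>0_pos \<rho>_pos
      by (intro mult_left_mono mult_right_mono divide_right_mono mult_nonneg_nonneg
          divide_nonneg_nonneg add_nonneg_nonneg) auto
  qed
  finally show ?thesis by simp
qed

end

section \<open>Look-ahead points and descent\<close>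

text \<open>
  Descent from \<open>y\<close> with the gradient taken at \<open>x\<close>. The mismatch of the gradients is split evenly
  between \<open>y - x\<close> and the step.
\<close>

lemma L_smooth_lookahead_descent:
  fixes f :: "'a::euclidean_space \<Rightarrow> real"
  assumes smooth: "L_smooth L f" and "L > 0"
  shows "f (y + \<delta>) \<le> f y + inner (nabla f x) \<delta> + L / 2 * (norm (y - x))\<^sup>2 + L * (norm \<delta>)\<^sup>2"
proof -
  have "inner (nabla f y - nabla f x) \<delta> \<le> norm (nabla f y - nabla f x) * norm \<delta>"
    by (rule norm_cauchy_schwarz)
  also have "\<dots> \<le> (L * norm (y - x)) * norm \<delta>"
    using smooth unfolding L_smooth_def by (blast intro: mult_right_mono norm_ge_zero)
  also have "\<dots> \<le> L / 2 * (norm (y - x))\<^sup>2 + L / 2 * (norm \<delta>)\<^sup>2"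
    using mult_nonneg_nonneg[OF less_imp_le[OF \<open>L > 0\<close>] zero_le_power2[of "norm (y - x) - norm \<delta>"]]
    by (simp add: power2_eq_square algebra_simps)
  finally show ?thesis
    using L_smooth_descent[OF smooth, of "y + \<delta>" y] by (simp add: inner_diff_left)
qed

lemma power2_norm_vec: "(norm (a :: real^'n))\<^sup>2 = (\<Sum>i\<in>UNIV. (a $ i)\<^sup>2)"
  unfolding power2_norm_eq_inner inner_vec_def by (simp add: power2_eq_square)

lemma vec_nth_sq_le_norm_sq: "((a :: real^'n) $ i)\<^sup>2 \<le> (norm a)\<^sup>2"
  using power_mono[OF component_le_norm_cart[of a i], of 2] by simp

lemma norm_add_sq_le: "(norm (a + b))\<^sup>2 \<le> 2 * (norm a)\<^sup>2 + 2 * (norm (b :: 'a::real_inner))\<^sup>2"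
  using zero_le_power2[of "norm (a - b)"]
  by (simp add: power2_norm_eq_inner inner_add inner_diff inner_commute)

lemma add_sq_le: "(a + b)\<^sup>2 \<le> 2 * a\<^sup>2 + 2 * (b :: real)\<^sup>2"
  using zero_le_power2[of "a - b"] by (simp add: power2_eq_square algebra_simps)

locale adam_run =
  fixes \<beta>1 \<beta>2 C0 \<epsilon>0 :: real and T :: nat and x1 :: "real^'d" and g x m v :: "nat \<Rightarrow> real^'d"
  assumes params: "0 \<le> \<beta>1" "\<beta>1 < \<beta>2" "\<beta>2 < 1" "C0 > 0" "\<epsilon>0 > 0"
    and path: "adam_path \<beta>1 \<beta>2 (\<epsilon>0 * sqrt (1 - \<beta>2)) (C0 * sqrt (1 - \<beta>2)) T x1 g x m v"

sublocale adam_run \<subseteq> coord: adam_coordinate \<beta>1 \<beta>2 C0 \<epsilon>0 T "\<lambda>s. g s $ i" "\<lambda>s. m s $ i" "\<lambda>s. v s $ i" for i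
proof
  show "m (Suc s) $ i = \<beta>1 * m s $ i + (1 - \<beta>1) * g (Suc s) $ i"
     "v (Suc s) $ i = \<beta>2 * v s $ i + (1 - \<beta>2) * (g (Suc s) $ i)\<^sup>2" if "s < T" for s
    using path that by (auto simp: adam_path_def dest!: bspec[of _ _ "Suc s"])
qed (use params path in \<open>auto simp: adam_path_def\<close>)

context adam_run
begin

lemma x_1: "x (Suc 0) = x1"
  using path by (simp add: adam_path_def)

lemma x_Suc: "s < T \<Longrightarrow> x (Suc (Suc s)) $ i = x (Suc s) $ i - coord.w i (Suc s) * m (Suc s) $ i"
  using path
  by (auto simp: adam_path_def coord.w_def coord.b_def coord.eta_def coord.eps_def dest!: bspec[of _ _ "Suc s"])

lemma x_dist_sq_le:
  assumes "s \<le> T"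
  shows "(norm (x (Suc s) - x1))\<^sup>2 \<le> real CARD('d) * (real s * C0)\<^sup>2"
proof -
  have "\<bar>x (Suc s) $ i - x1 $ i\<bar> \<le> real s * C0" for i
    using assms
  proof (induction s)
    case (Suc s)
    have "\<bar>coord.w i (Suc s) * m (Suc s) $ i\<bar> \<le> C0"
      using coord.step_sq_le[of "Suc s" i] Suc.prems params abs_le_square_iff[of "coord.w i (Suc s) * m (Suc s) $ i" C0]
      by simp
    then show ?case using Suc x_Suc[of s i] by (simp add: algebra_simps)
  qed (simp add: x_1)
  then have "\<bar>x (Suc s) $ i - x1 $ i\<bar>\<^sup>2 \<le> (real s * C0)\<^sup>2" for i
    by (intro power_mono) auto
  then have "(\<Sum>i\<in>UNIV. ((x (Suc s) - x1) $ i)\<^sup>2) \<le> (\<Sum>i\<in>(UNIV::'d set). (real s * C0)\<^sup>2)"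
    by (intro sum_mono) simp
  then show ?thesis by (simp add: power2_norm_vec)
qed

lemma grad_sq_le:
  assumes smooth: "L_smooth L f" and "L > 0" and s: "s \<le> T"
  shows "(norm (nabla f (x (Suc s))))\<^sup>2
    \<le> 2 * (norm (nabla f x1))\<^sup>2 + 2 * L\<^sup>2 * real CARD('d) * C0\<^sup>2 * (real s)\<^sup>2"
proof -
  have "norm (nabla f (x (Suc s)) - nabla f x1) \<le> L * norm (x (Suc s) - x1)"
    using smooth by (simp add: L_smooth_def)
  then have "(norm (nabla f (x (Suc s)) - nabla f x1))\<^sup>2 \<le> L\<^sup>2 * (norm (x (Suc s) - x1))\<^sup>2"
    by (metis norm_ge_zero power_mono power_mult_distrib)
  also have "\<dots> \<le> L\<^sup>2 * (real CARD('d) * (real s * C0)\<^sup>2)"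
    using x_dist_sq_le[OF s] by (intro mult_left_mono) auto
  finally show ?thesis
    using norm_add_sq_le[of "nabla f x1" "nabla f (x (Suc s)) - nabla f x1"]
    by (simp add: power_mult_distrib mult.commute mult.left_commute)
qed

text \<open>
  Each displacement is at most \<open>C0\<close> per coordinate, so the gradients, and by the noise bound also
  the answers, grow at most linearly in the round. Squaring and summing gives the cubic term of
  \<open>F_const\<close>.
\<close>

lemma F_const_bound:
  assumes smooth: "L_smooth L f" and "L > 0"
    and noise: "\<And>s. s < T \<Longrightarrow> (g (Suc s) $ i - nabla f (x (Suc s)) $ i)\<^sup>2
      \<le> (\<sigma>0 $ i)\<^sup>2 + (\<sigma>1 $ i)\<^sup>2 * (nabla f (x (Suc s)) $ i)\<^sup>2"
  shows "1 + (\<Sum>s<T. (g (Suc s) $ i)\<^sup>2) / (\<epsilon>0 * sqrt (1 - \<beta>2))\<^sup>2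
    \<le> F_const f x1 L \<sigma>0 \<sigma>1 \<beta>1 \<beta>2 C0 (\<epsilon>0 * sqrt (1 - \<beta>2)) T"
proof -
  let ?N = "(norm (nabla f x1))\<^sup>2" and ?S0 = "(infnorm \<sigma>0)\<^sup>2" and ?S1 = "(infnorm \<sigma>1)\<^sup>2"
  let ?D = "real CARD('d) * L\<^sup>2 * C0\<^sup>2" and ?\<rho> = "1 - \<beta>1 / \<beta>2"
  have \<rho>: "0 < ?\<rho>" "?\<rho> \<le> 1" using coord.\<rho>_pos coord.\<beta>2_pos params by auto
  have S: "(\<sigma>0 $ i)\<^sup>2 \<le> ?S0" "(\<sigma>1 $ i)\<^sup>2 \<le> ?S1"
    using power_mono[OF component_le_infnorm_cart, of _ _ 2] by force+
  have "(g (Suc s) $ i)\<^sup>2 \<le> 2 * ?S0 + 4 * (1 + ?S1) * ?N + 4 * (1 + ?S1) * ?D * (real T)\<^sup>2" if s: "s < T" for s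
  proof -
    let ?p = "nabla f (x (Suc s)) $ i"
    have "?p\<^sup>2 \<le> 2 * ?N + 2 * ?D * (real s)\<^sup>2"
      using vec_nth_sq_le_norm_sq[of "nabla f (x (Suc s))" i] grad_sq_le[OF smooth \<open>L > 0\<close>, of s] s
      by (simp add: mult.commute mult.left_commute)
    also have "\<dots> \<le> 2 * ?N + 2 * ?D * (real T)\<^sup>2"
      using s by (intro add_mono mult_left_mono power_mono) auto
    finally have p: "?p\<^sup>2 \<le> 2 * ?N + 2 * ?D * (real T)\<^sup>2" .
    have "(g (Suc s) $ i)\<^sup>2 \<le> 2 * ?p\<^sup>2 + 2 * (g (Suc s) $ i - ?p)\<^sup>2"
      using add_sq_le[of ?p "g (Suc s) $ i - ?p"] by simp
    also have "\<dots> \<le> 2 * ?p\<^sup>2 + 2 * (?S0 + ?S1 * ?p\<^sup>2)"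
    proof -
      have "(\<sigma>1 $ i)\<^sup>2 * ?p\<^sup>2 \<le> ?S1 * ?p\<^sup>2" using S by (intro mult_right_mono) auto
      then have "(g (Suc s) $ i - ?p)\<^sup>2 \<le> ?S0 + ?S1 * ?p\<^sup>2"
        by (rule order_trans[OF noise[OF s] add_mono[OF S(1)]])
      then show ?thesis by simp
    qed
    also have "\<dots> = 2 * ?S0 + 2 * (1 + ?S1) * ?p\<^sup>2" by (simp add: algebra_simps)
    also have "\<dots> \<le> 2 * ?S0 + 2 * (1 + ?S1) * (2 * ?N + 2 * ?D * (real T)\<^sup>2)"
      using p by (intro add_left_mono mult_left_mono) auto
    finally show ?thesis by (simp add: algebra_simps)
  qed
  then have "(\<Sum>s<T. (g (Suc s) $ i)\<^sup>2)
      \<le> (\<Sum>s<T. 2 * ?S0 + 4 * (1 + ?S1) * ?N + 4 * (1 + ?S1) * ?D * (real T)\<^sup>2)"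
    by (intro sum_mono) auto
  also have "\<dots> = 2 * ((?S0 + 2 * (1 + ?S1) * ?N) * real T + 2 * (1 + ?S1) * ?D * real T ^ 3)"
    by (simp add: algebra_simps power2_eq_square power3_eq_cube)
  also have "\<dots> \<le> 2 * ((?S0 + 2 * (1 + ?S1) * ?N) * real T + 2 * (1 + ?S1) * ?D / ?\<rho> * real T ^ 3)"
  proof -
    have "2 * (1 + ?S1) * ?D \<le> 2 * (1 + ?S1) * ?D / ?\<rho>"
      using \<rho> mult_left_le[of ?\<rho> "2 * (1 + ?S1) * ?D"] by (simp add: pos_le_divide_eq)
    then show ?thesis by (intro mult_left_mono add_left_mono mult_right_mono) auto
  qed
  finally have "(\<Sum>s<T. (g (Suc s) $ i)\<^sup>2) / (\<epsilon>0 * sqrt (1 - \<beta>2))\<^sup>2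
    \<le> 2 * ((?S0 + 2 * (1 + ?S1) * ?N) * real T + 2 * (1 + ?S1) * ?D / ?\<rho> * real T ^ 3) / (\<epsilon>0 * sqrt (1 - \<beta>2))\<^sup>2"
    by (intro divide_right_mono) auto
  then show ?thesis by (simp add: F_const_def mult.assoc)
qed

text \<open>
  The point \<open>x + \<kappa> * (x - x')\<close> before round \<open>s + 1\<close>, where \<open>x'\<close> is the previous iterate. Writing the
  displacement as \<open>- w s * m s\<close> covers the start as well, where there is no previous iterate and
  \<open>m 0 = 0\<close>.
\<close>

definition lookahead :: "nat \<Rightarrow> real^'d" where
  "lookahead s = (\<chi> i. x (Suc s) $ i - \<beta>1 / (1 - \<beta>1) * (coord.w i s * m s $ i))"

definition lookahead_step :: "nat \<Rightarrow> real^'d" where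
  "lookahead_step s = (\<chi> i. - (coord.w i (Suc s) * g (Suc s) $ i)
     - \<beta>1 / (1 - \<beta>1) * (m s $ i * (coord.w i (Suc s) - coord.w i s)))"

lemma lookahead_0: "lookahead 0 = x1"
  by (simp add: lookahead_def x_1 coord.m_0 vec_eq_iff)

text \<open>
  The coefficient \<open>\<kappa> = \<beta>1 / (1 - \<beta>1)\<close> is chosen so that \<open>(1 + \<kappa>) * m (Suc s) = \<kappa> * m s + g (Suc s)\<close>:
  old momentum enters the increment only through the change of \<open>w\<close>.
\<close>

lemma lookahead_Suc:
  assumes "s < T"
  shows "lookahead (Suc s) = lookahead s + lookahead_step s"
proof -
  have "x (Suc (Suc s)) $ i - \<beta>1 / (1 - \<beta>1) * (coord.w i (Suc s) * m (Suc s) $ i)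
      = x (Suc s) $ i - \<beta>1 / (1 - \<beta>1) * (coord.w i s * m s $ i)
        + (- (coord.w i (Suc s) * g (Suc s) $ i)
           - \<beta>1 / (1 - \<beta>1) * (m s $ i * (coord.w i (Suc s) - coord.w i s)))" for i
  proof -
    define k where "k = \<beta>1 / (1 - \<beta>1)"
    have "(1 + k) * (1 - \<beta>1) = 1" "(1 + k) * \<beta>1 = k"
      using coord.\<beta>1_less by (simp_all add: k_def field_simps)
    moreover have "(1 + k) * m (Suc s) $ i = ((1 + k) * \<beta>1) * m s $ i + ((1 + k) * (1 - \<beta>1)) * g (Suc s) $ i"
      unfolding coord.m_Suc[OF assms] by (simp add: algebra_simps)
    ultimately have "(1 + k) * m (Suc s) $ i = k * m s $ i + g (Suc s) $ i" by simp
    then have "coord.w i (Suc s) * ((1 + k) * m (Suc s) $ i) = coord.w i (Suc s) * (k * m s $ i + g (Suc s) $ i)"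
      by simp
    then show ?thesis unfolding x_Suc[OF assms] k_def[symmetric] by (simp add: algebra_simps)
  qed
  then show ?thesis by (simp add: lookahead_def lookahead_step_def vec_eq_iff)
qed

lemma norm_lookahead_diff:
  "(norm (lookahead s - x (Suc s)))\<^sup>2 = (\<Sum>i\<in>UNIV. (\<beta>1 / (1 - \<beta>1))\<^sup>2 * (coord.w i s * m s $ i)\<^sup>2)"
  by (simp add: power2_norm_vec lookahead_def power_mult_distrib power_divide)

lemma f_lookahead_le:
  assumes smooth: "L_smooth L f" and "L > 0" and t: "t \<le> T"
  defines "\<kappa> \<equiv> \<beta>1 / (1 - \<beta>1)"
  shows "f (lookahead t) \<le> f x1
    + (\<Sum>i\<in>UNIV. (\<Sum>s<t. nabla f (x (Suc s)) $ i
          * (- (coord.w i (Suc s) * g (Suc s) $ i) - \<kappa> * (m s $ i * (coord.w i (Suc s) - coord.w i s))))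
        + L / 2 * \<kappa>\<^sup>2 * (1 + 4 * (Sigma_max \<beta>2)\<^sup>2) * (\<Sum>s<t. (coord.w i s * m s $ i)\<^sup>2)
        + 2 * L * (\<Sum>s<t. (coord.w i (Suc s) * g (Suc s) $ i)\<^sup>2))"
  using t
proof (induction t)
  case 0
  show ?case by (simp add: lookahead_0)
next
  case (Suc t)
  then have t: "t < T" by simp
  let ?q = "\<lambda>i. coord.w i (Suc t) * g (Suc t) $ i" and ?D = "\<lambda>i. coord.w i t * m t $ i"
  let ?\<delta> = "\<lambda>i. - ?q i - \<kappa> * (m t $ i * (coord.w i (Suc t) - coord.w i t))"
  have "(?\<delta> i)\<^sup>2 \<le> 2 * (?q i)\<^sup>2 + 2 * \<kappa>\<^sup>2 * (Sigma_max \<beta>2)\<^sup>2 * (?D i)\<^sup>2" for i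
  proof -
    have "(?\<delta> i)\<^sup>2 \<le> 2 * (?q i)\<^sup>2 + 2 * (\<kappa>\<^sup>2 * (m t $ i * (coord.w i (Suc t) - coord.w i t))\<^sup>2)"
      using add_sq_le[of "- ?q i" "- \<kappa> * (m t $ i * (coord.w i (Suc t) - coord.w i t))"]
      by (simp add: power_mult_distrib)
    also have "\<dots> \<le> 2 * (?q i)\<^sup>2 + 2 * (\<kappa>\<^sup>2 * ((Sigma_max \<beta>2)\<^sup>2 * (?D i)\<^sup>2))"
      using coord.w_variation_le[OF t, of i] by (intro add_left_mono mult_left_mono) auto
    finally show ?thesis by (simp add: mult.assoc)
  qed
  then have N: "(norm (lookahead_step t))\<^sup>2 \<le> (\<Sum>i\<in>UNIV. 2 * (?q i)\<^sup>2 + 2 * \<kappa>\<^sup>2 * (Sigma_max \<beta>2)\<^sup>2 * (?D i)\<^sup>2)"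
    unfolding power2_norm_vec lookahead_step_def \<kappa>_def by (intro sum_mono) simp
  have "f (lookahead (Suc t)) \<le> f (lookahead t) + inner (nabla f (x (Suc t))) (lookahead_step t)
      + L / 2 * (norm (lookahead t - x (Suc t)))\<^sup>2 + L * (norm (lookahead_step t))\<^sup>2"
    unfolding lookahead_Suc[OF t] by (rule L_smooth_lookahead_descent[OF smooth \<open>L > 0\<close>])
  also have "\<dots> \<le> f (lookahead t) + (\<Sum>i\<in>UNIV. nabla f (x (Suc t)) $ i * ?\<delta> i)
      + L / 2 * (\<Sum>i\<in>UNIV. \<kappa>\<^sup>2 * (?D i)\<^sup>2)
      + L * (\<Sum>i\<in>UNIV. 2 * (?q i)\<^sup>2 + 2 * \<kappa>\<^sup>2 * (Sigma_max \<beta>2)\<^sup>2 * (?D i)\<^sup>2)"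
  proof -
    have "inner (nabla f (x (Suc t))) (lookahead_step t) = (\<Sum>i\<in>UNIV. nabla f (x (Suc t)) $ i * ?\<delta> i)"
      by (simp add: inner_vec_def lookahead_step_def \<kappa>_def)
    then show ?thesis using mult_left_mono[OF N, of L] \<open>L > 0\<close> norm_lookahead_diff[of t]
      by (simp add: \<kappa>_def)
  qed
  also have "\<dots> = f (lookahead t) + (\<Sum>i\<in>UNIV. nabla f (x (Suc t)) $ i * ?\<delta> i
      + L / 2 * \<kappa>\<^sup>2 * (1 + 4 * (Sigma_max \<beta>2)\<^sup>2) * (?D i)\<^sup>2 + 2 * L * (?q i)\<^sup>2)"
  proof -
    have "L / 2 * (\<kappa>\<^sup>2 * (?D i)\<^sup>2) + L * (2 * (?q i)\<^sup>2 + 2 * \<kappa>\<^sup>2 * (Sigma_max \<beta>2)\<^sup>2 * (?D i)\<^sup>2)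
        = L / 2 * \<kappa>\<^sup>2 * (1 + 4 * (Sigma_max \<beta>2)\<^sup>2) * (?D i)\<^sup>2 + 2 * L * (?q i)\<^sup>2" for i
      by (simp add: algebra_simps)
    then show ?thesis by (simp only: sum_distrib_left sum.distrib[symmetric] add.assoc)
  qed
  also have "\<dots> \<le> (f x1 + (\<Sum>i\<in>UNIV. (\<Sum>s<t. nabla f (x (Suc s)) $ i
          * (- (coord.w i (Suc s) * g (Suc s) $ i) - \<kappa> * (m s $ i * (coord.w i (Suc s) - coord.w i s))))
        + L / 2 * \<kappa>\<^sup>2 * (1 + 4 * (Sigma_max \<beta>2)\<^sup>2) * (\<Sum>s<t. (coord.w i s * m s $ i)\<^sup>2)
        + 2 * L * (\<Sum>s<t. (coord.w i (Suc s) * g (Suc s) $ i)\<^sup>2)))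
      + (\<Sum>i\<in>UNIV. nabla f (x (Suc t)) $ i * ?\<delta> i
      + L / 2 * \<kappa>\<^sup>2 * (1 + 4 * (Sigma_max \<beta>2)\<^sup>2) * (?D i)\<^sup>2 + 2 * L * (?q i)\<^sup>2)"
    using Suc by (intro add_right_mono) simp
  also have "\<dots> = f x1 + (\<Sum>i\<in>UNIV. (\<Sum>s<Suc t. nabla f (x (Suc s)) $ i
          * (- (coord.w i (Suc s) * g (Suc s) $ i) - \<kappa> * (m s $ i * (coord.w i (Suc s) - coord.w i s))))
        + L / 2 * \<kappa>\<^sup>2 * (1 + 4 * (Sigma_max \<beta>2)\<^sup>2) * (\<Sum>s<Suc t. (coord.w i s * m s $ i)\<^sup>2)
        + 2 * L * (\<Sum>s<Suc t. (coord.w i (Suc s) * g (Suc s) $ i)\<^sup>2))"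
    by (simp only: sum.lessThan_Suc sum.distrib distrib_left add.assoc add.left_commute add.commute)
  finally show ?case .
qed

lemma grad_next_sq_le:
  assumes smooth: "L_smooth L f" and L: "L > 0" and lower: "\<And>y. fstar \<le> f y" and t: "t \<le> T"
  shows "(norm (nabla f (x (Suc t))))\<^sup>2 \<le> 4 * L * (f (lookahead t) - fstar)
    + 2 * L\<^sup>2 * (\<beta>1 / (1 - \<beta>1))\<^sup>2 * real CARD('d) * C0\<^sup>2"
proof -
  let ?y = "lookahead t" and ?x = "x (Suc t)"
  have "(norm (?y - ?x))\<^sup>2 \<le> (\<Sum>i\<in>(UNIV::'d set). (\<beta>1 / (1 - \<beta>1))\<^sup>2 * C0\<^sup>2)"
    unfolding norm_lookahead_diff using coord.step_sq_le[OF t] by (intro sum_mono mult_left_mono) auto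
  then have D: "(norm (?y - ?x))\<^sup>2 \<le> real CARD('d) * ((\<beta>1 / (1 - \<beta>1))\<^sup>2 * C0\<^sup>2)" by simp
  have "norm (nabla f ?x - nabla f ?y) \<le> L * norm (?y - ?x)"
    using smooth by (simp add: L_smooth_def norm_minus_commute)
  then have "(norm (nabla f ?x - nabla f ?y))\<^sup>2 \<le> L\<^sup>2 * (norm (?y - ?x))\<^sup>2"
    by (metis norm_ge_zero power_mono power_mult_distrib)
  also have "\<dots> \<le> L\<^sup>2 * (real CARD('d) * ((\<beta>1 / (1 - \<beta>1))\<^sup>2 * C0\<^sup>2))"
    using D by (intro mult_left_mono) auto
  finally have "(norm (nabla f ?x - nabla f ?y))\<^sup>2 \<le> L\<^sup>2 * (\<beta>1 / (1 - \<beta>1))\<^sup>2 * real CARD('d) * C0\<^sup>2"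
    by (simp add: ac_simps)
  then show ?thesis
    using norm_add_sq_le[of "nabla f ?y" "nabla f ?x - nabla f ?y"]
      L_smooth_grad_sq_le[OF smooth L lower, of ?y] by simp
qed

end

section \<open>Closing the self-bounding estimate\<close>

lemma sum4_sq_le: "(a + b + c + d)\<^sup>2 \<le> 4 * (a\<^sup>2 + b\<^sup>2 + c\<^sup>2 + (d::real)\<^sup>2)"
  using add_sq_le[of "a + b" "c + d"] add_sq_le[of a b] add_sq_le[of c d] by (simp add: add.assoc)

lemma self_bounding:
  fixes B H Y G :: real
  assumes "2 * B + Y\<^sup>2 \<le> G" "H\<^sup>2 = G"
  shows "B + H * Y \<le> G"
  using zero_le_power2[of "H - Y"] assms by (simp add: power2_eq_square algebra_simps)

text \<open>
  The left-hand side is affine in \<open>H\<close>. Twice its constant part is covered by the terms of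
  \<open>G\<close> without \<open>d\<^sup>2\<close>; its slope is a sum of four terms, and four times the sum of their squares is
  covered by the terms of \<open>G\<close> with \<open>d\<^sup>2\<close>. The letters stand
  for \<open>i = 1 / (1 - \<beta>1)\<close>, \<open>\<rho> = 1 / (1 - \<beta>1 / \<beta>2)\<close>, \<open>e = 1 / \<beta>2\<close>, \<open>e' = 1 / sqrt \<beta>2\<close>,
  \<open>j = 1 / sqrt (1 - \<beta>1)\<close> and \<open>q = sqrt (1 + S1\<^sup>2)\<close>.
\<close>

lemma budget_absorbs:
  fixes L C0 \<kappa> d i \<rho> e e' j S0 S1 q l \<Lambda> \<Sigma> \<Delta> \<epsilon>0 H G :: real
  assumes nonneg: "0 \<le> L" "0 \<le> C0" "0 \<le> \<kappa>" "0 \<le> d" "0 \<le> i" "0 \<le> S0" "0 \<le> S1" "0 \<le> l" "0 \<le> \<Lambda>" "0 \<le> \<epsilon>0" "0 \<le> H"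
    and \<rho>: "1 \<le> \<rho>" and j: "j\<^sup>2 = i" and e: "0 \<le> e'" "e' \<le> e" and q: "0 \<le> q" "S1 \<le> q" "q\<^sup>2 = 1 + S1\<^sup>2"
    and G: "G = 8 * L * \<Delta> + 256 * L\<^sup>2 * C0\<^sup>2 * \<kappa>\<^sup>2 * d\<^sup>2 * i * \<rho> + 4 * L\<^sup>2 * C0\<^sup>2 * \<kappa>\<^sup>2 * d * \<rho>
      + 48 * L * C0 * S0 * i * d * l
      + 8 * L * C0 * \<kappa>\<^sup>2 * \<rho> * (4 * S0 * e + (\<epsilon>0 + sqrt 2 * S0) * e' + L * C0 / 2 * (1 + 4 * \<Sigma>\<^sup>2)) * d * \<Lambda>
      + 8 * (3 * L\<^sup>2 * C0\<^sup>2 * i\<^sup>2 + 8 * L * S0 * C0 * i) * d * \<Lambda>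
      + 2304 * L\<^sup>2 * C0\<^sup>2 * S1\<^sup>2 * i\<^sup>2 * d\<^sup>2 * l\<^sup>2
      + 256 * (16 * L\<^sup>2 * C0\<^sup>2 * S1\<^sup>2 * i\<^sup>2 + 9 * L\<^sup>2 * C0\<^sup>2 * \<kappa> ^ 4 * (1 + S1\<^sup>2) * e\<^sup>2 * \<rho>\<^sup>2) * d\<^sup>2 * \<Lambda>\<^sup>2"
    and H: "H\<^sup>2 = G"
  shows "4 * L * (\<Delta> + d * (6 * C0 * (S0 + S1 * H) * i * l + 4 * C0 * (S0 + S1 * H) * i * \<Lambda>
      + \<kappa>\<^sup>2 * C0 * \<rho> * (4 * (S0 + S1 * H) * e + (\<epsilon>0 + sqrt 2 * (S0 + q * H)) * e') * \<Lambda>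
      + 2 * \<kappa> * H * C0 * j + L / 2 * \<kappa>\<^sup>2 * (1 + 4 * \<Sigma>\<^sup>2) * (C0\<^sup>2 * \<rho> * \<Lambda>) + 2 * L * (C0\<^sup>2 * i\<^sup>2 * \<Lambda>)))
    + 2 * L\<^sup>2 * \<kappa>\<^sup>2 * d * C0\<^sup>2 \<le> G"
proof -
  define Y1 where "Y1 = 8 * L * d * \<kappa> * C0 * j"
  define Y2 where "Y2 = 24 * L * d * C0 * S1 * i * l"
  define Y3 where "Y3 = 16 * L * d * C0 * S1 * i * \<Lambda>"
  define Y4 where "Y4 = 4 * L * d * \<kappa>\<^sup>2 * C0 * \<rho> * (4 * S1 * e + sqrt 2 * q * e') * \<Lambda>"
  define Z4 where "Z4 = 24 * L * d * \<kappa>\<^sup>2 * C0 * \<rho> * q * e * \<Lambda>"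
  define B where "B = 4 * L * (\<Delta> + d * (6 * C0 * S0 * i * l + 4 * C0 * S0 * i * \<Lambda>
      + \<kappa>\<^sup>2 * C0 * \<rho> * (4 * S0 * e + (\<epsilon>0 + sqrt 2 * S0) * e') * \<Lambda>
      + L / 2 * \<kappa>\<^sup>2 * (1 + 4 * \<Sigma>\<^sup>2) * (C0\<^sup>2 * \<rho> * \<Lambda>) + 2 * L * (C0\<^sup>2 * i\<^sup>2 * \<Lambda>))) + 2 * L\<^sup>2 * \<kappa>\<^sup>2 * d * C0\<^sup>2"
  have split: "4 * L * (\<Delta> + d * (6 * C0 * (S0 + S1 * H) * i * l + 4 * C0 * (S0 + S1 * H) * i * \<Lambda>
      + \<kappa>\<^sup>2 * C0 * \<rho> * (4 * (S0 + S1 * H) * e + (\<epsilon>0 + sqrt 2 * (S0 + q * H)) * e') * \<Lambda>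
      + 2 * \<kappa> * H * C0 * j + L / 2 * \<kappa>\<^sup>2 * (1 + 4 * \<Sigma>\<^sup>2) * (C0\<^sup>2 * \<rho> * \<Lambda>) + 2 * L * (C0\<^sup>2 * i\<^sup>2 * \<Lambda>)))
    + 2 * L\<^sup>2 * \<kappa>\<^sup>2 * d * C0\<^sup>2 = B + H * (Y1 + Y2 + Y3 + Y4)"
    by (simp add: B_def Y1_def Y2_def Y3_def Y4_def algebra_simps)
  have s2: "sqrt 2 \<le> (2::real)" by (rule real_le_lsqrt) auto
  have e0: "0 \<le> e" using e by linarith
  have "4 * S1 * e + sqrt 2 * q * e' \<le> 4 * q * e + 2 * q * e"
    using q e e0 s2 nonneg by (intro add_mono mult_mono) auto
  then have "4 * L * d * \<kappa>\<^sup>2 * C0 * \<rho> * (4 * S1 * e + sqrt 2 * q * e') * \<Lambda>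
      \<le> 4 * L * d * \<kappa>\<^sup>2 * C0 * \<rho> * (4 * q * e + 2 * q * e) * \<Lambda>"
    using nonneg \<rho> by (intro mult_right_mono mult_left_mono) auto
  then have Y4: "Y4 \<le> Z4" by (simp add: Y4_def Z4_def algebra_simps)
  let ?a = "L\<^sup>2 * C0\<^sup>2 * \<kappa>\<^sup>2 * d\<^sup>2 * i" and ?b = "L\<^sup>2 * C0\<^sup>2 * S1\<^sup>2 * i\<^sup>2 * d\<^sup>2 * l\<^sup>2"
  let ?c = "L\<^sup>2 * C0\<^sup>2 * S1\<^sup>2 * i\<^sup>2 * d\<^sup>2 * \<Lambda>\<^sup>2"
  let ?z = "L\<^sup>2 * C0\<^sup>2 * \<kappa> ^ 4 * (1 + S1\<^sup>2) * e\<^sup>2 * \<rho>\<^sup>2 * d\<^sup>2 * \<Lambda>\<^sup>2"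
  have sq: "Y1\<^sup>2 = 64 * ?a" "Y2\<^sup>2 = 576 * ?b" "Y3\<^sup>2 = 256 * ?c" "Z4\<^sup>2 = 576 * ?z"
    unfolding Y1_def Y2_def Y3_def Z4_def power_mult_distrib j q(3) by simp_all
  have r1: "?a \<le> ?a * \<rho>"
    using nonneg \<rho> mult_left_mono[of 1 \<rho> ?a] by simp
  have r2: "4 * L\<^sup>2 * C0\<^sup>2 * \<kappa>\<^sup>2 * d \<le> 4 * L\<^sup>2 * C0\<^sup>2 * \<kappa>\<^sup>2 * d * \<rho>"
    using nonneg \<rho> mult_left_mono[of 1 \<rho> "4 * L\<^sup>2 * C0\<^sup>2 * \<kappa>\<^sup>2 * d"] by simp
  have n: "0 \<le> L\<^sup>2 * C0\<^sup>2 * i\<^sup>2 * d * \<Lambda>" "0 \<le> L * S0 * C0 * i * d * \<Lambda>" "0 \<le> L\<^sup>2 * C0\<^sup>2 * S1\<^sup>2 * i\<^sup>2 * d\<^sup>2 * \<Lambda>\<^sup>2"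
    using nonneg by simp_all
  \<comment> \<open>The terms of \<open>G\<close> that twice the constant part has to fit into.\<close>
  have B2: "2 * B \<le> 8 * L * \<Delta> + 4 * L\<^sup>2 * C0\<^sup>2 * \<kappa>\<^sup>2 * d * \<rho>
      + 48 * L * C0 * S0 * i * d * l
      + 8 * L * C0 * \<kappa>\<^sup>2 * \<rho> * (4 * S0 * e + (\<epsilon>0 + sqrt 2 * S0) * e' + L * C0 / 2 * (1 + 4 * \<Sigma>\<^sup>2)) * d * \<Lambda>
      + 8 * (3 * L\<^sup>2 * C0\<^sup>2 * i\<^sup>2 + 8 * L * S0 * C0 * i) * d * \<Lambda>"
    using r2 n by (simp add: B_def algebra_simps power2_eq_square)
  have Y: "(Y1 + Y2 + Y3 + Z4)\<^sup>2 \<le> 256 * L\<^sup>2 * C0\<^sup>2 * \<kappa>\<^sup>2 * d\<^sup>2 * i * \<rho>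
      + 2304 * L\<^sup>2 * C0\<^sup>2 * S1\<^sup>2 * i\<^sup>2 * d\<^sup>2 * l\<^sup>2
      + 256 * (16 * L\<^sup>2 * C0\<^sup>2 * S1\<^sup>2 * i\<^sup>2 + 9 * L\<^sup>2 * C0\<^sup>2 * \<kappa> ^ 4 * (1 + S1\<^sup>2) * e\<^sup>2 * \<rho>\<^sup>2) * d\<^sup>2 * \<Lambda>\<^sup>2"
  proof -
    have "4 * (Y1\<^sup>2 + Y2\<^sup>2 + Y3\<^sup>2 + Z4\<^sup>2) \<le> 256 * (?a * \<rho>) + 2304 * ?b + (4096 * ?c + 2304 * ?z)"
    proof -
      have "4 * (64 * a + 576 * b + 256 * c + 576 * z) \<le> 256 * a' + 2304 * b + (4096 * c + 2304 * z)"
        if "a \<le> a'" "0 \<le> c" for a a' b c z :: real using that by simp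
      then show ?thesis unfolding sq using r1 n(3) by blast
    qed
    also have "\<dots> = 256 * L\<^sup>2 * C0\<^sup>2 * \<kappa>\<^sup>2 * d\<^sup>2 * i * \<rho>
      + 2304 * L\<^sup>2 * C0\<^sup>2 * S1\<^sup>2 * i\<^sup>2 * d\<^sup>2 * l\<^sup>2
      + 256 * (16 * L\<^sup>2 * C0\<^sup>2 * S1\<^sup>2 * i\<^sup>2 + 9 * L\<^sup>2 * C0\<^sup>2 * \<kappa> ^ 4 * (1 + S1\<^sup>2) * e\<^sup>2 * \<rho>\<^sup>2) * d\<^sup>2 * \<Lambda>\<^sup>2"
      by (simp add: algebra_simps)
    finally show ?thesis using sum4_sq_le[of Y1 Y2 Y3 Z4] by linarith
  qed
  \<comment> \<open>The slope is enlarged to \<open>Z4\<close>, where \<open>4 + sqrt 2 \<le> 6\<close> meets the constant \<open>9 * 256 = 4 * 24\<^sup>2\<close>.\<close>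
  have "B + H * (Y1 + Y2 + Y3 + Z4) \<le> G"
    by (rule self_bounding[OF _ H]) (use B2 Y G in linarith)
  moreover have "H * (Y1 + Y2 + Y3 + Y4) \<le> H * (Y1 + Y2 + Y3 + Z4)"
    using Y4 nonneg by (intro mult_left_mono) auto
  ultimately show ?thesis unfolding split by linarith
qed

text \<open>
  The factor of the noise in the first-order term, scaled by \<open>\<theta>\<close> and cut off where the gradient
  coordinate exceeds \<open>H\<close>. It is stated without reference to a run, as an explicit function of the
  state, so that its measurability can be read off.
\<close>

definition noise_weight :: "real \<Rightarrow> real \<Rightarrow> real \<Rightarrow> real \<Rightarrow> real \<Rightarrow> real \<Rightarrow> nat \<Rightarrow> real \<Rightarrow> real \<Rightarrow> real \<Rightarrow> real" where
  "noise_weight \<beta>1 \<beta>2 C0 \<epsilon>0 \<theta> H s vs p S2 =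
    (if \<bar>p\<bar> \<le> H then - \<theta> * (adam_eta \<beta>1 \<beta>2 (C0 * sqrt (1 - \<beta>2)) (Suc s) * p
        / (sqrt (\<beta>2 * vs + (1 - \<beta>2) * (p\<^sup>2 + S2)) + adam_eps \<beta>2 (\<epsilon>0 * sqrt (1 - \<beta>2)) (Suc s)))
     else 0)"

lemma (in adam_coordinate) noise_weight_eq:
  "noise_weight \<beta>1 \<beta>2 C0 \<epsilon>0 \<theta> H s (v s) p S2 =
    (if \<bar>p\<bar> \<le> H then - \<theta> * (eta (Suc s) * p / proxy s (p\<^sup>2 + S2)) else 0)"
  by (simp add: noise_weight_def eta_def proxy_def eps_def)

lemma (in adam_coordinate) abs_noise_weight_le:
  assumes "s < T" "0 \<le> S2"
  shows "\<bar>noise_weight \<beta>1 \<beta>2 C0 \<epsilon>0 \<theta> H s (v s) p S2\<bar>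
    \<le> \<bar>\<theta>\<bar> * (C0 * sqrt (1 - \<beta>2) / (1 - \<beta>1) * \<bar>H\<bar> / (\<epsilon>0 * (1 - \<beta>2)))"
proof (cases "\<bar>p\<bar> \<le> H")
  case True
  let ?a = "proxy s (p\<^sup>2 + S2)"
  have "0 \<le> sqrt (1 - \<beta>2) * sqrt (p\<^sup>2 + S2)" using \<beta>2_less assms by simp
  then have a: "\<epsilon>0 * (1 - \<beta>2) \<le> ?a" "0 < ?a" using proxy_ge[OF assms(1), of "p\<^sup>2 + S2"] assms by auto
  have k: "0 < \<epsilon>0 * (1 - \<beta>2)" using \<epsilon>0_pos \<beta>2_less by simp
  have "eta (Suc s) * \<bar>p\<bar> / ?a \<le> (C0 * sqrt (1 - \<beta>2) / (1 - \<beta>1)) * \<bar>H\<bar> / (\<epsilon>0 * (1 - \<beta>2))"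
    using a k True eta_le'[of "Suc s"] eta_nonneg[of "Suc s"] assms C0_pos \<beta>1_less \<beta>2_less
    by (intro frac_le mult_mono mult_nonneg_nonneg) auto
  then have "\<bar>\<theta>\<bar> * (eta (Suc s) * \<bar>p\<bar> / ?a) \<le> \<bar>\<theta>\<bar> * ((C0 * sqrt (1 - \<beta>2) / (1 - \<beta>1)) * \<bar>H\<bar> / (\<epsilon>0 * (1 - \<beta>2)))"
    by (intro mult_left_mono) auto
  then show ?thesis
    using True a eta_nonneg[of "Suc s"] by (simp add: noise_weight_eq abs_mult)
qed (use \<epsilon>0_pos C0_pos \<beta>1_less \<beta>2_less in \<open>simp add: noise_weight_eq\<close>)

text \<open>
  The quadratic compensator is \<open>\<theta>\<^sup>2\<close> times \<open>(eta * p\<^sup>2 / a) * (eta * S2 / a)\<close>, and the second factor is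
  at most \<open>C0 * Sb / (1 - \<beta>1)\<close>. The choice of \<open>\<theta>\<close> makes this, after division by \<open>\<theta>\<close>, a sixth of
  the descent.
\<close>

lemma (in adam_coordinate) martingale_part_le:
  assumes t: "t \<le> T" and S2: "\<And>s. s < t \<Longrightarrow> 0 \<le> S2 s" "\<And>s. s < t \<Longrightarrow> S2 s \<le> Sb\<^sup>2" and Sb: "0 < Sb"
    and H: "\<And>s. s < t \<Longrightarrow> \<bar>p s\<bar> \<le> H"
  defines "\<theta> \<equiv> (1 - \<beta>1) / (6 * C0 * Sb)"
  defines "h s \<equiv> noise_weight \<beta>1 \<beta>2 C0 \<epsilon>0 \<theta> H s (v s) (p s) (S2 s)"
  assumes mart: "(\<Sum>s<t. h s * (g (Suc s) - p s) - (\<bar>h s\<bar> * sqrt (S2 s))\<^sup>2) \<le> l"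
  shows "(\<Sum>s<t. - (eta (Suc s) * p s * (g (Suc s) - p s) / proxy s ((p s)\<^sup>2 + S2 s)))
    \<le> 1 / 6 * (\<Sum>s<t. eta (Suc s) * (p s)\<^sup>2 / proxy s ((p s)\<^sup>2 + S2 s)) + 6 * C0 * Sb / (1 - \<beta>1) * l"
proof -
  let ?a = "\<lambda>s. proxy s ((p s)\<^sup>2 + S2 s)"
  let ?X = "\<lambda>s. eta (Suc s) * (p s)\<^sup>2 / ?a s"
  let ?Z = "\<lambda>s. - (eta (Suc s) * p s * (g (Suc s) - p s) / ?a s)"
  have \<theta>: "0 < \<theta>" using \<beta>1_less C0_pos Sb by (simp add: \<theta>_def)
  have step: "\<theta> * ?Z s \<le> \<theta> * (1 / 6 * ?X s) + (h s * (g (Suc s) - p s) - (\<bar>h s\<bar> * sqrt (S2 s))\<^sup>2)"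
    if s: "s < t" for s
  proof -
    have sT: "s < T" using s t by simp
    have h: "h s = - \<theta> * (eta (Suc s) * p s / ?a s)" using H[OF s] by (simp add: h_def noise_weight_eq)
    have a: "0 < ?a s" "sqrt (1 - \<beta>2) * sqrt ((p s)\<^sup>2 + S2 s) + \<epsilon>0 * (1 - \<beta>2) \<le> ?a s"
      using proxy_ge[OF sT, of "(p s)\<^sup>2 + S2 s"] S2(1)[OF s] by auto
    have "sqrt (1 - \<beta>2) * sqrt (S2 s) \<le> sqrt (1 - \<beta>2) * sqrt ((p s)\<^sup>2 + S2 s)"
      using \<beta>2_less by (intro mult_left_mono) auto
    then have aS: "sqrt (1 - \<beta>2) * sqrt (S2 s) \<le> ?a s"
      using a \<epsilon>0_pos \<beta>2_less by (smt (verit) mult_pos_pos)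
    have "eta (Suc s) * S2 s \<le> C0 * sqrt (1 - \<beta>2) / (1 - \<beta>1) * S2 s"
      using eta_le'[of "Suc s"] S2(1)[OF s] by (intro mult_right_mono) auto
    also have "\<dots> = C0 / (1 - \<beta>1) * ((sqrt (1 - \<beta>2) * sqrt (S2 s)) * sqrt (S2 s))"
      using S2(1)[OF s] by simp
    also have "\<dots> \<le> C0 / (1 - \<beta>1) * (?a s * Sb)"
      using aS a S2[OF s] Sb C0_pos \<beta>1_less
      by (intro mult_left_mono mult_mono real_le_lsqrt) auto
    finally have "eta (Suc s) * S2 s / ?a s \<le> C0 / (1 - \<beta>1) * Sb"
      using a by (simp add: pos_divide_le_eq ac_simps)
    then have "\<theta> * (eta (Suc s) * S2 s / ?a s) \<le> \<theta> * (C0 / (1 - \<beta>1) * Sb)"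
      using \<theta> by (intro mult_left_mono) auto
    also have "\<dots> = 1 / 6" using \<beta>1_less C0_pos Sb by (simp add: \<theta>_def)
    finally have "\<theta> * (eta (Suc s) * S2 s / ?a s) * (\<theta> * ?X s) \<le> 1 / 6 * (\<theta> * ?X s)"
      using \<theta> a eta_nonneg[of "Suc s"] by (intro mult_right_mono) auto
    moreover have "(\<bar>h s\<bar> * sqrt (S2 s))\<^sup>2 = \<theta> * (eta (Suc s) * S2 s / ?a s) * (\<theta> * ?X s)"
    proof -
      have "(\<bar>h s\<bar> * sqrt (S2 s))\<^sup>2 = (h s)\<^sup>2 * S2 s"
        using S2(1)[OF s] by (simp add: power_mult_distrib)
      also have "\<dots> = \<theta> * (eta (Suc s) * S2 s / ?a s) * (\<theta> * ?X s)"
        by (simp add: h power2_eq_square)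
      finally show ?thesis .
    qed
    moreover have "h s * (g (Suc s) - p s) = \<theta> * ?Z s" by (simp add: h)
    ultimately show ?thesis by simp
  qed
  have "\<theta> * (\<Sum>s<t. ?Z s) = (\<Sum>s<t. \<theta> * ?Z s)" by (rule sum_distrib_left)
  also have "\<dots> \<le> (\<Sum>s<t. \<theta> * (1 / 6 * ?X s) + (h s * (g (Suc s) - p s) - (\<bar>h s\<bar> * sqrt (S2 s))\<^sup>2))"
    using step by (intro sum_mono) auto
  also have "\<dots> \<le> \<theta> * (1 / 6 * (\<Sum>s<t. ?X s)) + l"
    using mart by (simp only: sum.distrib sum_distrib_left[symmetric])
  also have "\<dots> = \<theta> * (1 / 6 * (\<Sum>s<t. ?X s) + 6 * C0 * Sb / (1 - \<beta>1) * l)"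
    using \<beta>1_less C0_pos Sb by (simp add: \<theta>_def distrib_left)
  finally show ?thesis using \<theta> by (simp only: mult_le_cancel_left_pos)
qed


lemma G_const_self_bounding:
  fixes f :: "real^'d \<Rightarrow> real" and x1 \<sigma>0 \<sigma>1 :: "real^'d"
    and fstar L \<beta>1 \<beta>2 C0 \<epsilon>0 \<delta> :: real and T :: nat
  defines "d \<equiv> real CARD('d)" and "S0 \<equiv> infnorm \<sigma>0" and "S1 \<equiv> infnorm \<sigma>1"
  defines "G \<equiv> G_const f fstar x1 L \<sigma>0 \<sigma>1 \<beta>1 \<beta>2 C0 \<epsilon>0 T \<delta>"
  defines "H \<equiv> sqrt G" and "\<kappa> \<equiv> \<beta>1 / (1 - \<beta>1)" and "l \<equiv> ln (d * real T / \<delta>)"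
    and "\<Lambda> \<equiv> ln (F_const f x1 L \<sigma>0 \<sigma>1 \<beta>1 \<beta>2 C0 (\<epsilon>0 * sqrt (1 - \<beta>2)) T / \<beta>2 ^ T)"
  assumes params: "0 \<le> \<beta>1" "\<beta>1 < \<beta>2" "\<beta>2 < 1" "C0 > 0" "\<epsilon>0 > 0" "L > 0"
    and lower: "fstar \<le> f x1" and l: "0 \<le> l" and \<Lambda>: "0 \<le> \<Lambda>"
  shows "8 * L * (f x1 - fstar) \<le> G"
    and "4 * L * (f x1 - fstar + d * (6 * C0 * (S0 + S1 * H) / (1 - \<beta>1) * l
        + 4 * C0 * (S0 + S1 * H) / (1 - \<beta>1) * \<Lambda>
        + \<kappa>\<^sup>2 * C0 / (1 - \<beta>1 / \<beta>2)
          * (4 * (S0 + S1 * H) / \<beta>2 + (\<epsilon>0 + sqrt 2 * (S0 + sqrt (1 + S1\<^sup>2) * H)) / sqrt \<beta>2) * \<Lambda>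
        + 2 * \<kappa> * H * C0 / sqrt (1 - \<beta>1)
        + L / 2 * \<kappa>\<^sup>2 * (1 + 4 * (Sigma_max \<beta>2)\<^sup>2) * (C0\<^sup>2 / (1 - \<beta>1 / \<beta>2) * \<Lambda>)
        + 2 * L * (C0\<^sup>2 / (1 - \<beta>1)\<^sup>2 * \<Lambda>)))
      + 2 * L\<^sup>2 * \<kappa>\<^sup>2 * d * C0\<^sup>2 \<le> G"
proof -
  define i \<rho> e e' j where "i = 1 / (1 - \<beta>1)" and "\<rho> = 1 / (1 - \<beta>1 / \<beta>2)" and "e = 1 / \<beta>2"
    and "e' = 1 / sqrt \<beta>2" and "j = 1 / sqrt (1 - \<beta>1)"
  note defs = i_def \<rho>_def e_def e'_def j_def
  have b: "0 < \<beta>2" "\<beta>1 < 1" "0 < 1 - \<beta>1 / \<beta>2" "1 - \<beta>1 / \<beta>2 \<le> 1" using params by auto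
  have nn: "0 \<le> d" "0 \<le> S0" "0 \<le> S1" "0 \<le> \<kappa>" "0 \<le> i" "1 \<le> \<rho>" "j\<^sup>2 = i" "0 \<le> e'" "0 \<le> f x1 - fstar"
    using b params lower by (auto simp: d_def S0_def S1_def \<kappa>_def defs infnorm_pos_le power_divide)
  have ee: "e' \<le> e"
  proof -
    have "\<beta>2 \<le> sqrt \<beta>2" using b params by (intro real_le_rsqrt) (simp add: power2_eq_square mult_left_le)
    then show ?thesis using b by (simp add: defs frac_le)
  qed
  have Gl: "G = 8 * L * (f x1 - fstar) + 256 * L\<^sup>2 * C0\<^sup>2 * \<kappa>\<^sup>2 * d\<^sup>2 * i * \<rho> + 4 * L\<^sup>2 * C0\<^sup>2 * \<kappa>\<^sup>2 * d * \<rho>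
      + 48 * L * C0 * S0 * i * d * l
      + 8 * L * C0 * \<kappa>\<^sup>2 * \<rho> * (4 * S0 * e + (\<epsilon>0 + sqrt 2 * S0) * e' + L * C0 / 2 * (1 + 4 * (Sigma_max \<beta>2)\<^sup>2)) * d * \<Lambda>
      + 8 * (3 * L\<^sup>2 * C0\<^sup>2 * i\<^sup>2 + 8 * L * S0 * C0 * i) * d * \<Lambda>
      + 2304 * L\<^sup>2 * C0\<^sup>2 * S1\<^sup>2 * i\<^sup>2 * d\<^sup>2 * l\<^sup>2
      + 256 * (16 * L\<^sup>2 * C0\<^sup>2 * S1\<^sup>2 * i\<^sup>2 + 9 * L\<^sup>2 * C0\<^sup>2 * \<kappa> ^ 4 * (1 + S1\<^sup>2) * e\<^sup>2 * \<rho>\<^sup>2) * d\<^sup>2 * \<Lambda>\<^sup>2"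
    unfolding G_def G_const_def Let_def d_def[symmetric] S0_def[symmetric] S1_def[symmetric]
      l_def[symmetric] \<Lambda>_def[symmetric] \<kappa>_def defs
    by (simp add: power_divide power2_eq_square[of "1 - \<beta>1"] power3_eq_cube)
  have "0 \<le> G - 8 * L * (f x1 - fstar)"
    unfolding Gl using nn params l \<Lambda> ee by simp
  then show G0: "8 * L * (f x1 - fstar) \<le> G" by simp
  have "0 \<le> G" using G0 nn params by (smt (verit) mult_nonneg_nonneg)
  then have H: "H\<^sup>2 = G" "0 \<le> H" by (simp_all add: H_def)
  have q: "0 \<le> sqrt (1 + S1\<^sup>2)" "S1 \<le> sqrt (1 + S1\<^sup>2)" "(sqrt (1 + S1\<^sup>2))\<^sup>2 = 1 + S1\<^sup>2"
    by (auto intro: real_le_rsqrt)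
  have p: "0 \<le> L" "0 \<le> C0" "0 \<le> \<epsilon>0" using params by auto
  from budget_absorbs[OF p(1,2) nn(4,1,5,2,3) l \<Lambda> p(3) H(2) nn(6,7,8) ee q Gl H(1)]
  show "4 * L * (f x1 - fstar + d * (6 * C0 * (S0 + S1 * H) / (1 - \<beta>1) * l
        + 4 * C0 * (S0 + S1 * H) / (1 - \<beta>1) * \<Lambda>
        + \<kappa>\<^sup>2 * C0 / (1 - \<beta>1 / \<beta>2)
          * (4 * (S0 + S1 * H) / \<beta>2 + (\<epsilon>0 + sqrt 2 * (S0 + sqrt (1 + S1\<^sup>2) * H)) / sqrt \<beta>2) * \<Lambda>
        + 2 * \<kappa> * H * C0 / sqrt (1 - \<beta>1)
        + L / 2 * \<kappa>\<^sup>2 * (1 + 4 * (Sigma_max \<beta>2)\<^sup>2) * (C0\<^sup>2 / (1 - \<beta>1 / \<beta>2) * \<Lambda>)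
        + 2 * L * (C0\<^sup>2 / (1 - \<beta>1)\<^sup>2 * \<Lambda>)))
      + 2 * L\<^sup>2 * \<kappa>\<^sup>2 * d * C0\<^sup>2 \<le> G"
    by (simp add: defs power_divide)
qed

lemma (in adam_coordinate) proxy_nonneg_sum:
  assumes "t \<le> T" "\<And>s. s < t \<Longrightarrow> 0 \<le> c2 s"
  shows "0 \<le> (\<Sum>s<t. eta (Suc s) * (p s)\<^sup>2 / proxy s (c2 s))"
  using assms proxy_ge(3) eta_nonneg
  by (intro sum_nonneg divide_nonneg_nonneg mult_nonneg_nonneg) (auto intro: less_imp_le)

context adam_run
begin

text \<open>
  By induction all earlier gradients are at most \<open>H = sqrt G\<close>, so the cut-off in the weights is
  inactive and all bounds that depend on the gradient may use \<open>H\<close>. The resulting estimate at the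
  next iterate is the left-hand side of \<open>G_const_self_bounding\<close>, minus \<open>4 / 3 * L\<close> times the
  descent.
\<close>

lemma gradient_bound:
  fixes f :: "real^'d \<Rightarrow> real" and \<sigma>0 \<sigma>1 :: "real^'d" and fstar L \<delta> :: real
  defines "p i s \<equiv> nabla f (x (Suc s)) $ i"
  defines "S2 i s \<equiv> (\<sigma>0 $ i)\<^sup>2 + (\<sigma>1 $ i)\<^sup>2 * (p i s)\<^sup>2"
  defines "G \<equiv> G_const f fstar x1 L \<sigma>0 \<sigma>1 \<beta>1 \<beta>2 C0 \<epsilon>0 T \<delta>"
  defines "H \<equiv> sqrt G"
  defines "\<theta> \<equiv> (1 - \<beta>1) / (6 * C0 * (infnorm \<sigma>0 + infnorm \<sigma>1 * H))"
  defines "h i s \<equiv> noise_weight \<beta>1 \<beta>2 C0 \<epsilon>0 \<theta> H s (v s $ i) (p i s) (S2 i s)"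
  assumes smooth: "L_smooth L f" and L: "L > 0" and lower: "\<And>y. fstar \<le> f y"
    and \<sigma>0: "infnorm \<sigma>0 > 0" and l: "0 \<le> ln (real CARD('d) * real T / \<delta>)"
    and noise: "\<And>i s. s < T \<Longrightarrow> (g (Suc s) $ i - p i s)\<^sup>2 \<le> S2 i s"
    and mart: "\<And>i t. t \<le> T \<Longrightarrow> (\<Sum>s<t. h i s * (g (Suc s) $ i - p i s) - (\<bar>h i s\<bar> * sqrt (S2 i s))\<^sup>2)
        \<le> ln (real CARD('d) * real T / \<delta>)"
  shows "t \<le> T \<Longrightarrow> (norm (nabla f (x (Suc t))))\<^sup>2
    \<le> G - L * (\<Sum>i\<in>UNIV. \<Sum>s<t. coord.eta (Suc s) * (p i s)\<^sup>2 / coord.proxy i s ((p i s)\<^sup>2 + S2 i s))"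
proof (induction t rule: less_induct)
  case (less t)
  define \<kappa> where "\<kappa> = \<beta>1 / (1 - \<beta>1)"
  define l where "l = ln (real CARD('d) * real T / \<delta>)"
  define F where "F = F_const f x1 L \<sigma>0 \<sigma>1 \<beta>1 \<beta>2 C0 (\<epsilon>0 * sqrt (1 - \<beta>2)) T"
  define \<Lambda> where "\<Lambda> = ln (F / \<beta>2 ^ T)"
  define S0 S1 where "S0 = infnorm \<sigma>0" and "S1 = infnorm \<sigma>1"
  define Sb cb where "Sb = S0 + S1 * H" and "cb = S0 + sqrt (1 + S1\<^sup>2) * H"
  define P where "P i = (\<Sum>s<t. coord.eta (Suc s) * (p i s)\<^sup>2 / coord.proxy i s ((p i s)\<^sup>2 + S2 i s))" for i
  define K where "K = 6 * C0 * Sb / (1 - \<beta>1) * l + 4 * C0 * Sb / (1 - \<beta>1) * \<Lambda>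
      + \<kappa>\<^sup>2 * C0 / (1 - \<beta>1 / \<beta>2) * (4 * Sb / \<beta>2 + (\<epsilon>0 + sqrt 2 * cb) / sqrt \<beta>2) * \<Lambda>
      + 2 * \<kappa> * H * C0 / sqrt (1 - \<beta>1)
      + L / 2 * \<kappa>\<^sup>2 * (1 + 4 * (Sigma_max \<beta>2)\<^sup>2) * (C0\<^sup>2 / (1 - \<beta>1 / \<beta>2) * \<Lambda>)
      + 2 * L * (C0\<^sup>2 / (1 - \<beta>1)\<^sup>2 * \<Lambda>)"
  have t: "t \<le> T" by fact
  have F: "1 + (\<Sum>s<T. (g (Suc s) $ i)\<^sup>2) / (\<epsilon>0 * sqrt (1 - \<beta>2))\<^sup>2 \<le> F" for i
    unfolding F_def by (rule F_const_bound[OF smooth L]) (use noise in \<open>simp add: p_def S2_def\<close>)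
  have \<Lambda>: "(\<Sum>s<t. (1 - \<beta>2) * ((g (Suc s) $ i)\<^sup>2 / coord.u i (Suc s))) \<le> \<Lambda>" for i
    unfolding \<Lambda>_def by (rule coord.sum_g_sq_over_u_le_log[OF t F])
  have \<Lambda>0: "0 \<le> \<Lambda>"
    unfolding \<Lambda>_def using coord.sum_g_sq_over_u_le_log[OF _ F, of 0] by simp
  have gc: "8 * L * (f x1 - fstar) \<le> G" "4 * L * (f x1 - fstar + real CARD('d) * K) + 2 * L\<^sup>2 * \<kappa>\<^sup>2 * real CARD('d) * C0\<^sup>2 \<le> G"
    using G_const_self_bounding[OF params L lower[of x1] l \<Lambda>0[unfolded \<Lambda>_def F_def]]
    unfolding K_def \<kappa>_def l_def \<Lambda>_def F_def Sb_def cb_def S0_def S1_def H_def G_def by simp_all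
  have "0 \<le> L * (f x1 - fstar)" using L lower[of x1] by simp
  with gc have G: "0 \<le> G" by linarith
  have H: "0 \<le> H" "H\<^sup>2 = G" using G by (simp_all add: H_def)
  have S: "0 < S0" "0 \<le> S1" using \<sigma>0 by (auto simp: S0_def S1_def infnorm_pos_le)
  have Sb: "0 < Sb" and cb: "0 \<le> cb" using S H by (auto simp: Sb_def cb_def add_pos_nonneg)
  have S2n: "0 \<le> S2 i s" for i s by (simp add: S2_def)
  have Pn: "0 \<le> P i" for i
    unfolding P_def using S2n by (intro coord.proxy_nonneg_sum[OF t]) auto
  have grad: "(norm (nabla f (x (Suc s))))\<^sup>2 \<le> G" if s: "s < t" for s
  proof -
    have "0 \<le> (\<Sum>i\<in>UNIV. \<Sum>r<s. coord.eta (Suc r) * (p i r)\<^sup>2 / coord.proxy i r ((p i r)\<^sup>2 + S2 i r))"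
      using s t S2n by (intro sum_nonneg[of UNIV] coord.proxy_nonneg_sum) auto
    then have "0 \<le> L * (\<Sum>i\<in>UNIV. \<Sum>r<s. coord.eta (Suc r) * (p i r)\<^sup>2 / coord.proxy i r ((p i r)\<^sup>2 + S2 i r))"
      using L by simp
    then show ?thesis using less.IH[OF s] s t by linarith
  qed
  have pH: "\<bar>p i s\<bar> \<le> H" if "s < t" for i s
  proof -
    have "(p i s)\<^sup>2 \<le> H\<^sup>2"
      using vec_nth_sq_le_norm_sq[of "nabla f (x (Suc s))" i] grad[OF that] H by (simp add: p_def)
    then show ?thesis using H(1) by (simp add: abs_le_square_iff[symmetric])
  qed
  have pG: "(p i s)\<^sup>2 \<le> H\<^sup>2" if "s < t" for i s
    using power_mono[OF pH[OF that], of i 2] by simp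
  have \<sigma>le: "(\<sigma>0 $ i)\<^sup>2 \<le> S0\<^sup>2" "(\<sigma>1 $ i)\<^sup>2 \<le> S1\<^sup>2" for i
    using power_mono[OF component_le_infnorm_cart, of _ _ 2] unfolding S0_def S1_def by force+
  have sum_sq: "a\<^sup>2 + b\<^sup>2 \<le> (a + b)\<^sup>2" if "0 \<le> a" "0 \<le> b" for a b :: real
    using that by (simp add: power2_sum)
  have S1p: "(\<sigma>1 $ i)\<^sup>2 * (p i s)\<^sup>2 \<le> S1\<^sup>2 * H\<^sup>2" if "s < t" for i s
    using \<sigma>le pG[OF that] by (intro mult_mono) auto
  have S2le: "S2 i s \<le> Sb\<^sup>2" if "s < t" for i s
    using S1p[OF that, of i] \<sigma>le(1)[of i] sum_sq[of S0 "S1 * H"] S H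
    by (simp add: S2_def Sb_def power_mult_distrib)
  have c2le: "(p i s)\<^sup>2 + S2 i s \<le> cb\<^sup>2" if "s < t" for i s
    using S1p[OF that, of i] \<sigma>le(1)[of i] sum_sq[of S0 "sqrt (1 + S1\<^sup>2) * H"] S H pG[OF that, of i]
    by (simp add: S2_def cb_def power_mult_distrib distrib_right)
  have martP: "(\<Sum>s<t. - (coord.eta (Suc s) * p i s * (g (Suc s) $ i - p i s) / coord.proxy i s ((p i s)\<^sup>2 + S2 i s)))
      \<le> 1 / 6 * P i + 6 * C0 * Sb / (1 - \<beta>1) * l" for i
    unfolding P_def
    by (rule coord.martingale_part_le[OF t S2n S2le Sb pH])
      (use mart[OF t, of i] in \<open>simp_all add: h_def \<theta>_def Sb_def S0_def S1_def l_def\<close>)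
  have \<kappa>0: "0 \<le> \<kappa>" using params by (simp add: \<kappa>_def)
  have coord_le: "(\<Sum>s<t. p i s * (- (coord.w i (Suc s) * g (Suc s) $ i) - \<kappa> * (m s $ i * (coord.w i (Suc s) - coord.w i s))))
        + L / 2 * \<kappa>\<^sup>2 * (1 + 4 * (Sigma_max \<beta>2)\<^sup>2) * (\<Sum>s<t. (coord.w i s * m s $ i)\<^sup>2)
        + 2 * L * (\<Sum>s<t. (coord.w i (Suc s) * g (Suc s) $ i)\<^sup>2) \<le> K - 1 / 3 * P i" for i
  proof -
    have "(\<Sum>s<t. p i s * (- (coord.w i (Suc s) * g (Suc s) $ i) - \<kappa> * (m s $ i * (coord.w i (Suc s) - coord.w i s))))
      \<le> - (1 / 3) * P i + 6 * C0 * Sb / (1 - \<beta>1) * l + 4 * C0 * Sb / (1 - \<beta>1) * \<Lambda>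
      + \<kappa>\<^sup>2 * C0 / (1 - \<beta>1 / \<beta>2) * (4 * Sb / \<beta>2 + (\<epsilon>0 + sqrt 2 * cb) / sqrt \<beta>2) * \<Lambda>
      + 2 * \<kappa> * H * C0 / sqrt (1 - \<beta>1)"
      using martP[of i] unfolding P_def
      by (intro coord.coordinate_bound[OF t _ S2le less_imp_le[OF Sb] c2le cb pH H(1) \<kappa>0 \<Lambda>])
        (use noise t in auto)
    moreover have "L / 2 * \<kappa>\<^sup>2 * (1 + 4 * (Sigma_max \<beta>2)\<^sup>2) * (\<Sum>s<t. (coord.w i s * m s $ i)\<^sup>2)
        \<le> L / 2 * \<kappa>\<^sup>2 * (1 + 4 * (Sigma_max \<beta>2)\<^sup>2) * (C0\<^sup>2 / (1 - \<beta>1 / \<beta>2) * \<Lambda>)"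
      using coord.sum_step_sq_le[OF t \<Lambda>] L by (intro mult_left_mono) auto
    moreover have "2 * L * (\<Sum>s<t. (coord.w i (Suc s) * g (Suc s) $ i)\<^sup>2) \<le> 2 * L * (C0\<^sup>2 / (1 - \<beta>1)\<^sup>2 * \<Lambda>)"
      using coord.sum_w_g_sq_le[OF t \<Lambda>] L by (intro mult_left_mono) auto
    ultimately show ?thesis unfolding K_def by linarith
  qed
  have "f (lookahead t) \<le> f x1 + (\<Sum>i\<in>UNIV. (\<Sum>s<t. p i s
          * (- (coord.w i (Suc s) * g (Suc s) $ i) - \<kappa> * (m s $ i * (coord.w i (Suc s) - coord.w i s))))
        + L / 2 * \<kappa>\<^sup>2 * (1 + 4 * (Sigma_max \<beta>2)\<^sup>2) * (\<Sum>s<t. (coord.w i s * m s $ i)\<^sup>2)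
        + 2 * L * (\<Sum>s<t. (coord.w i (Suc s) * g (Suc s) $ i)\<^sup>2))"
    unfolding p_def \<kappa>_def by (rule f_lookahead_le[OF smooth L t])
  also have "\<dots> \<le> f x1 + (\<Sum>i\<in>(UNIV::'d set). K - 1 / 3 * P i)"
    by (intro add_left_mono sum_mono coord_le)
  also have "\<dots> = f x1 + real CARD('d) * K - 1 / 3 * (\<Sum>i\<in>UNIV. P i)"
    by (simp add: sum_subtractf sum_divide_distrib)
  finally have "f (lookahead t) - fstar \<le> (f x1 - fstar + real CARD('d) * K) - 1 / 3 * (\<Sum>i\<in>UNIV. P i)"
    by simp
  then have "4 * L * (f (lookahead t) - fstar)
      \<le> 4 * L * ((f x1 - fstar + real CARD('d) * K) - 1 / 3 * (\<Sum>i\<in>UNIV. P i))"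
    using L by (intro mult_left_mono) auto
  then have "4 * L * (f (lookahead t) - fstar) \<le> 4 * L * (f x1 - fstar + real CARD('d) * K) - L * (\<Sum>i\<in>UNIV. P i)
     - 1 / 3 * (L * (\<Sum>i\<in>UNIV. P i))"
    by (simp add: right_diff_distrib)
  moreover have "0 \<le> L * (\<Sum>i\<in>UNIV. P i)" using Pn L by (simp add: sum_nonneg)
  ultimately show ?case
    using grad_next_sq_le[OF smooth L lower t] gc(2) unfolding \<kappa>_def[symmetric] P_def by linarith
qed

end

section \<open>The random process\<close>

lemma borel_measurable_vec_iff:
  "(h :: 'a \<Rightarrow> real^'n) \<in> borel_measurable N \<longleftrightarrow> (\<forall>i. (\<lambda>\<omega>. h \<omega> $ i) \<in> borel_measurable N)"
  by (subst borel_measurable_euclidean_space) (auto simp: Basis_vec_def inner_axis)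

lemma borel_measurable_nabla:
  fixes f :: "'a::euclidean_space \<Rightarrow> real"
  assumes "L_smooth L f"
  shows "nabla f \<in> borel_measurable borel"
proof (rule borel_measurable_continuous_onI)
  have "(max L 0)-lipschitz_on UNIV (nabla f)"
  proof (rule lipschitz_onI)
    fix x y
    have "dist (nabla f x) (nabla f y) \<le> L * dist x y"
      using assms by (simp add: L_smooth_def dist_norm)
    also have "\<dots> \<le> max L 0 * dist x y" by (intro mult_right_mono) auto
    finally show "dist (nabla f x) (nabla f y) \<le> max L 0 * dist x y" .
  qed simp
  then show "continuous_on UNIV (nabla f)" by (rule lipschitz_on_continuous_on)
qed

lemma space_history [simp]: "space (history M g s) = space M"
  by (simp add: history_def space_measure_of_conv)

lemma sets_history:
  "sets (history M g s) = sigma_sets (space M) (\<Union>r\<in>{1..<s}. {g r -` A \<inter> space M |A. A \<in> sets borel})"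
  unfolding history_def by (rule sets_measure_of) auto

lemma measurable_history:
  fixes g :: "nat \<Rightarrow> 'w \<Rightarrow> 'b::topological_space"
  shows "r \<in> {1..<s} \<Longrightarrow> g r \<in> borel_measurable (history M g s)"
proof (rule measurableI)
  fix A :: "'b set" assume "r \<in> {1..<s}" "A \<in> sets borel"
  then have "g r -` A \<inter> space M \<in> (\<Union>r\<in>{1..<s}. {g r -` A \<inter> space M |A. A \<in> sets borel})" by blast
  then show "g r -` A \<inter> space (history M g s) \<in> sets (history M g s)"
    by (simp add: sets_history sigma_sets.Basic)
qed simp

lemma subalgebra_history:
  assumes "\<And>r. r \<in> {1..<s} \<Longrightarrow> g r \<in> borel_measurable M"
  shows "subalgebra M (history M g s)"
  unfolding subalgebra_def sets_history
  using assms by (auto intro!: sets.sigma_sets_subset measurable_sets)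

lemma measurable_history_mono:
  assumes "s \<le> s'" "h \<in> borel_measurable (history M g s)"
  shows "h \<in> borel_measurable (history M g s')"
proof -
  have "sets (history M g s) \<subseteq> sets (history M g s')"
    unfolding sets_history using assms(1) by (intro sigma_sets_mono' UN_mono) auto
  then show ?thesis
    using assms(2) by (auto simp: measurable_def)
qed

locale adam_random = prob_space M
  for M :: "'w measure" +
  fixes f :: "real^'d \<Rightarrow> real"
    and fstar L \<beta>1 \<beta>2 C0 \<epsilon>0 \<delta> :: real
    and T :: nat
    and x1 \<sigma>0 \<sigma>1 :: "real^'d"
    and orc :: "nat \<Rightarrow> real^'d \<Rightarrow> 'w \<Rightarrow> real^'d"
    and g x m v :: "nat \<Rightarrow> 'w \<Rightarrow> real^'d"
  assumes T: "T \<ge> 1" and L: "L > 0"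
    and smooth: "L_smooth L f"
    and lower: "\<And>y. fstar \<le> f y"
    and \<sigma>0_pos: "\<And>i. \<sigma>0 $ i > 0"
    and params: "0 \<le> \<beta>1" "\<beta>1 < \<beta>2" "\<beta>2 < 1" "C0 > 0" "\<epsilon>0 > 0"
    and query: "stochastic_oracle M T orc g"
    and unbiased: "unbiased M T f orc g"
    and noise: "affine_variance_noise M T f \<sigma>0 \<sigma>1 orc g"
    and process: "adam_process M \<beta>1 \<beta>2 (\<epsilon>0 * sqrt (1 - \<beta>2)) (C0 * sqrt (1 - \<beta>2)) T x1 orc g x m v"
    and \<delta>: "0 < \<delta>" "\<delta> < 1"
begin

definition p :: "'d \<Rightarrow> nat \<Rightarrow> 'w \<Rightarrow> real"
  where "p i s \<omega> = nabla f (x (Suc s) \<omega>) $ i"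

definition S2 :: "'d \<Rightarrow> nat \<Rightarrow> 'w \<Rightarrow> real"
  where "S2 i s \<omega> = (\<sigma>0 $ i)\<^sup>2 + (\<sigma>1 $ i)\<^sup>2 * (p i s \<omega>)\<^sup>2"

definition G :: real
  where "G = G_const f fstar x1 L \<sigma>0 \<sigma>1 \<beta>1 \<beta>2 C0 \<epsilon>0 T \<delta>"

definition weight :: "'d \<Rightarrow> nat \<Rightarrow> 'w \<Rightarrow> real"
  where "weight i s \<omega> = noise_weight \<beta>1 \<beta>2 C0 \<epsilon>0 ((1 - \<beta>1) / (6 * C0 * (infnorm \<sigma>0 + infnorm \<sigma>1 * sqrt G)))
    (sqrt G) s (v s \<omega> $ i) (p i s \<omega>) (S2 i s \<omega>)"

lemma run: "\<omega> \<in> space M \<Longrightarrow> adam_run \<beta>1 \<beta>2 C0 \<epsilon>0 T x1 (\<lambda>s. g s \<omega>) (\<lambda>s. x s \<omega>) (\<lambda>s. m s \<omega>) (\<lambda>s. v s \<omega>)"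
  using process params by (simp add: adam_run_def adam_process_def)

lemma coordinate: "\<omega> \<in> space M \<Longrightarrow>
    adam_coordinate \<beta>1 \<beta>2 C0 \<epsilon>0 T (\<lambda>s. g s \<omega> $ i) (\<lambda>s. m s \<omega> $ i) (\<lambda>s. v s \<omega> $ i)"
proof -
  assume "\<omega> \<in> space M"
  then interpret r: adam_run \<beta>1 \<beta>2 C0 \<epsilon>0 T x1 "\<lambda>s. g s \<omega>" "\<lambda>s. x s \<omega>" "\<lambda>s. m s \<omega>" "\<lambda>s. v s \<omega>"
    by (rule run)
  show ?thesis by (rule r.coord.adam_coordinate_axioms)
qed

lemma g_eq: "\<omega> \<in> space M \<Longrightarrow> s \<in> {1..T} \<Longrightarrow> g s \<omega> = orc s (x s \<omega>) \<omega>"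
  using process by (simp add: adam_process_def)

text \<open>
  Stated for an arbitrary \<sigma>-algebra on the sample space that makes the answers so far measurable,
  in particular for the history they generate.
\<close>

lemma measurable_path:
  assumes N: "space N = space M" and g: "\<And>r. r \<in> {1..s} \<Longrightarrow> g r \<in> borel_measurable N" and s: "s \<le> T"
  shows "m s \<in> borel_measurable N \<and> v s \<in> borel_measurable N \<and> x (Suc s) \<in> borel_measurable N"
  using g s
proof (induction s)
  case 0
  have path: "m 0 \<omega> = 0" "v 0 \<omega> = 0" "x (Suc 0) \<omega> = x1" if "\<omega> \<in> space N" for \<omega>
    using process that N by (auto simp: adam_process_def adam_path_def)
  have "m 0 \<in> borel_measurable N" by (subst measurable_cong[OF path(1)]) auto
  moreover have "v 0 \<in> borel_measurable N" by (subst measurable_cong[OF path(2)]) auto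
  moreover have "x (Suc 0) \<in> borel_measurable N" by (subst measurable_cong[OF path(3)]) auto
  ultimately show ?case by simp
next
  case (Suc s)
  have IH: "m s \<in> borel_measurable N" "v s \<in> borel_measurable N" "x (Suc s) \<in> borel_measurable N"
    using Suc by auto
  have gs: "g (Suc s) \<in> borel_measurable N" using Suc.prems by auto
  have path: "m (Suc s) \<omega> $ i = \<beta>1 * m s \<omega> $ i + (1 - \<beta>1) * g (Suc s) \<omega> $ i"
    "v (Suc s) \<omega> $ i = \<beta>2 * v s \<omega> $ i + (1 - \<beta>2) * (g (Suc s) \<omega> $ i)\<^sup>2"
    "x (Suc (Suc s)) \<omega> $ i = x (Suc s) \<omega> $ i - adam_eta \<beta>1 \<beta>2 (C0 * sqrt (1 - \<beta>2)) (Suc s)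
      / (sqrt (v (Suc s) \<omega> $ i) + adam_eps \<beta>2 (\<epsilon>0 * sqrt (1 - \<beta>2)) (Suc s)) * m (Suc s) \<omega> $ i"
    if "\<omega> \<in> space N" for \<omega> i
    using process that N Suc.prems(2)
    by (auto simp: adam_process_def adam_path_def dest!: bspec[of _ _ \<omega>] bspec[of _ _ "Suc s"])
  note comp = IH[unfolded borel_measurable_vec_iff, rule_format] gs[unfolded borel_measurable_vec_iff, rule_format]
  have m: "m (Suc s) \<in> borel_measurable N"
    unfolding borel_measurable_vec_iff
  proof
    fix i show "(\<lambda>\<omega>. m (Suc s) \<omega> $ i) \<in> borel_measurable N"
      by (subst measurable_cong[OF path(1)]) (use comp in auto)
  qed
  have v: "v (Suc s) \<in> borel_measurable N"
    unfolding borel_measurable_vec_iff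
  proof
    fix i show "(\<lambda>\<omega>. v (Suc s) \<omega> $ i) \<in> borel_measurable N"
      by (subst measurable_cong[OF path(2)]) (use comp in auto)
  qed
  note comp' = m[unfolded borel_measurable_vec_iff, rule_format] v[unfolded borel_measurable_vec_iff, rule_format]
  note [measurable] = comp comp'
  have "x (Suc (Suc s)) \<in> borel_measurable N"
    unfolding borel_measurable_vec_iff
  proof
    fix i show "(\<lambda>\<omega>. x (Suc (Suc s)) \<omega> $ i) \<in> borel_measurable N"
      by (subst measurable_cong[OF path(3)]) measurable
  qed
  with m v show ?case by simp
qed

lemma measurable_path_history:
  assumes "s \<le> T"
  shows "m s \<in> borel_measurable (history M g (Suc s))" "v s \<in> borel_measurable (history M g (Suc s))"
    "x (Suc s) \<in> borel_measurable (history M g (Suc s))"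
proof -
  have "g r \<in> borel_measurable (history M g (Suc s))" if "r \<in> {1..s}" for r
    using that by (intro measurable_history) auto
  from measurable_path[OF space_history this assms]
  show "m s \<in> borel_measurable (history M g (Suc s))" "v s \<in> borel_measurable (history M g (Suc s))"
    "x (Suc s) \<in> borel_measurable (history M g (Suc s))" by auto
qed

lemma measurable_g: "s < T \<Longrightarrow> g (Suc s) \<in> borel_measurable M"
proof -
  assume s: "s < T"
  have "(\<lambda>\<omega>. orc (Suc s) (x (Suc s) \<omega>) \<omega>) \<in> borel_measurable M"
    using query measurable_path_history(3)[of s] s by (auto simp: stochastic_oracle_def)
  then show ?thesis
    using g_eq[of _ "Suc s"] s by (subst measurable_cong[of M _ "\<lambda>\<omega>. orc (Suc s) (x (Suc s) \<omega>) \<omega>"]) auto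
qed

lemma subalgebra_F: "s \<le> T \<Longrightarrow> subalgebra M (history M g (Suc s))"
proof (rule subalgebra_history)
  fix r assume "s \<le> T" "r \<in> {1..<Suc s}"
  then show "g r \<in> borel_measurable M" using measurable_g[of "r - 1"] by auto
qed

lemma measurable_state:
  assumes "s \<le> T"
  shows "p i s \<in> borel_measurable (history M g (Suc s))"
    and "S2 i s \<in> borel_measurable (history M g (Suc s))"
    and "weight i s \<in> borel_measurable (history M g (Suc s))"
proof -
  have "(\<lambda>\<omega>. nabla f (x (Suc s) \<omega>)) \<in> borel_measurable (history M g (Suc s))"
    by (rule measurable_compose[OF measurable_path_history(3)[OF assms] borel_measurable_nabla[OF smooth]])
  then show p [measurable]: "p i s \<in> borel_measurable (history M g (Suc s))"
    by (simp add: borel_measurable_vec_iff p_def[abs_def])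
  have [measurable]: "(\<lambda>\<omega>. v s \<omega> $ i) \<in> borel_measurable (history M g (Suc s))"
    using measurable_path_history(2)[OF assms] by (simp add: borel_measurable_vec_iff)
  show [measurable]: "S2 i s \<in> borel_measurable (history M g (Suc s))"
    unfolding S2_def[abs_def] by measurable
  show "weight i s \<in> borel_measurable (history M g (Suc s))"
    unfolding weight_def[abs_def] noise_weight_def by measurable
qed

lemma to_M: "s \<le> T \<Longrightarrow> h \<in> borel_measurable (history M g (Suc s)) \<Longrightarrow> h \<in> borel_measurable M"
  by (rule measurable_from_subalg[OF subalgebra_F])

lemma noise_AE: "s < T \<Longrightarrow> AE \<omega> in M. (g (Suc s) \<omega> $ i - p i s \<omega>)\<^sup>2 \<le> S2 i s \<omega>"
proof -
  assume s: "s < T"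
  have "AE \<omega> in M. (orc (Suc s) (x (Suc s) \<omega>) \<omega> $ i - nabla f (x (Suc s) \<omega>) $ i)\<^sup>2
        \<le> (\<sigma>0 $ i)\<^sup>2 + (\<sigma>1 $ i)\<^sup>2 * (nabla f (x (Suc s) \<omega>) $ i)\<^sup>2"
    using noise measurable_path_history(3)[of s] s by (auto simp: affine_variance_noise_def)
  with AE_space show ?thesis
  proof eventually_elim
    case (elim \<omega>)
    then show ?case using g_eq[of \<omega> "Suc s"] s by (simp add: p_def S2_def)
  qed
qed

text \<open>
  The iterates stay in a fixed bounded region on every sample path. This is what makes the answers
  integrable, and hence unbiasedness applicable at the iterates.
\<close>

lemma p_bounded: "\<exists>B\<ge>0. \<forall>s\<le>T. \<forall>\<omega>\<in>space M. \<forall>i. (p i s \<omega>)\<^sup>2 \<le> B"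
proof (intro exI conjI allI impI ballI)
  let ?B = "2 * (norm (nabla f x1))\<^sup>2 + 2 * L\<^sup>2 * real CARD('d) * C0\<^sup>2 * (real T)\<^sup>2"
  show "0 \<le> ?B" by simp
  fix s \<omega> i assume s: "s \<le> T" and \<omega>: "\<omega> \<in> space M"
  have "(p i s \<omega>)\<^sup>2 \<le> (norm (nabla f (x (Suc s) \<omega>)))\<^sup>2"
    unfolding p_def by (rule vec_nth_sq_le_norm_sq)
  also have "\<dots> \<le> 2 * (norm (nabla f x1))\<^sup>2 + 2 * L\<^sup>2 * real CARD('d) * C0\<^sup>2 * (real s)\<^sup>2"
    by (rule adam_run.grad_sq_le[OF run[OF \<omega>] smooth L s])
  also have "\<dots> \<le> ?B" using s by (intro add_left_mono mult_left_mono power_mono) auto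
  finally show "(p i s \<omega>)\<^sup>2 \<le> ?B" .
qed

lemma integrable_p: "s \<le> T \<Longrightarrow> integrable M (p i s)"
proof -
  assume s: "s \<le> T"
  obtain B where B: "\<And>\<omega>. \<omega> \<in> space M \<Longrightarrow> (p i s \<omega>)\<^sup>2 \<le> B" using p_bounded s by blast
  show ?thesis
  proof (rule integrable_const_bound)
    show "AE \<omega> in M. norm (p i s \<omega>) \<le> sqrt B"
      using B by (intro AE_I2) (simp add: real_le_rsqrt)
  qed (rule to_M[OF s measurable_state(1)[OF s]])
qed

lemma integrable_g: "s < T \<Longrightarrow> integrable M (\<lambda>\<omega>. g (Suc s) \<omega> $ i)"
proof -
  assume s: "s < T"
  obtain B where B: "\<And>\<omega>. \<omega> \<in> space M \<Longrightarrow> (p i s \<omega>)\<^sup>2 \<le> B" using p_bounded less_imp_le[OF s] by blast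
  have "AE \<omega> in M. norm (g (Suc s) \<omega> $ i) \<le> sqrt (2 * B + 2 * ((\<sigma>0 $ i)\<^sup>2 + (\<sigma>1 $ i)\<^sup>2 * B))"
    using noise_AE[OF s, of i] AE_space
  proof eventually_elim
    case (elim \<omega>)
    have "S2 i s \<omega> \<le> (\<sigma>0 $ i)\<^sup>2 + (\<sigma>1 $ i)\<^sup>2 * B"
      using B[OF elim(2)] by (simp add: S2_def mult_left_mono)
    then have "(g (Suc s) \<omega> $ i)\<^sup>2 \<le> 2 * B + 2 * ((\<sigma>0 $ i)\<^sup>2 + (\<sigma>1 $ i)\<^sup>2 * B)"
      using add_sq_le[of "p i s \<omega>" "g (Suc s) \<omega> $ i - p i s \<omega>"] elim(1) B[OF elim(2)] by simp
    then show ?case by (simp add: real_le_rsqrt)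
  qed
  then show ?thesis
    using measurable_g[OF s] by (intro integrable_const_bound) (auto simp: borel_measurable_vec_iff)
qed

lemma noise_centered:
  assumes s: "s < T"
  shows "AE \<omega> in M. real_cond_exp M (history M g (Suc s)) (\<lambda>\<omega>. g (Suc s) \<omega> $ i - p i s \<omega>) \<omega> = 0"
proof -
  have sub: "subalgebra M (history M g (Suc s))" using subalgebra_F s by simp
  interpret sigma_finite_subalgebra M "history M g (Suc s)"
    by (rule finite_measure_subalgebra_is_sigma_finite) (unfold_locales, rule sub)
  let ?o = "\<lambda>\<omega>. orc (Suc s) (x (Suc s) \<omega>) \<omega>"
  have go: "AE \<omega> in M. ?o \<omega> = g (Suc s) \<omega>"
    using g_eq[of _ "Suc s"] s by (intro AE_I2) auto
  have X: "x (Suc s) \<in> borel_measurable (history M g (Suc s))" using measurable_path_history s by simp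
  have oM: "?o \<in> borel_measurable M" using query X s by (auto simp: stochastic_oracle_def)
  have "integrable M (g (Suc s))"
  proof (rule Bochner_Integration.integrable_bound)
    show "integrable M (\<lambda>\<omega>. \<Sum>i\<in>UNIV. \<bar>g (Suc s) \<omega> $ i\<bar>)" using integrable_g[OF s] by auto
    show "AE \<omega> in M. norm (g (Suc s) \<omega>) \<le> norm (\<Sum>i\<in>UNIV. \<bar>g (Suc s) \<omega> $ i\<bar>)"
      by (intro AE_I2) (simp add: sum_nonneg norm_le_l1_cart)
  qed (rule measurable_g[OF s])
  then have "integrable M ?o"
    using go oM measurable_g[OF s] by (subst integrable_cong_AE) auto
  then have "AE \<omega> in M. real_cond_exp M (history M g (Suc s)) (\<lambda>\<omega>. ?o \<omega> $ i) \<omega> = nabla f (x (Suc s) \<omega>) $ i"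
    using unbiased X s by (auto simp: unbiased_def)
  moreover have "AE \<omega> in M. real_cond_exp M (history M g (Suc s)) (\<lambda>\<omega>. ?o \<omega> $ i) \<omega>
      = real_cond_exp M (history M g (Suc s)) (\<lambda>\<omega>. g (Suc s) \<omega> $ i) \<omega>"
    using go oM measurable_g[OF s] by (intro real_cond_exp_cong) (auto simp: borel_measurable_vec_iff)
  moreover have "AE \<omega> in M. real_cond_exp M (history M g (Suc s)) (p i s) \<omega> = p i s \<omega>"
    using integrable_p[of s i] measurable_state(1)[of s i] s by (intro real_cond_exp_F_meas) auto
  moreover have "AE \<omega> in M. real_cond_exp M (history M g (Suc s)) (\<lambda>\<omega>. g (Suc s) \<omega> $ i - p i s \<omega>) \<omega>
      = real_cond_exp M (history M g (Suc s)) (\<lambda>\<omega>. g (Suc s) \<omega> $ i) \<omega>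
        - real_cond_exp M (history M g (Suc s)) (p i s) \<omega>"
    using integrable_g[OF s, of i] integrable_p[of s i] s by (intro real_cond_exp_diff) auto
  ultimately show ?thesis by eventually_elim (simp add: p_def)
qed

text \<open>
  The logarithm of the exponential supermartingale for coordinate \<open>i\<close> after \<open>t\<close> rounds.
\<close>

definition deviation :: "'d \<Rightarrow> nat \<Rightarrow> 'w \<Rightarrow> real"
  where "deviation i t \<omega> = (\<Sum>s<t. weight i s \<omega> * (g (Suc s) \<omega> $ i - p i s \<omega>)
    - (\<bar>weight i s \<omega>\<bar> * sqrt (S2 i s \<omega>))\<^sup>2)"

lemma S2_nonneg: "0 \<le> S2 i s \<omega>"
  by (simp add: S2_def)

lemma dT_pos: "0 < real CARD('d) * real T"
  using T by simp

lemma log_nonneg: "0 \<le> ln (real CARD('d) * real T / \<delta>)"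
proof -
  have "1 * 1 \<le> real CARD('d) * real T" using T by (intro mult_mono) (auto simp: Suc_le_eq)
  then have "1 \<le> real CARD('d) * real T / \<delta>" using \<delta> by (simp add: pos_le_divide_eq)
  then show ?thesis by simp
qed

lemma infnorm_\<sigma>0_pos: "0 < infnorm \<sigma>0"
  using component_le_infnorm_cart[of \<sigma>0 undefined] \<sigma>0_pos[of undefined] by linarith

lemma measurable_deviation: "t \<le> T \<Longrightarrow> deviation i t \<in> borel_measurable M"
proof -
  assume t: "t \<le> T"
  have [measurable]: "weight i s \<in> borel_measurable M" "p i s \<in> borel_measurable M"
    "S2 i s \<in> borel_measurable M" "(\<lambda>\<omega>. g (Suc s) \<omega> $ i) \<in> borel_measurable M" if "s < T" for s
    using to_M[OF _ measurable_state(1)[of s i]] to_M[OF _ measurable_state(2)[of s i]]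
      to_M[OF _ measurable_state(3)[of s i]] measurable_g[OF that] that
    by (simp_all add: borel_measurable_vec_iff)
  show ?thesis unfolding deviation_def[abs_def]
    using t by (intro borel_measurable_sum) auto
qed

lemma deviation_tail:
  assumes t: "t \<le> T"
  shows "prob {\<omega> \<in> space M. deviation i t \<omega> > ln (real CARD('d) * real T / \<delta>)} \<le> \<delta> / (real CARD('d) * real T)"
proof -
  obtain B where B: "0 \<le> B" "\<And>s \<omega>. s \<le> T \<Longrightarrow> \<omega> \<in> space M \<Longrightarrow> (p i s \<omega>)\<^sup>2 \<le> B"
    using p_bounded by blast
  define W where "W = \<bar>(1 - \<beta>1) / (6 * C0 * (infnorm \<sigma>0 + infnorm \<sigma>1 * sqrt G))\<bar>
      * (C0 * sqrt (1 - \<beta>2) / (1 - \<beta>1) * \<bar>sqrt G\<bar> / (\<epsilon>0 * (1 - \<beta>2)))"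
  define D where "D = sqrt ((\<sigma>0 $ i)\<^sup>2 + (\<sigma>1 $ i)\<^sup>2 * B)"
  have b: "\<beta>1 < 1" using params by simp
  have W: "0 \<le> W" unfolding W_def using params b by (intro mult_nonneg_nonneg divide_nonneg_nonneg) auto
  have w_le: "\<bar>weight i s \<omega>\<bar> \<le> W" if s: "s < T" and \<omega>: "\<omega> \<in> space M" for s \<omega>
    unfolding W_def weight_def by (rule adam_coordinate.abs_noise_weight_le[OF coordinate[OF \<omega>] s S2_nonneg])
  have S_le: "sqrt (S2 i s \<omega>) \<le> D" if "s < T" "\<omega> \<in> space M" for s \<omega>
    using B(2)[of s \<omega>] that by (simp add: D_def S2_def mult_left_mono)
  have D: "0 \<le> D" using B(1) by (simp add: D_def)
  have "integrable M (\<lambda>\<omega>. exp (deviation i t \<omega>)) \<and> expectation (\<lambda>\<omega>. exp (deviation i t \<omega>)) \<le> 1"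
    unfolding deviation_def
  proof (rule supermartingale_exp_le_1[where F = "\<lambda>s. history M g (Suc s)" and K = "W + W * D"])
    fix s assume s: "s < t"
    then have sT: "s < T" "s \<le> T" using t by auto
    show "subalgebra M (history M g (Suc s))" using subalgebra_F[OF sT(2)] .
    show "weight i s \<in> borel_measurable (history M g (Suc s))" using measurable_state(3)[OF sT(2)] .
    have "S2 i s \<in> borel_measurable (history M g (Suc s))" using measurable_state(2)[OF sT(2)] .
    then show "(\<lambda>\<omega>. \<bar>weight i s \<omega>\<bar> * sqrt (S2 i s \<omega>)) \<in> borel_measurable (history M g (Suc s))"
      using measurable_state(3)[OF sT(2), of i] by simp
    show "integrable M (\<lambda>\<omega>. g (Suc s) \<omega> $ i - p i s \<omega>)"
      using integrable_g[OF sT(1), of i] integrable_p[OF sT(2), of i] by simp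
    show "AE \<omega> in M. real_cond_exp M (history M g (Suc s)) (\<lambda>\<omega>. g (Suc s) \<omega> $ i - p i s \<omega>) \<omega> = 0"
      by (rule noise_centered[OF sT(1)])
    show "AE \<omega> in M. \<bar>weight i s \<omega> * (g (Suc s) \<omega> $ i - p i s \<omega>)\<bar> \<le> \<bar>weight i s \<omega>\<bar> * sqrt (S2 i s \<omega>)"
      using noise_AE[OF sT(1), of i]
      by eventually_elim (auto simp: abs_mult intro!: mult_left_mono real_le_rsqrt)
    fix \<omega> assume \<omega>: "\<omega> \<in> space M"
    show "\<bar>weight i s \<omega>\<bar> \<le> W + W * D"
      using w_le[OF sT(1) \<omega>] W D by (simp add: add_increasing2)
    have "\<bar>weight i s \<omega>\<bar> * sqrt (S2 i s \<omega>) \<le> W * D"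
      using w_le[OF sT(1) \<omega>] S_le[OF sT(1) \<omega>] S2_nonneg W by (intro mult_mono) auto
    then show "\<bar>\<bar>weight i s \<omega>\<bar> * sqrt (S2 i s \<omega>)\<bar> \<le> W + W * D"
      using W S2_nonneg[of i s \<omega>] by (simp add: abs_mult)
  next
    fix r s assume r: "r < s" and s: "s < t"
    then have rT: "r < T" "r \<le> T" using t by auto
    have up: "h \<in> borel_measurable (history M g (Suc s))" if "h \<in> borel_measurable (history M g (Suc r))"
      for h :: "'w \<Rightarrow> real"
      using measurable_history_mono[OF _ that, of "Suc s"] r by simp
    have "g (Suc r) \<in> borel_measurable (history M g (Suc s))" using r by (intro measurable_history) auto
    then have [measurable]: "(\<lambda>\<omega>. g (Suc r) \<omega> $ i) \<in> borel_measurable (history M g (Suc s))"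
      by (simp add: borel_measurable_vec_iff)
    note [measurable] = measurable_state[OF rT(2), of i, THEN up]
    show "(\<lambda>\<omega>. g (Suc r) \<omega> $ i - p i r \<omega>) \<in> borel_measurable (history M g (Suc s))
        \<and> weight i r \<in> borel_measurable (history M g (Suc s))
        \<and> (\<lambda>\<omega>. \<bar>weight i r \<omega>\<bar> * sqrt (S2 i r \<omega>)) \<in> borel_measurable (history M g (Suc s))"
      by (intro conjI) measurable
  qed
  then have "prob {\<omega> \<in> space M. deviation i t \<omega> > ln (1 / (\<delta> / (real CARD('d) * real T)))} \<le> \<delta> / (real CARD('d) * real T)"
    using \<delta> dT_pos by (intro exp_martingale_tail) (auto simp del: divide_divide_eq_right divide_divide_eq_left)
  then show ?thesis by simp
qed

definition good :: "'w set"
  where "good = {\<omega> \<in> space M. \<forall>k\<in>UNIV \<times> {1..T}.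
    deviation (fst k) (snd k) \<omega> \<le> ln (real CARD('d) * real T / \<delta>)}"

lemma prob_good: "1 - \<delta> \<le> prob good"
proof -
  let ?l = "ln (real CARD('d) * real T / \<delta>)"
  define I where "I = (UNIV :: 'd set) \<times> {1..T}"
  define bad where "bad k = {\<omega> \<in> space M. deviation (fst k) (snd k) \<omega> > ?l}" for k
  have I: "finite I" "real (card I) = real CARD('d) * real T" unfolding I_def by (simp, simp only: card_cartesian_product, simp)
  have bad: "bad k \<in> events" "prob (bad k) \<le> \<delta> / (real CARD('d) * real T)" if "k \<in> I" for k
  proof -
    have t: "snd k \<le> T" using that by (auto simp: I_def)
    note [measurable] = measurable_deviation[OF t, of "fst k"]
    show "bad k \<in> events" unfolding bad_def by measurable
    show "prob (bad k) \<le> \<delta> / (real CARD('d) * real T)" unfolding bad_def by (rule deviation_tail[OF t])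
  qed
  have good: "good = space M - (\<Union>k\<in>I. bad k)"
    unfolding good_def bad_def I_def[symmetric] not_le[symmetric] by blast
  have "prob (\<Union>k\<in>I. bad k) \<le> (\<Sum>k\<in>I. prob (bad k))"
    using bad(1) I(1) by (intro finite_measure_subadditive_finite) auto
  also have "\<dots> \<le> (\<Sum>k\<in>I. \<delta> / (real CARD('d) * real T))" by (intro sum_mono bad(2))
  also have "\<dots> = \<delta>" using T I(2) by simp
  finally have "prob (\<Union>k\<in>I. bad k) \<le> \<delta>" .
  moreover have "prob good = 1 - prob (\<Union>k\<in>I. bad k)"
    unfolding good using bad(1) I(1) by (intro prob_compl sets.finite_UN) auto
  ultimately show ?thesis by simp
qed

definition bound_event :: "'w set" where
  "bound_event = {\<omega> \<in> space M. \<forall>t\<in>{1..T}.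
            (norm (nabla f (x (t + 1) \<omega>)))\<^sup>2
              \<le> G - L * (\<Sum>i\<in>UNIV. \<Sum>s=1..t. adam_eta \<beta>1 \<beta>2 (C0 * sqrt (1 - \<beta>2)) s
                    * ((nabla f (x s \<omega>) $ i)\<^sup>2
                        / proxy_step f \<beta>2 (\<epsilon>0 * sqrt (1 - \<beta>2)) \<sigma>0 \<sigma>1 (\<lambda>r. x r \<omega>) (\<lambda>r. v r \<omega>) s i))}"

lemma good_bound: "AE \<omega> in M. \<omega> \<in> good \<longrightarrow> \<omega> \<in> bound_event"
proof -
  have "AE \<omega> in M. \<forall>s\<in>{..<T}. \<forall>i\<in>(UNIV::'d set). (g (Suc s) \<omega> $ i - p i s \<omega>)\<^sup>2 \<le> S2 i s \<omega>"
    using noise_AE by (intro AE_finite_allI) auto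
  with AE_space show ?thesis
  proof (eventually_elim, intro impI)
    case (elim \<omega>)
    interpret r: adam_run \<beta>1 \<beta>2 C0 \<epsilon>0 T x1 "\<lambda>s. g s \<omega>" "\<lambda>s. x s \<omega>" "\<lambda>s. m s \<omega>" "\<lambda>s. v s \<omega>"
      using run elim(1) .
    assume good: "\<omega> \<in> good"
    \<comment> \<open>The event concerns positive horizons; at \<open>t = 0\<close> the sum is empty.\<close>
    have dev: "deviation i t \<omega> \<le> ln (real CARD('d) * real T / \<delta>)" if "t \<le> T" for i t
    proof (cases "t = 0")
      case True
      then show ?thesis using log_nonneg by (simp add: deviation_def)
    next
      case False
      then show ?thesis using good that by (simp add: good_def)
    qed
    have bound: "(norm (nabla f (x (Suc t) \<omega>)))\<^sup>2
      \<le> G - L * (\<Sum>i\<in>UNIV. \<Sum>s<t. r.coord.eta (Suc s) * (p i s \<omega>)\<^sup>2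
          / r.coord.proxy i s ((p i s \<omega>)\<^sup>2 + S2 i s \<omega>))" if "t \<le> T" for t
      unfolding p_def S2_def G_def
      by (rule r.gradient_bound[OF smooth L lower infnorm_\<sigma>0_pos log_nonneg _ _ that])
        (use elim(2) dev in \<open>auto simp: p_def S2_def G_def deviation_def weight_def\<close>)
    have summand: "r.coord.eta (Suc s) * (p i s \<omega>)\<^sup>2 / r.coord.proxy i s ((p i s \<omega>)\<^sup>2 + S2 i s \<omega>)
        = adam_eta \<beta>1 \<beta>2 (C0 * sqrt (1 - \<beta>2)) (Suc s) * ((nabla f (x (Suc s) \<omega>) $ i)\<^sup>2
          / proxy_step f \<beta>2 (\<epsilon>0 * sqrt (1 - \<beta>2)) \<sigma>0 \<sigma>1 (\<lambda>r. x r \<omega>) (\<lambda>r. v r \<omega>) (Suc s) i)" for i s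
    proof -
      have "(p i s \<omega>)\<^sup>2 + S2 i s \<omega> = (\<sigma>0 $ i)\<^sup>2 + (1 + (\<sigma>1 $ i)\<^sup>2) * (p i s \<omega>)\<^sup>2"
        by (simp add: S2_def algebra_simps)
      then show ?thesis
        by (simp add: r.coord.proxy_def r.coord.eta_def r.coord.eps_def proxy_step_def p_def)
    qed
    show "\<omega> \<in> bound_event"
      unfolding bound_event_def
    proof (intro CollectI conjI ballI)
      fix t assume "t \<in> {1..T}"
      then show "(norm (nabla f (x (t + 1) \<omega>)))\<^sup>2
              \<le> G - L * (\<Sum>i\<in>UNIV. \<Sum>s=1..t. adam_eta \<beta>1 \<beta>2 (C0 * sqrt (1 - \<beta>2)) s
                    * ((nabla f (x s \<omega>) $ i)\<^sup>2
                        / proxy_step f \<beta>2 (\<epsilon>0 * sqrt (1 - \<beta>2)) \<sigma>0 \<sigma>1 (\<lambda>r. x r \<omega>) (\<lambda>r. v r \<omega>) s i))"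
        using bound[of t] unfolding summand by (simp add: sum.atLeast1_atMost_eq)
    qed (rule elim(1))
  qed
qed


lemma measurable_penalty:
  assumes "s \<in> {1..T}"
  shows "(\<lambda>\<omega>. adam_eta \<beta>1 \<beta>2 (C0 * sqrt (1 - \<beta>2)) s * ((nabla f (x s \<omega>) $ i)\<^sup>2
      / proxy_step f \<beta>2 (\<epsilon>0 * sqrt (1 - \<beta>2)) \<sigma>0 \<sigma>1 (\<lambda>r. x r \<omega>) (\<lambda>r. v r \<omega>) s i)) \<in> borel_measurable M"
proof -
  define r where "r = s - 1"
  have s: "s = Suc r" and r: "r \<le> T" using assms by (auto simp: r_def)
  have [measurable]: "(\<lambda>\<omega>. nabla f (x (Suc r) \<omega>) $ i) \<in> borel_measurable M"
    using to_M[OF r measurable_state(1)[OF r, of i]] by (simp add: p_def[abs_def])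
  have [measurable]: "(\<lambda>\<omega>. v r \<omega> $ i) \<in> borel_measurable M"
    using measurable_from_subalg[OF subalgebra_F[OF r] measurable_path_history(2)[OF r]]
    by (simp add: borel_measurable_vec_iff)
  show ?thesis unfolding s proxy_step_def diff_Suc_1 by measurable
qed

lemma penalty_nonneg:
  assumes "\<omega> \<in> space M" "s \<in> {1..T}"
  shows "0 \<le> adam_eta \<beta>1 \<beta>2 (C0 * sqrt (1 - \<beta>2)) s * ((nabla f (x s \<omega>) $ i)\<^sup>2
      / proxy_step f \<beta>2 (\<epsilon>0 * sqrt (1 - \<beta>2)) \<sigma>0 \<sigma>1 (\<lambda>r. x r \<omega>) (\<lambda>r. v r \<omega>) s i)"
proof -
  interpret c: adam_coordinate \<beta>1 \<beta>2 C0 \<epsilon>0 T "\<lambda>s. g s \<omega> $ i" "\<lambda>s. m s \<omega> $ i" "\<lambda>s. v s \<omega> $ i"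
    by (rule coordinate[OF assms(1)])
  have "0 \<le> \<beta>2 * v (s - 1) \<omega> $ i" using c.v_nonneg[of "s - 1"] c.\<beta>2_pos assms(2) by auto
  then have "0 \<le> proxy_step f \<beta>2 (\<epsilon>0 * sqrt (1 - \<beta>2)) \<sigma>0 \<sigma>1 (\<lambda>r. x r \<omega>) (\<lambda>r. v r \<omega>) s i"
    unfolding proxy_step_def using c.eps_nonneg[of s] params by (simp add: c.eps_def)
  then show ?thesis using c.eta_nonneg[of s] by (simp add: c.eta_def)
qed

lemma measurable_grad: "s \<le> T \<Longrightarrow> (\<lambda>\<omega>. nabla f (x (Suc s) \<omega>)) \<in> borel_measurable M"
  by (rule measurable_compose[OF measurable_from_subalg[OF subalgebra_F measurable_path_history(3)]
        borel_measurable_nabla[OF smooth]])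

lemma bound_event_in_events: "bound_event \<in> events"
  unfolding bound_event_def
proof (rule sets.sets_Collect_finite_All')
  fix t assume t: "t \<in> {1..T}"
  have [measurable]: "(\<lambda>\<omega>. nabla f (x (t + 1) \<omega>)) \<in> borel_measurable M" using measurable_grad t by simp
  have [measurable]: "(\<lambda>\<omega>. \<Sum>i\<in>(UNIV::'d set). \<Sum>s=1..t. adam_eta \<beta>1 \<beta>2 (C0 * sqrt (1 - \<beta>2)) s
      * ((nabla f (x s \<omega>) $ i)\<^sup>2
        / proxy_step f \<beta>2 (\<epsilon>0 * sqrt (1 - \<beta>2)) \<sigma>0 \<sigma>1 (\<lambda>r. x r \<omega>) (\<lambda>r. v r \<omega>) s i)) \<in> borel_measurable M"
    by (intro borel_measurable_sum measurable_penalty) (use t in auto)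
  show "{\<omega> \<in> space M. (norm (nabla f (x (t + 1) \<omega>)))\<^sup>2
              \<le> G - L * (\<Sum>i\<in>UNIV. \<Sum>s=1..t. adam_eta \<beta>1 \<beta>2 (C0 * sqrt (1 - \<beta>2)) s
                    * ((nabla f (x s \<omega>) $ i)\<^sup>2
                        / proxy_step f \<beta>2 (\<epsilon>0 * sqrt (1 - \<beta>2)) \<sigma>0 \<sigma>1 (\<lambda>r. x r \<omega>) (\<lambda>r. v r \<omega>) s i))} \<in> events"
    by measurable
qed (use T in auto)

lemma prob_bound_event: "1 - \<delta> \<le> prob bound_event"
  using prob_good finite_measure_mono_AE[OF good_bound bound_event_in_events] by linarith

text \<open>
  At the first iterate the gradient is deterministic, and the leading term of \<open>G\<close> suffices.
\<close>

lemma grad_x1_le: "(norm (nabla f x1))\<^sup>2 \<le> G"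
proof -
  let ?F = "F_const f x1 L \<sigma>0 \<sigma>1 \<beta>1 \<beta>2 C0 (\<epsilon>0 * sqrt (1 - \<beta>2)) T"
  have \<beta>: "0 < \<beta>2" "0 < 1 - \<beta>1 / \<beta>2" using params by auto
  have "1 \<le> ?F" unfolding F_const_def using \<beta> by simp
  moreover have "\<beta>2 ^ T \<le> 1" using params \<beta> by (intro power_le_one) auto
  ultimately have "1 \<le> ?F / \<beta>2 ^ T" using \<beta> by (simp add: pos_le_divide_eq)
  then have "0 \<le> ln (?F / \<beta>2 ^ T)" by simp
  from G_const_self_bounding(1)[OF params L lower[of x1] log_nonneg this]
  have "8 * L * (f x1 - fstar) \<le> G" unfolding G_def .
  moreover have "0 \<le> L * (f x1 - fstar)" using L lower[of x1] by simp
  ultimately show ?thesis using L_smooth_grad_sq_le[OF smooth L lower, of x1] by linarith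
qed

lemma prob_grad_bounded:
  "1 - \<delta> \<le> prob {\<omega> \<in> space M. \<forall>t\<in>{1..T + 1}. (norm (nabla f (x t \<omega>)))\<^sup>2 \<le> G}"
proof -
  have "bound_event \<subseteq> {\<omega> \<in> space M. \<forall>t\<in>{1..T + 1}. (norm (nabla f (x t \<omega>)))\<^sup>2 \<le> G}"
  proof safe
    fix \<omega> t assume \<omega>: "\<omega> \<in> bound_event" and t: "t \<in> {1..T + 1}"
    then have sp: "\<omega> \<in> space M" by (simp add: bound_event_def)
    show "(norm (nabla f (x t \<omega>)))\<^sup>2 \<le> G"
    proof (cases "t = 1")
      case True
      then show ?thesis using grad_x1_le process sp by (simp add: adam_process_def adam_path_def)
    next
      case False
      define r where "r = t - 1"
      have r: "r \<in> {1..T}" "t = r + 1" using t False by (auto simp: r_def)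
      have "0 \<le> (\<Sum>i\<in>(UNIV::'d set). \<Sum>s=1..r. adam_eta \<beta>1 \<beta>2 (C0 * sqrt (1 - \<beta>2)) s
          * ((nabla f (x s \<omega>) $ i)\<^sup>2
            / proxy_step f \<beta>2 (\<epsilon>0 * sqrt (1 - \<beta>2)) \<sigma>0 \<sigma>1 (\<lambda>r. x r \<omega>) (\<lambda>r. v r \<omega>) s i))" (is "0 \<le> ?S")
        using r by (intro sum_nonneg penalty_nonneg[OF sp]) auto
      then have "0 \<le> L * ?S" using L by simp
      moreover have "(norm (nabla f (x t \<omega>)))\<^sup>2 \<le> G - L * ?S"
        using \<omega> r by (simp add: bound_event_def)
      ultimately show ?thesis by linarith
    qed
  qed (simp add: bound_event_def)
  moreover have "{\<omega> \<in> space M. \<forall>t\<in>{1..T + 1}. (norm (nabla f (x t \<omega>)))\<^sup>2 \<le> G} \<in> events"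
  proof (rule sets.sets_Collect_finite_All')
    fix t assume "t \<in> {1..T + 1}"
    then have [measurable]: "(\<lambda>\<omega>. nabla f (x t \<omega>)) \<in> borel_measurable M"
      using measurable_grad[of "t - 1"] by (auto simp: le_diff_conv)
    show "{\<omega> \<in> space M. (norm (nabla f (x t \<omega>)))\<^sup>2 \<le> G} \<in> events" by measurable
  qed auto
  ultimately have "prob bound_event \<le> prob {\<omega> \<in> space M. \<forall>t\<in>{1..T + 1}. (norm (nabla f (x t \<omega>)))\<^sup>2 \<le> G}"
    by (rule finite_measure_mono)
  with prob_bound_event show ?thesis by linarith
qed

end

theorem proposition12:
  fixes f :: "real^'d \<Rightarrow> real"
    and fstar L \<beta>1 \<beta>2 \<eta> \<epsilon> C0 \<epsilon>0 \<delta> :: real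
    and T :: nat
    and x1 \<sigma>0 \<sigma>1 :: "real^'d"
    and M :: "'w measure"
    and orc :: "nat \<Rightarrow> real^'d \<Rightarrow> 'w \<Rightarrow> real^'d"
    and g x m v :: "nat \<Rightarrow> 'w \<Rightarrow> real^'d"
  assumes "T \<ge> 1" and "L > 0"
    and "L_smooth L f"
    and "\<And>y. fstar \<le> f y"
    and "\<And>i. \<sigma>0 $ i > 0" and "\<And>i. \<sigma>1 $ i > 0"
    and "0 \<le> \<beta>1" and "\<beta>1 < \<beta>2" and "\<beta>2 < 1"
    and "C0 > 0" and "\<epsilon>0 > 0"
    and "\<eta> = C0 * sqrt (1 - \<beta>2)" and "\<epsilon> = \<epsilon>0 * sqrt (1 - \<beta>2)"
    and "prob_space M"
    and "stochastic_oracle M T orc g"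
    and "unbiased M T f orc g"
    and "affine_variance_noise M T f \<sigma>0 \<sigma>1 orc g"
    and "adam_process M \<beta>1 \<beta>2 \<epsilon> \<eta> T x1 orc g x m v"
    and "0 < \<delta>" and "\<delta> < 1"
  shows "measure M {\<omega> \<in> space M. \<forall>t\<in>{1..T}.
            (norm (nabla f (x (t + 1) \<omega>)))\<^sup>2
              \<le> G_const f fstar x1 L \<sigma>0 \<sigma>1 \<beta>1 \<beta>2 C0 \<epsilon>0 T \<delta>
                - L * (\<Sum>i\<in>UNIV. \<Sum>s=1..t. adam_eta \<beta>1 \<beta>2 \<eta> s
                    * ((nabla f (x s \<omega>) $ i)\<^sup>2
                        / proxy_step f \<beta>2 \<epsilon> \<sigma>0 \<sigma>1 (\<lambda>r. x r \<omega>) (\<lambda>r. v r \<omega>) s i))}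
          \<ge> 1 - \<delta>
       \<and> measure M {\<omega> \<in> space M. \<forall>t\<in>{1..T + 1}.
            (norm (nabla f (x t \<omega>)))\<^sup>2
              \<le> G_const f fstar x1 L \<sigma>0 \<sigma>1 \<beta>1 \<beta>2 C0 \<epsilon>0 T \<delta>}
          \<ge> 1 - \<delta>"
proof -
  interpret adam_random M f fstar L \<beta>1 \<beta>2 C0 \<epsilon>0 \<delta> T x1 \<sigma>0 \<sigma>1 orc g x m v
    using assms by (auto simp: adam_random_def adam_random_axioms_def)
  show ?thesis
    using prob_bound_event prob_grad_bounded
    unfolding bound_event_def G_def \<open>\<eta> = C0 * sqrt (1 - \<beta>2)\<close> \<open>\<epsilon> = \<epsilon>0 * sqrt (1 - \<beta>2)\<close> by simp
qed

end
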